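(* Let $n\ge 0$ be an integer, and let $f^\pm(x,y)=\sum_{i+j=0}^n a^\pm_{i,j}x^iy^j$ and $g^\pm(x,y)=\sum_{i+j=0}^n b^\pm_{i,j}x^iy^j$ be arbitrary real polynomials of degree at most $n$. For each of the four cases $S_1$, $S_2$, $(r19)$, $(r20)$ (with the corresponding $k$, $H$, $\Sigma$, $\Gamma_h^\pm$ given in the context), consider the Abelian integral $$M(h)=\int_{\Gamma^+_h}x^{-k-1}\big[g^+(x,y)\,dx-f^+(x,y)\,dy\big]+\int_{\Gamma^-_h}x^{-k-1}\big[g^-(x,y)\,dx-f^-(x,y)\,dy\big],\qquad h\in\Sigma .$$ Then the number of isolated zeros of $M$ in $\Sigma$, counted with multiplicity, satisfies the following. (i) For $S_1$ it is at most $4n+30$ for every $n\ge 0$. For $S_2$ it is at most $10n-4$ if $n\ge 1$, and at most $2$ if $n=0$. (ii) For $(r19)$ it is at most $4n-3$ if $n\ge 4$, and at most $11$ if $n\in\{0,1,2,3\}$. For $(r20)$ it is at most $4n+3$ if $n\ge 3$, and at most $8$ if $n\in\{0,1,2\}$.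
   Context: In each case set $H(x,y)=x^{-k}\big(\tfrac12y^2+\lambda_2x^2+\lambda_1x+\lambda_0\big)$, a first integral of the stated planar system, with the following data. $S_1$: system $\dot x=\sqrt2\,xy,\ \dot y=\tfrac{\sqrt2}{4}(1-x^2+2y^2)$; $k=1$, $\lambda_2=\tfrac14$, $\lambda_1=-\tfrac12$, $\lambda_0=\tfrac14$; $\Sigma=(-\infty,-1)\cup(0,+\infty)$ (the level curves with $h>0$ are closed orbits around the center $(1,0)$ in $x>0$, those with $h<-1$ are closed orbits around the center $(-1,0)$ in $x<0$). $S_2$: system $\dot x=\tfrac{\sqrt2}{2}xy,\ \dot y=\tfrac{\sqrt2}{2}(2-2x+y^2)$; $k=2$, $\lambda_2=1$, $\lambda_1=-2$, $\lambda_0=1$; $\Sigma=(0,1)$ (closed orbits around $(1,0)$ in $x>0$). $(r19)$: system $\dot x=-xy,\ \dot y=-\tfrac34y^2+\tfrac1{2^8}x^2-\tfrac1{2^8}x$; $k=\tfrac32$, $\lambda_2=\lambda_1=\tfrac1{2^7}$, $\lambda_0=0$; $\Sigma=(\tfrac1{2^6},+\infty)$ (closed orbits around $(1,0)$ in $x>0$). $(r20)$: system $\dot x=-xy,\ \dot y=-\tfrac14y^2+\tfrac1{2^8}x-\tfrac1{2^8}$; $k=\tfrac12$, $\lambda_2=0$, $\lambda_1=\lambda_0=\tfrac1{2^7}$; $\Sigma=(\tfrac1{2^6},+\infty)$ (closed orbits around $(1,0)$ in $x>0$). For $h\in\Sigma$, $\Gamma_h^+=\{(x,y): H(x,y)=h,\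 y>0\}$ and $\Gamma_h^-=\{(x,y): H(x,y)=h,\ y<0\}$ are the upper and lower arcs of the closed orbit $\{H=h\}$, both oriented by the flow of the stated system. The sums $\sum_{i+j=0}^n$ run over integers $i,j\ge0$ with $i+j\le n$. *)

theory Defs
  imports "HOL-Analysis.Analysis"
begin

section \<open>The four planar systems\<close>

datatype case_id = S1 | S2 | R19 | R20

text \<open>
  For the integral exponents (\<open>S1\<close>, \<open>S2\<close>) a power of a negative \<open>x\<close> has to make sense, whereas
  \<open>powr\<close> is meant for positive bases only.
\<close>

definition rpow :: "real \<Rightarrow> real \<Rightarrow> real" where
  "rpow x a = (if a \<in> \<int> then x powi \<lfloor>a\<rfloor> else x powr a)"

fun kk :: "case_id \<Rightarrow> real" where
  "kk S1 = 1" | "kk S2 = 2" | "kk R19 = 3/2" | "kk R20 = 1/2"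

fun lam2 :: "case_id \<Rightarrow> real" where
  "lam2 S1 = 1/4" | "lam2 S2 = 1" | "lam2 R19 = 1/2^7" | "lam2 R20 = 0"

fun lam1 :: "case_id \<Rightarrow> real" where
  "lam1 S1 = -1/2" | "lam1 S2 = -2" | "lam1 R19 = 1/2^7" | "lam1 R20 = 1/2^7"

fun lam0 :: "case_id \<Rightarrow> real" where
  "lam0 S1 = 1/4" | "lam0 S2 = 1" | "lam0 R19 = 0" | "lam0 R20 = 1/2^7"

fun vfield :: "case_id \<Rightarrow> real \<times> real \<Rightarrow> real \<times> real" where
  "vfield S1 (x, y) = (sqrt 2 * x * y, sqrt 2 / 4 * (1 - x^2 + 2 * y^2))"
| "vfield S2 (x, y) = (sqrt 2 / 2 * x * y, sqrt 2 / 2 * (2 - 2 * x + y^2))"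
| "vfield R19 (x, y) = (- x * y, - 3/4 * y^2 + 1/2^8 * x^2 - 1/2^8 * x)"
| "vfield R20 (x, y) = (- x * y, - 1/4 * y^2 + 1/2^8 * x - 1/2^8)"

text \<open>
  The abscissae of the closed orbits. For \<open>S1\<close> both half-planes occur: the level curves with \<open>h > 0\<close>
  lie in \<open>x > 0\<close>, those with \<open>h < -1\<close> in \<open>x < 0\<close>.
\<close>

fun xdom :: "case_id \<Rightarrow> real set" where
  "xdom S1 = - {0}" | "xdom S2 = {0<..}" | "xdom R19 = {0<..}" | "xdom R20 = {0<..}"

fun Sigma_h :: "case_id \<Rightarrow> real set" where
  "Sigma_h S1 = {..<-1} \<union> {0<..}"
| "Sigma_h S2 = {0<..<1}"
| "Sigma_h R19 = {1/2^6<..}"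
| "Sigma_h R20 = {1/2^6<..}"

definition HH :: "case_id \<Rightarrow> real \<Rightarrow> real \<Rightarrow> real" where
  "HH c x y = rpow x (- kk c) * (1/2 * y^2 + lam2 c * x^2 + lam1 c * x + lam0 c)"

definition upper_arc :: "case_id \<Rightarrow> real \<Rightarrow> (real \<times> real) set" where
  "upper_arc c h = {(x, y). x \<in> xdom c \<and> HH c x y = h \<and> y > 0}"

definition lower_arc :: "case_id \<Rightarrow> real \<Rightarrow> (real \<times> real) set" where
  "lower_arc c h = {(x, y). x \<in> xdom c \<and> HH c x y = h \<and> y < 0}"


section \<open>Line integrals along arcs oriented by a flow\<close>

definition flow_param ::
  "(real \<times> real \<Rightarrow> real \<times> real) \<Rightarrow> (real \<times> real) set \<Rightarrow> (real \<Rightarrow> real \<times> real) \<Rightarrow> real \<Rightarrow> real \<Rightarrow> bool"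
  where
  "flow_param X \<Gamma> \<gamma> a b \<longleftrightarrow> a < b \<and> bij_betw \<gamma> {a<..<b} \<Gamma> \<and>
     (\<forall>t\<in>{a<..<b}. (\<gamma> has_vector_derivative X (\<gamma> t)) (at t))"

text \<open>
  The integral of \<open>P dx + Q dy\<close> over the arc \<open>\<Gamma>\<close>, parametrized by a solution of the system \<open>X\<close>, so
  that \<open>dx\<close> and \<open>dy\<close> are the components of \<open>X (\<gamma> t) dt\<close>. Such a parametrization is unique up to a
  translation of time.
\<close>

definition flow_integral ::
  "(real \<times> real \<Rightarrow> real \<times> real) \<Rightarrow> (real \<times> real) set \<Rightarrow>
    (real \<times> real \<Rightarrow> real) \<Rightarrow> (real \<times> real \<Rightarrow> real) \<Rightarrow> real"
  where
  "flow_integral X \<Gamma> P Q = (THE I. \<exists>\<gamma> a b. flow_param X \<Gamma> \<gamma> a b \<and>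
     ((\<lambda>t. P (\<gamma> t) * fst (X (\<gamma> t)) + Q (\<gamma> t) * snd (X (\<gamma> t))) has_integral I) {a<..<b})"

definition bipoly :: "nat \<Rightarrow> (nat \<Rightarrow> nat \<Rightarrow> real) \<Rightarrow> real \<Rightarrow> real \<Rightarrow> real" where
  "bipoly n a x y = (\<Sum>(i, j)\<in>{(i, j). i + j \<le> n}. a i j * x ^ i * y ^ j)"

text \<open>
  The coefficient arrays \<open>ap\<close>, \<open>am\<close>, \<open>bp\<close>, \<open>bm\<close> are those of \<open>f\<^sup>+\<close>, \<open>f\<^sup>-\<close>, \<open>g\<^sup>+\<close>, \<open>g\<^sup>-\<close>.
\<close>

definition MM ::
  "case_id \<Rightarrow> nat \<Rightarrow> (nat \<Rightarrow> nat \<Rightarrow> real) \<Rightarrow> (nat \<Rightarrow> nat \<Rightarrow> real) \<Rightarrow>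
    (nat \<Rightarrow> nat \<Rightarrow> real) \<Rightarrow> (nat \<Rightarrow> nat \<Rightarrow> real) \<Rightarrow> real \<Rightarrow> real"
  where
  "MM c n ap am bp bm h =
     flow_integral (vfield c) (upper_arc c h)
       (\<lambda>(x, y). rpow x (- kk c - 1) * bipoly n bp x y)
       (\<lambda>(x, y). - (rpow x (- kk c - 1) * bipoly n ap x y))
   + flow_integral (vfield c) (lower_arc c h)
       (\<lambda>(x, y). rpow x (- kk c - 1) * bipoly n bm x y)
       (\<lambda>(x, y). - (rpow x (- kk c - 1) * bipoly n am x y))"


section \<open>Isolated zeros counted with multiplicity\<close>

text \<open>
  The first \<open>m\<close> derivatives are required to exist near \<open>z\<close>, instead of iterating \<open>deriv\<close>, whose value
  is unspecified at points of non-differentiability.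
\<close>

definition has_zero_order :: "(real \<Rightarrow> real) \<Rightarrow> real \<Rightarrow> nat \<Rightarrow> bool" where
  "has_zero_order f z m \<longleftrightarrow> (\<exists>D :: nat \<Rightarrow> real \<Rightarrow> real.
     D 0 = f \<and>
     (\<forall>j<m. \<forall>\<^sub>F t in nhds z. (D j has_real_derivative D (Suc j) t) (at t)) \<and>
     (\<forall>j<m. D j z = 0) \<and> D m z \<noteq> 0)"

definition zero_mult :: "(real \<Rightarrow> real) \<Rightarrow> real \<Rightarrow> enat" where
  "zero_mult f z = (INF m\<in>{m. has_zero_order f z m}. enat m)"

definition isolated_zeros :: "(real \<Rightarrow> real) \<Rightarrow> real set \<Rightarrow> real set" where
  "isolated_zeros f S = {z. z isolated_in {x \<in> S. f x = 0}}"

definition num_isolated_zeros :: "(real \<Rightarrow> real) \<Rightarrow> real set \<Rightarrow> enat" where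
  "num_isolated_zeros f S =
     (if finite (isolated_zeros f S) then \<Sum>z\<in>isolated_zeros f S. zero_mult f z else \<infinity>)"

end

theory Submission
  imports Defs
begin

text \<open>
  In suitable variables all four families of closed orbits become the same family of conics
  \<open>w\<^sup>2 = 2 s cosh t - s\<^sup>2 - 1\<close>, parametrized by \<open>s = cosh t + sinh t cos \<theta>\<close>, \<open>w = sinh t sin \<theta>\<close>:
  every arc has the form \<open>x = A s\<^sup>\<alpha>\<close>, \<open>y = B s\<^sup>\<beta> w\<close> with integers \<open>\<alpha>\<close>, \<open>\<beta>\<close>, and \<open>h\<close> is a function of
  \<open>cosh t\<close>. After an integration by parts, \<open>M\<close> is a linear combination of the integrals
  \<open>\<integral> s\<^sup>q w\<^sup>j\<^sup>+\<^sup>1 d\<theta>\<close> over \<open>[0, \<pi>]\<close> with integer \<open>q\<close>. Recursions in \<open>q\<close> and \<open>j\<close> show that these are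
  exponential polynomials in \<open>t\<close> with integer frequencies and coefficients of degree at most one, and
  they control which frequencies occur. A nonzero exponential polynomial in an \<open>N\<close>-dimensional space
  of this kind has at most \<open>N - 1\<close> real zeros by Rolle's theorem; here one of them is \<open>t = 0\<close>, which
  does not correspond to any \<open>h \<in> \<Sigma>\<close>. Counting frequencies gives bounds that are at least as good as
  the claimed ones.
\<close>

section \<open>Zeros of exponential polynomials\<close>

text \<open>The end abscissae of every orbit are scaled to the reciprocal numbers exp (- t) and exp
  t, and w d\<theta> = - ds, so the basic integrals are those of s^q w^j ds between them. They are
  invariant under s -> 1/s, which sends q to - q - j - 2; hence their frequencies are governed by
  the pair of bounds - q - 1 and q + j + 1, which this symmetry exchanges. For even j everything
  descends to powers of s, and a factor t stems from the integral of ds/s alone. For odd j the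
  three-term recursion decouples at q = 0 and at q = -3: it is run upwards and downwards from there,
  and the gap q = -1, -2 needs an evaluation by hand. Below each bound the frequencies have a fixed
  parity, which roughly halves the count. Multiplicities are defined by derivatives in h, whereas
  Rolle's argument lives in t; orders of vanishing are therefore turned into limits of quotients,
  which survive the substitution without a formula for higher derivatives of a composition.\<close>

definition chain :: "(nat \<Rightarrow> real \<Rightarrow> real) \<Rightarrow> bool" where
  "chain D \<longleftrightarrow> (\<forall>j t. (D j has_real_derivative D (Suc j) t) (at t))"

text \<open>The product of the operators d/dt - k over \<open>ks\<close> kills \<open>D 0\<close>.
  It acts on the whole sequence of derivatives, so that each factor returns a sequence of the same
  kind.\<close>

fun annihilated :: "real list \<Rightarrow> (nat \<Rightarrow> real \<Rightarrow> real) \<Rightarrow> bool" where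
  "annihilated [] D \<longleftrightarrow> (\<forall>t. D 0 t = 0)"
| "annihilated (k # ks) D \<longleftrightarrow> annihilated ks (\<lambda>j t. D (Suc j) t - k * D j t)"

lemma chain_shift: "chain D \<Longrightarrow> chain (\<lambda>j t. D (Suc j) t - k * D j t)"
  unfolding chain_def by (auto intro!: derivative_eq_intros)

lemma annihilated_add:
  "annihilated ks D \<Longrightarrow> annihilated ks D' \<Longrightarrow> annihilated ks (\<lambda>j t. D j t + D' j t)"
proof (induction ks arbitrary: D D')
  case (Cons k ks)
  then have "annihilated ks (\<lambda>j t. (D (Suc j) t - k * D j t) + (D' (Suc j) t - k * D' j t))"
    by (simp only: annihilated.simps)
  then show ?case by (simp add: algebra_simps)
qed simp

lemma annihilated_scale:
  "annihilated ks D \<Longrightarrow> annihilated ks (\<lambda>j t. c * D j t)"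
proof (induction ks arbitrary: D)
  case (Cons k ks)
  then have "annihilated ks (\<lambda>j t. c * (D (Suc j) t - k * D j t))"
    by simp
  then show ?case by (simp add: algebra_simps)
qed simp

lemma annihilated_zero: "annihilated ks (\<lambda>j t. 0)"
  by (induction ks) auto

lemma annihilated_exp:
  "k \<in> set ks \<Longrightarrow> annihilated ks (\<lambda>j t. k ^ j * exp (k * t))"
proof (induction ks)
  case (Cons l ks)
  have *: "(\<lambda>j t. k ^ Suc j * exp (k * t) - l * (k ^ j * exp (k * t)))
      = (\<lambda>j t. (k - l) * (k ^ j * exp (k * t)))"
    by (simp add: fun_eq_iff algebra_simps)
  show ?case
  proof (cases "k = l")
    case True
    then show ?thesis using annihilated_zero by simp
  next
    case False
    then show ?thesis using Cons annihilated_scale[of ks _ "k - l"]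
      unfolding annihilated.simps * by simp
  qed
qed simp

text \<open>The factor d/dt - l multiplies t exp (k t) by k - l and adds exp (k t). For l = k only
  exp (k t) remains, to be killed by a second k in the list. At j = 0 the term
  \<open>k ^ (j - 1)\<close> is harmless because of its factor \<open>real j\<close>.\<close>

lemma annihilated_t_exp:
  "2 \<le> count_list ks k \<Longrightarrow>
    annihilated ks (\<lambda>j t. (k ^ j * t + real j * k ^ (j - 1)) * exp (k * t))"
proof (induction ks)
  case (Cons l ks)
  have *: "(\<lambda>j t. (k ^ Suc j * t + real (Suc j) * k ^ (Suc j - 1)) * exp (k * t)
        - l * ((k ^ j * t + real j * k ^ (j - 1)) * exp (k * t)))
      = (\<lambda>j t. (k - l) * ((k ^ j * t + real j * k ^ (j - 1)) * exp (k * t)) + k ^ j * exp (k * t))"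
  proof (intro ext)
    fix j t
    show "(k ^ Suc j * t + real (Suc j) * k ^ (Suc j - 1)) * exp (k * t)
        - l * ((k ^ j * t + real j * k ^ (j - 1)) * exp (k * t))
      = (k - l) * ((k ^ j * t + real j * k ^ (j - 1)) * exp (k * t)) + k ^ j * exp (k * t)"
      by (cases j) (simp_all add: algebra_simps)
  qed
  show ?case
  proof (cases "k = l")
    case True
    then have "count_list ks k > 0" using Cons.prems by simp
    then have "k \<in> set ks" by (metis count_notin less_irrefl)
    then show ?thesis unfolding annihilated.simps *
      using True by (simp add: annihilated_exp)
  next
    case False
    then have c: "2 \<le> count_list ks k" using Cons.prems by simp
    then have "k \<in> set ks" by (metis count_notin not_numeral_le_zero)
    then show ?thesis unfolding annihilated.simps *
      by (intro annihilated_add annihilated_scale annihilated_exp Cons.IH c)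
  qed
qed simp

text \<open>\<open>C\<close> collects one Rolle point between any two neighbours in
  \<open>Z\<close>. The bound \<open>c < Max Z\<close> carries the induction: when a new maximum is
  added, the new point lies beyond the old maximum and so differs from all earlier ones.\<close>

lemma Rolle_finite:
  fixes f f' :: "real \<Rightarrow> real"
  assumes "finite Z" "Z \<noteq> {}" and "\<And>z. z \<in> Z \<Longrightarrow> f z = 0"
    and der: "\<And>t. (f has_real_derivative f' t) (at t)"
  shows "\<exists>C. finite C \<and> C \<inter> Z = {} \<and> Suc (card C) = card Z \<and> (\<forall>c\<in>C. f' c = 0 \<and> c < Max Z)"
  using assms(1-3)
proof (induction Z rule: finite_linorder_max_induct)
  case (insert b A)
  show ?case
  proof (cases "A = {}")
    case True
    then show ?thesis by (intro exI[of _ "{}"]) auto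
  next
    case False
    then obtain C where C: "finite C" "C \<inter> A = {}" "Suc (card C) = card A"
        "\<forall>c\<in>C. f' c = 0 \<and> c < Max A"
      using insert by (metis insertCI)
    have M: "Max A \<in> A" "Max A < b" using False insert by auto
    obtain c where c: "Max A < c" "c < b" "f' c = 0"
    proof -
      have "\<exists>z. Max A < z \<and> z < b \<and> DERIV f z :> 0"
      proof (rule Rolle)
        show "f (Max A) = f b" using insert M by simp
        show "continuous_on {Max A..b} f"
          using der by (meson DERIV_isCont continuous_at_imp_continuous_on)
        show "\<And>x. f differentiable (at x)" using der real_differentiable_def by blast
      qed (use M in auto)
      then show ?thesis using that der DERIV_unique by blast
    qed
    have "c \<notin> A" using c insert(1) by (meson Max_ge not_le)
    moreover have "c \<notin> C" "b \<notin> C" "b \<noteq> c" using C(4) c M by auto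
    moreover have "b \<notin> A" using insert(2) by auto
    moreover have "Max (insert b A) = b" using insert(1,2)
      by (intro Max_eqI) (auto intro: less_imp_le)
    ultimately show ?thesis
      using C c M insert(1)
      by (intro exI[of _ "insert c C"]) (auto simp: intro: less_trans)
  qed
qed simp

text \<open>
  Rolle's theorem for \<open>exp (- k t) D\<^sub>0 t\<close> trades one annihilating factor for one zero.
\<close>

lemma sum_zero_orders_less:
  assumes "chain D" "annihilated ks D" "D 0 t0 \<noteq> 0" "finite Z"
    and "\<And>z j. z \<in> Z \<Longrightarrow> j < \<mu> z \<Longrightarrow> D j z = 0"
  shows "sum \<mu> Z < length ks"
  using assms
proof (induction ks arbitrary: D t0 Z \<mu>)
  case (Cons k ks)
  define D1 where "D1 = (\<lambda>j t. D (Suc j) t - k * D j t)"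
  define g where "g = (\<lambda>t. exp (- k * t) * D 0 t)"
  have g: "(g has_real_derivative exp (- k * t) * D1 0 t) (at t)" for t
    using Cons.prems(1) unfolding chain_def g_def D1_def
    by (auto intro!: derivative_eq_intros simp: algebra_simps)
  have D1: "chain D1" "annihilated ks D1"
    using chain_shift Cons.prems(1,2) unfolding D1_def by auto
  \<comment> \<open>Points of order 0 are dropped, so that the truncated subtraction
    \<open>\<mu> z - 1\<close> below really lowers the order by one.\<close>
  define Z1 where "Z1 = {z\<in>Z. \<mu> z > 0}"
  have "finite Z1" using Cons.prems(4) unfolding Z1_def by auto
  have Z1: "sum \<mu> Z = sum \<mu> Z1"
    unfolding Z1_def using Cons.prems(4) by (intro sum.mono_neutral_right) auto
  have gz: "g z = 0" if "z \<in> Z1" for z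
    using Cons.prems(5)[of z 0] that unfolding Z1_def g_def by auto
  show ?case
  proof (cases "Z1 = {}")
    case False
    obtain C where C: "finite C" "C \<inter> Z1 = {}" "Suc (card C) = card Z1" "\<forall>c\<in>C. D1 0 c = 0"
      using Rolle_finite[OF \<open>finite Z1\<close> False gz g] by auto
    \<comment> \<open>Otherwise \<open>g\<close> is constant; as it vanishes on \<open>Z1\<close>,
      this contradicts \<open>D 0 t0 \<noteq> 0\<close>.\<close>
    have "\<exists>t1. D1 0 t1 \<noteq> 0"
    proof (rule ccontr)
      assume "\<nexists>t1. D1 0 t1 \<noteq> 0"
      then have "(g has_real_derivative 0) (at t)" for t using g[of t] by simp
      then have "g x = g y" for x y using DERIV_isconst_all by blast
      moreover obtain z where "z \<in> Z1" using False by blast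
      ultimately have "g t0 = 0" using gz by metis
      then show False using Cons.prems(3) unfolding g_def by simp
    qed
    then obtain t1 where t1: "D1 0 t1 \<noteq> 0" by blast
    \<comment> \<open>\<open>D1\<close> keeps each old zero with its order lowered by one and gains
      the Rolle points: \<open>card Z1\<close> is lost and \<open>card Z1 - 1\<close> is gained, so
      the total drops by one, like the length of the list.\<close>
    define \<mu>' where "\<mu>' = (\<lambda>z. if z \<in> C then 1 else \<mu> z - 1)"
    have "sum \<mu>' (Z1 \<union> C) < length ks"
    proof (rule Cons.IH[OF D1 t1])
      fix z j assume z: "z \<in> Z1 \<union> C" and j: "j < \<mu>' z"
      show "D1 j z = 0"
      proof (cases "z \<in> C")
        case True
        then show ?thesis using C(4) j by (simp add: \<mu>'_def)
      next
        case False
        then have "z \<in> Z" "Suc j < \<mu> z" using z j by (auto simp: \<mu>'_def Z1_def)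
        then show ?thesis using Cons.prems(5)[of z j] Cons.prems(5)[of z "Suc j"]
          by (simp add: D1_def)
      qed
    qed (use C \<open>finite Z1\<close> in auto)
    moreover have "sum \<mu>' (Z1 \<union> C) = sum \<mu>' Z1 + sum \<mu>' C"
      using C \<open>finite Z1\<close> by (intro sum.union_disjoint) auto
    moreover have "sum \<mu>' C = card C" by (simp add: \<mu>'_def)
    moreover have "sum \<mu>' Z1 + card Z1 = sum \<mu> Z1"
    proof -
      have "sum \<mu>' Z1 + card Z1 = (\<Sum>z\<in>Z1. \<mu>' z + 1)"
        by (simp only: sum.distrib card_eq_sum)
      also have "\<dots> = sum \<mu> Z1" using C(2) by (intro sum.cong) (auto simp: \<mu>'_def Z1_def)
      finally show ?thesis .
    qed
    ultimately show ?thesis using Z1 C(3) by simp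
  qed (simp add: Z1)
qed simp

section \<open>Spaces of exponential polynomials with prescribed integer frequencies\<close>

inductive exp_span :: "int set \<Rightarrow> int set \<Rightarrow> (real \<Rightarrow> real) \<Rightarrow> bool" for A B where
  zero: "exp_span A B (\<lambda>t. 0)"
| add: "exp_span A B f \<Longrightarrow> exp_span A B g \<Longrightarrow> exp_span A B (\<lambda>t. f t + g t)"
| scale: "exp_span A B f \<Longrightarrow> exp_span A B (\<lambda>t. c * f t)"
| exp: "k \<in> A \<Longrightarrow> exp_span A B (\<lambda>t. exp (of_int k * t))"
| t_exp: "k \<in> B \<Longrightarrow> exp_span A B (\<lambda>t. t * exp (of_int k * t))"

text \<open>\<open>B \<subseteq> A\<close> makes each frequency of \<open>B\<close> occur twice in
  \<open>as @ bs\<close>, the double root that t exp (k t) requires.\<close>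

lemma exp_span_chain:
  assumes "exp_span A B f" "finite A" "B \<subseteq> A"
  shows "\<exists>D ks. chain D \<and> annihilated ks D \<and> D 0 = f \<and> length ks = card A + card B"
proof -
  have "finite B" using assms finite_subset by blast
  obtain as where as: "set as = A" "distinct as" using assms(2) finite_distinct_list by blast
  obtain bs where bs: "set bs = B" "distinct bs" using \<open>finite B\<close> finite_distinct_list by blast
  define ks where "ks = map real_of_int (as @ bs)"
  have "length ks = card A + card B"
    using as bs by (simp add: ks_def distinct_card[symmetric])
  moreover have "\<exists>D. chain D \<and> annihilated ks D \<and> D 0 = f"
    using assms(1)
  proof induction
    case zero
    then show ?case
      by (intro exI[of _ "\<lambda>j t. 0"]) (auto simp: chain_def annihilated_zero)
  next
    case (add f g)
    then obtain D D' where "chain D" "annihilated ks D" "D 0 = f" "chain D'" "annihilated ks D'"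
      "D' 0 = g" by blast
    then show ?case
      by (intro exI[of _ "\<lambda>j t. D j t + D' j t"])
        (auto simp: chain_def intro!: annihilated_add derivative_eq_intros)
  next
    case (scale f c)
    then obtain D where "chain D" "annihilated ks D" "D 0 = f" by blast
    then show ?case
      by (intro exI[of _ "\<lambda>j t. c * D j t"])
        (auto simp: chain_def intro!: annihilated_scale derivative_eq_intros)
  next
    case (exp k)
    then have "real_of_int k \<in> set ks" using as by (auto simp: ks_def)
    then show ?case
      by (intro exI[of _ "\<lambda>j t. (of_int k) ^ j * exp (of_int k * t)"])
        (auto simp: chain_def annihilated_exp intro!: derivative_eq_intros)
  next
    case (t_exp k)
    then have "k \<in> set as" "k \<in> set bs" using as bs assms(3) by auto
    then have "1 \<le> count_list as k" "1 \<le> count_list bs k"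
      using count_list_0_iff[of as k] count_list_0_iff[of bs k] by linarith+
    moreover have "count_list (map real_of_int xs) (of_int k) = count_list xs k" for xs
      by (induction xs) auto
    ultimately have "2 \<le> count_list ks (of_int k)" by (simp add: ks_def)
    moreover have "chain (\<lambda>j t. ((of_int k) ^ j * t + real j * (of_int k) ^ (j - 1))
        * exp (of_int k * t))"
      unfolding chain_def
    proof (intro allI)
      fix j t
      show "((\<lambda>t. ((of_int k) ^ j * t + real j * (of_int k) ^ (j - 1)) * exp (of_int k * t))
        has_real_derivative ((of_int k) ^ Suc j * t + real (Suc j) * (of_int k) ^ (Suc j - 1))
        * exp (of_int k * t)) (at t)"
        by (cases j) (auto intro!: derivative_eq_intros simp: algebra_simps)
    qed
    ultimately show ?case
      by (intro exI[of _ "\<lambda>j t. ((of_int k) ^ j * t + real j * (of_int k) ^ (j - 1))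
          * exp (of_int k * t)"] conjI annihilated_t_exp) auto
  qed
  ultimately show ?thesis by blast
qed

lemma exp_span_mono:
  "exp_span A B f \<Longrightarrow> A \<subseteq> A' \<Longrightarrow> B \<subseteq> B' \<Longrightarrow> exp_span A' B' f"
  by (induction rule: exp_span.induct) (auto intro: exp_span.intros)

lemma cosh_mult_exp:
  "cosh t * exp (of_int k * t) = (1/2) * (exp (of_int (k + 1) * t) + exp (of_int (k - 1) * t))"
  for t :: real
proof -
  have "exp (of_int (k + 1) * t) = exp t * exp (of_int k * t)"
    "exp (of_int (k - 1) * t) = exp (- t) * exp (of_int k * t)"
    by (simp_all add: algebra_simps flip: exp_add)
  then show ?thesis by (simp add: cosh_def algebra_simps)
qed

lemma exp_span_cosh:
  assumes "exp_span A B f"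
    and "\<And>k. k \<in> A \<Longrightarrow> k + 1 \<in> A' \<and> k - 1 \<in> A'"
    and "\<And>k. k \<in> B \<Longrightarrow> k + 1 \<in> B' \<and> k - 1 \<in> B'"
  shows "exp_span A' B' (\<lambda>t. cosh t * f t)"
  using assms(1)
proof induction
  case zero
  then show ?case by (simp add: exp_span.zero)
next
  case (add f g)
  then show ?case using exp_span.add by (fastforce simp: algebra_simps)
next
  case (scale f c)
  then show ?case using exp_span.scale[OF scale.IH, of c] by (simp add: algebra_simps)
next
  case (exp k)
  have "exp_span A' B' (\<lambda>t. (1/2) * (exp (of_int (k + 1) * t) + exp (of_int (k - 1) * t)))"
    using exp assms(2) by (intro exp_span.intros) auto
  moreover have "(1/2) * (exp (of_int (k + 1) * t) + exp (of_int (k - 1) * t))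
      = cosh t * exp (of_int k * t)" for t :: real
    by (simp only: cosh_mult_exp)
  ultimately show ?case by simp
next
  case (t_exp k)
  have "exp_span A' B' (\<lambda>t. (1/2) * (t * exp (of_int (k + 1) * t) + t * exp (of_int (k - 1) * t)))"
    using t_exp assms(3) by (intro exp_span.intros) auto
  moreover have "(1/2) * (t * exp (of_int (k + 1) * t) + t * exp (of_int (k - 1) * t))
      = cosh t * (t * exp (of_int k * t))" for t :: real
    by (simp only: mult.left_commute[of "cosh t"] cosh_mult_exp) (simp only: algebra_simps)
  ultimately show ?case by simp
qed

lemma exp_span_sum:
  "finite I \<Longrightarrow> (\<And>i. i \<in> I \<Longrightarrow> exp_span A B (f i)) \<Longrightarrow> exp_span A B (\<lambda>t. \<Sum>i\<in>I. f i t)"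
  by (induction I rule: finite_induct) (auto intro: exp_span.intros)

section \<open>Orders of zeros under a change of variable\<close>

text \<open>Iterated l'Hopital: the leading Taylor coefficient as a limit. In this form an order of
  vanishing passes through products and substitutions.\<close>

lemma chain_limit:
  fixes D :: "nat \<Rightarrow> real \<Rightarrow> real"
  assumes "\<And>j. j < m \<Longrightarrow> \<forall>\<^sub>F t in nhds z. (D j has_real_derivative D (Suc j) t) (at t)"
    and "\<And>j. j < m \<Longrightarrow> D j z = 0"
    and "isCont (D m) z"
  shows "((\<lambda>x. D 0 x / (x - z) ^ m) \<longlongrightarrow> D m z / fact m) (at z)"
  using assms
proof (induction m arbitrary: D)
  case 0
  then show ?case by (simp add: isCont_def)
next
  case (Suc m)
  have lim: "((\<lambda>x. D (Suc 0) x / (x - z) ^ m) \<longlongrightarrow> D (Suc m) z / fact m) (at z)"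
    using Suc.IH[of "\<lambda>j. D (Suc j)"] Suc.prems by force
  have d0: "\<forall>\<^sub>F t in nhds z. (D 0 has_real_derivative D (Suc 0) t) (at t)"
    using Suc.prems(1) by blast
  show ?case
  proof (rule lhopital)
    have "isCont (D 0) z" using eventually_nhds_x_imp_x[OF d0] DERIV_isCont by blast
    then show "(D 0 \<longlongrightarrow> 0) (at z)" using Suc.prems(2)[of 0] by (simp add: isCont_def)
    show "((\<lambda>x. (x - z) ^ Suc m) \<longlongrightarrow> 0) (at z)"
      by (rule tendsto_eq_intros refl | simp)+
    show "\<forall>\<^sub>F x in at z. (x - z) ^ Suc m \<noteq> 0"
      unfolding eventually_at_filter by (intro always_eventually) auto
    show "\<forall>\<^sub>F x in at z. real (Suc m) * (x - z) ^ m \<noteq> 0"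
      unfolding eventually_at_filter by (intro always_eventually) auto
    show "\<forall>\<^sub>F x in at z. (D 0 has_real_derivative D (Suc 0) x) (at x)"
      using d0 by (auto simp: eventually_at_filter elim: eventually_mono)
    show "\<forall>\<^sub>F x in at z. ((\<lambda>x. (x - z) ^ Suc m) has_real_derivative real (Suc m) * (x - z) ^ m) (at x)"
      by (intro always_eventually allI) (rule derivative_eq_intros refl | simp)+
    have "((\<lambda>x. inverse (real (Suc m)) * (D (Suc 0) x / (x - z) ^ m))
        \<longlongrightarrow> inverse (real (Suc m)) * (D (Suc m) z / fact m)) (at z)"
      by (intro tendsto_intros lim)
    then show "((\<lambda>x. D (Suc 0) x / (real (Suc m) * (x - z) ^ m)) \<longlongrightarrow> D (Suc m) z / fact (Suc m)) (at z)"
      by (simp add: field_simps)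
  qed
qed

text \<open>For j < m the quotient by (x - z)^j tends to 0, being the quotient by (x - z)^m times a
  positive power of x - z; once all lower derivatives are known to vanish at z, it also tends to
  \<open>D j z / fact j\<close>. Hence the strong induction.\<close>

lemma has_zero_order_limit:
  fixes D :: "nat \<Rightarrow> real \<Rightarrow> real"
  assumes D: "\<And>j. \<forall>\<^sub>F t in nhds z. (D j has_real_derivative D (Suc j) t) (at t)"
    and lim: "((\<lambda>x. D 0 x / (x - z) ^ m) \<longlongrightarrow> c) (at z)" and "c \<noteq> 0"
  shows "has_zero_order (D 0) z m"
proof -
  have cont: "isCont (D j) z" for j
    using eventually_nhds_x_imp_x[OF D] DERIV_isCont by blast
  have zero: "D j z = 0" if "j < m" for j
    using that
  proof (induction j rule: less_induct)
    case (less j)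
    have lim1: "((\<lambda>x. D 0 x / (x - z) ^ j) \<longlongrightarrow> D j z / fact j) (at z)"
      using less by (intro chain_limit D cont) auto
    have lim2: "((\<lambda>x. D 0 x / (x - z) ^ m * (x - z) ^ (m - j)) \<longlongrightarrow> c * (z - z) ^ (m - j)) (at z)"
      by (intro tendsto_intros lim)
    have ev: "\<forall>\<^sub>F x in at z. D 0 x / (x - z) ^ m * (x - z) ^ (m - j) = D 0 x / (x - z) ^ j"
      unfolding eventually_at_filter
    proof (intro always_eventually allI impI)
      fix x assume "x \<noteq> z"
      moreover have "(x - z) ^ m = (x - z) ^ j * (x - z) ^ (m - j)"
        using less(2) by (simp flip: power_add)
      ultimately show "D 0 x / (x - z) ^ m * (x - z) ^ (m - j) = D 0 x / (x - z) ^ j" by simp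
    qed
    have "D j z / fact j = c * (z - z) ^ (m - j)"
      by (rule tendsto_unique[OF trivial_limit_at lim1 Lim_transform_eventually[OF lim2 ev]])
    then show ?case using less(2) by (simp add: zero_power)
  qed
  have "((\<lambda>x. D 0 x / (x - z) ^ m) \<longlongrightarrow> D m z / fact m) (at z)"
    by (intro chain_limit D cont zero)
  then have "D m z / fact m = c" by (rule tendsto_unique[OF trivial_limit_at _ lim])
  then show ?thesis
    unfolding has_zero_order_def using D zero \<open>c \<noteq> 0\<close> by (intro exI[of _ D]) auto
qed

text \<open>
  These functions are only used on \<open>t > 0\<close>, where the class is closed under differentiation. It contains
  \<open>dt/dh\<close> as a function of \<open>t\<close> in all four cases, so every iterated derivative with respect to \<open>h\<close>
  stays in the class.
\<close>

inductive smooth_fun :: "(real \<Rightarrow> real) \<Rightarrow> bool" where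
  chain: "chain D \<Longrightarrow> smooth_fun (D j)"
| inv_sinh: "smooth_fun (\<lambda>t. inverse (sinh t))"
| inv_cosh: "smooth_fun (\<lambda>t. inverse (cosh t))"
| add: "smooth_fun f \<Longrightarrow> smooth_fun g \<Longrightarrow> smooth_fun (\<lambda>t. f t + g t)"
| mult: "smooth_fun f \<Longrightarrow> smooth_fun g \<Longrightarrow> smooth_fun (\<lambda>t. f t * g t)"

lemma smooth_fun_const: "smooth_fun (\<lambda>t. c)"
  using smooth_fun.chain[of "\<lambda>j t. if j = 0 then c else 0" 0] by (simp add: chain_def)

lemma smooth_fun_cosh: "smooth_fun cosh" and smooth_fun_sinh: "smooth_fun sinh"
proof -
  define D :: "nat \<Rightarrow> real \<Rightarrow> real" where "D = (\<lambda>j. if even j then cosh else sinh)"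
  have "chain D" unfolding chain_def D_def by (auto intro!: derivative_eq_intros)
  then have "smooth_fun (D 0)" "smooth_fun (D 1)" by (intro smooth_fun.chain, simp)+
  then show "smooth_fun cosh" "smooth_fun sinh" by (simp_all add: D_def)
qed

lemma smooth_fun_power: "smooth_fun f \<Longrightarrow> smooth_fun (\<lambda>t. f t ^ n)"
  by (induction n) (auto intro: smooth_fun_const smooth_fun.mult)

lemma smooth_fun_deriv:
  "smooth_fun f \<Longrightarrow> \<exists>f'. smooth_fun f' \<and> (\<forall>t>0. (f has_real_derivative f' t) (at t))"
proof (induction rule: smooth_fun.induct)
  case (chain D j)
  then show ?case using smooth_fun.chain[of D "Suc j"] by (auto simp: chain_def)
next
  case inv_sinh
  have "smooth_fun (\<lambda>t. (- 1) * (cosh t * (inverse (sinh t) * inverse (sinh t))))"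
    by (intro smooth_fun.intros smooth_fun_const smooth_fun_cosh)
  then show ?case
    by (intro exI conjI, assumption)
      (auto intro!: derivative_eq_intros simp: power2_eq_square)
next
  case inv_cosh
  have "smooth_fun (\<lambda>t. (- 1) * (sinh t * (inverse (cosh t) * inverse (cosh t))))"
    by (intro smooth_fun.intros smooth_fun_const smooth_fun_sinh)
  then show ?case
    by (intro exI conjI, assumption)
      (auto intro!: derivative_eq_intros simp: power2_eq_square)
next
  case (add f g)
  then obtain f' g' where "smooth_fun f'" "\<forall>t>0. (f has_real_derivative f' t) (at t)"
    "smooth_fun g'" "\<forall>t>0. (g has_real_derivative g' t) (at t)" by blast
  then show ?case
    by (intro exI[of _ "\<lambda>t. f' t + g' t"]) (auto intro!: smooth_fun.add derivative_eq_intros)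
next
  case (mult f g)
  then obtain f' g' where "smooth_fun f'" "\<forall>t>0. (f has_real_derivative f' t) (at t)"
    "smooth_fun g'" "\<forall>t>0. (g has_real_derivative g' t) (at t)" by blast
  then show ?case using mult.hyps
    by (intro exI[of _ "\<lambda>t. f' t * g t + g' t * f t"])
      (auto intro!: smooth_fun.add smooth_fun.mult derivative_eq_intros)
qed

text \<open>With \<kappa> = dt/dh expressed in t, differentiation with respect to h acts on
  functions of t as G -> G' \<kappa>; \<open>G j\<close> is the j-th iterate.\<close>

lemma smooth_fun_iterate:
  assumes "smooth_fun f" "smooth_fun \<kappa>"
  shows "\<exists>G. G 0 = f \<and>
    (\<forall>j. \<forall>t>0. \<exists>d. (G j has_real_derivative d) (at t) \<and> G (Suc j) t = d * \<kappa> t)"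
proof -
  obtain d where d: "\<And>f. smooth_fun f \<Longrightarrow> smooth_fun (d f) \<and> (\<forall>t>0. (f has_real_derivative d f t) (at t))"
    using smooth_fun_deriv by metis
  define G where "G = rec_nat f (\<lambda>j g. (\<lambda>t. d g t * \<kappa> t))"
  have "smooth_fun (G j)" for j
    by (induction j) (auto simp: G_def assms d intro!: smooth_fun.mult)
  then show ?thesis using d by (intro exI[of _ G]) (auto simp: G_def)
qed

lemma smooth_fun_substitution_chain:
  fixes \<tau> :: "real \<Rightarrow> real"
  assumes "smooth_fun f" "smooth_fun \<kappa>" "open S"
    and \<tau>: "\<And>h. h \<in> S \<Longrightarrow> \<tau> h > 0"
    and der: "\<And>h. h \<in> S \<Longrightarrow> (\<tau> has_real_derivative \<kappa> (\<tau> h)) (at h)"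
    and F: "\<And>h. h \<in> S \<Longrightarrow> F h = f (\<tau> h)"
  obtains D where "D 0 = F" "\<And>j h. h \<in> S \<Longrightarrow> (D j has_real_derivative D (Suc j) h) (at h)"
proof -
  obtain G where G: "G 0 = f"
    "\<And>j t. t > 0 \<Longrightarrow> \<exists>d. (G j has_real_derivative d) (at t) \<and> G (Suc j) t = d * \<kappa> t"
    using smooth_fun_iterate[OF assms(1,2)] by blast
  \<comment> \<open>Orders of zeros are defined by a sequence that starts with \<open>F\<close>
    itself, and \<open>F\<close> is known to agree with \<open>f \<circ> \<tau>\<close> on
    \<open>S\<close> only.\<close>
  define D where "D = (\<lambda>j. if j = 0 then F else G j \<circ> \<tau>)"
  have *: "((G j \<circ> \<tau>) has_real_derivative G (Suc j) (\<tau> h)) (at h)" if "h \<in> S" for j h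
    using G(2)[OF \<tau>[OF that], of j] DERIV_chain[OF _ der[OF that]] by metis
  have "(D j has_real_derivative D (Suc j) h) (at h)" if "h \<in> S" for j h
  proof (cases "j = 0")
    case True
    have "(F has_real_derivative G (Suc 0) (\<tau> h)) (at h)"
      by (rule has_field_derivative_transform_within_open[OF *[OF that, of 0] \<open>open S\<close> that])
        (use F G(1) in auto)
    then show ?thesis using True by (simp add: D_def)
  next
    case False
    then show ?thesis using *[OF that, of j] by (simp add: D_def)
  qed
  moreover have "D 0 = F" by (simp add: D_def)
  ultimately show thesis using that by blast
qed

text \<open>As \<phi> and \<kappa> do not vanish for t > 0, the order of f at h is that of E at
  \<tau> h. The orders of E add up to at most \<open>card A + card B - 1\<close>, and the zero t =
  0, outside the image of \<tau>, uses up at least one of them.\<close>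

lemma num_isolated_zeros_le:
  fixes \<tau> f :: "real \<Rightarrow> real"
  assumes "open S" and inj: "inj_on \<tau> S"
    and \<tau>: "\<And>h. h \<in> S \<Longrightarrow> \<tau> h > 0"
    and der: "\<And>h. h \<in> S \<Longrightarrow> (\<tau> has_real_derivative \<kappa> (\<tau> h)) (at h)"
    and \<kappa>: "smooth_fun \<kappa>" "\<And>t. t > 0 \<Longrightarrow> \<kappa> t \<noteq> 0"
    and \<phi>: "smooth_fun \<phi>" "\<And>t. t > 0 \<Longrightarrow> \<phi> t \<noteq> 0"
    and f: "\<And>h. h \<in> S \<Longrightarrow> f h = \<phi> (\<tau> h) * E (\<tau> h)"
    and E: "exp_span A B E" "E 0 = 0" "finite A" "B \<subseteq> A"
  shows "num_isolated_zeros f S \<le> enat (card A + card B - 2)"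
proof (cases "\<forall>t. E t = 0")
  case True
  \<comment> \<open>Now f vanishes on all of \<open>S\<close>, and an open set of reals has no
    isolated points.\<close>
  have "isolated_zeros f S = {}"
  proof (rule equals0I)
    fix z assume "z \<in> isolated_zeros f S"
    moreover have "{x\<in>S. f x = 0} = S" using f True by auto
    ultimately have "z isolated_in S" unfolding isolated_zeros_def by simp
    then obtain T where "open T" "T \<inter> S = {z}" unfolding isolated_in_def by blast
    then show False using \<open>open S\<close> open_Int not_open_singleton by metis
  qed
  then show ?thesis by (simp add: num_isolated_zeros_def zero_enat_def[symmetric])
next
  case False
  then obtain t0 where t0: "E t0 \<noteq> 0" by blast
  obtain D ks where D: "chain D" "annihilated ks D" "D 0 = E" "length ks = card A + card B"
    using exp_span_chain[OF E(1,3,4)] by blast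
  have bound: "sum \<mu> Z < card A + card B"
    if "finite Z" "\<And>z j. z \<in> Z \<Longrightarrow> j < \<mu> z \<Longrightarrow> D j z = 0" for \<mu> Z
    using sum_zero_orders_less[OF D(1,2), of t0 Z \<mu>] that t0 D by auto
  \<comment> \<open>If all derivatives vanished at z, the order \<open>card A + card B\<close> could
    be assigned to z, against \<open>bound\<close>.\<close>
  have ex: "\<exists>m. D m z \<noteq> 0" for z
    using bound[of "{z}" "\<lambda>_. card A + card B"] by auto
  define ord where "ord = (\<lambda>z. LEAST m. D m z \<noteq> 0)"
  have ord: "D (ord z) z \<noteq> 0" for z
    unfolding ord_def by (rule LeastI_ex[OF ex])
  have ord_less: "D j z = 0" if "j < ord z" for z j
    using not_less_Least[of j "\<lambda>m. D m z \<noteq> 0"] that unfolding ord_def by blast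
  have ord_pos: "ord z > 0" if "E z = 0" for z
    using ord[of z] that D(3) by (cases "ord z") auto
  have ordE: "((\<lambda>x. E x / (x - z) ^ ord z) \<longlongrightarrow> D (ord z) z / fact (ord z)) (at z)" for z
  proof -
    have "isCont (D (ord z)) z" using D(1) DERIV_isCont unfolding chain_def by blast
    then show ?thesis
      using chain_limit[of "ord z" D z] ord_less D(1) unfolding chain_def D(3)
      by (simp add: always_eventually)
  qed
  define Z where "Z = {h\<in>S. f h = 0}"
  have EZ: "E (\<tau> h) = 0" "\<tau> h > 0" if "h \<in> Z" for h
    using that f \<phi>(2) \<tau> unfolding Z_def by fastforce+
  have le: "sum (ord \<circ> \<tau>) Z' \<le> card A + card B - 2" if "finite Z'" "Z' \<subseteq> Z" for Z'
  proof -
    have inj': "inj_on \<tau> Z'" using inj that(2) inj_on_subset unfolding Z_def by blast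
    have "sum ord (insert 0 (\<tau> ` Z')) < card A + card B"
      using that ord_less by (intro bound) auto
    moreover have "0 \<notin> \<tau> ` Z'" using EZ(2) that by force
    ultimately have "ord 0 + sum ord (\<tau> ` Z') < card A + card B" using that by simp
    moreover have "sum ord (\<tau> ` Z') = sum (ord \<circ> \<tau>) Z'" using sum.reindex[OF inj'] .
    ultimately show ?thesis using ord_pos[OF E(2)] by linarith
  qed
  have "finite Z"
  proof (rule ccontr)
    assume "infinite Z"
    then obtain Z' where Z': "Z' \<subseteq> Z" "finite Z'" "card Z' = Suc (card A + card B)"
      using infinite_arbitrarily_large by blast
    have "card Z' = (\<Sum>z\<in>Z'. 1)" by simp
    also have "\<dots> \<le> sum (ord \<circ> \<tau>) Z'"
      using ord_pos EZ Z'(1) by (intro sum_mono) (force simp: Suc_le_eq)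
    finally show False using le[OF Z'(2,1)] Z'(3) by linarith
  qed
  have sub: "isolated_zeros f S \<subseteq> Z" unfolding isolated_zeros_def isolated_in_def Z_def by auto
  then have fin: "finite (isolated_zeros f S)" using \<open>finite Z\<close> finite_subset by blast
  have sm: "smooth_fun (\<lambda>t. \<phi> t * E t)"
    using smooth_fun.mult[OF \<phi>(1) smooth_fun.chain[OF D(1), of 0]] D(3) by simp
  obtain F where F: "F 0 = f" "\<And>j h. h \<in> S \<Longrightarrow> (F j has_real_derivative F (Suc j) h) (at h)"
    by (rule smooth_fun_substitution_chain[where \<tau> = \<tau> and F = f, OF sm \<kappa>(1) \<open>open S\<close>])
      (use \<tau> der f in auto)
  have mult: "zero_mult f z \<le> enat (ord (\<tau> z))" if "z \<in> Z" for z
  proof -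
    define m where "m = ord (\<tau> z)"
    have z: "z \<in> S" using that unfolding Z_def by simp
    have ev: "\<forall>\<^sub>F h in nhds z. h \<in> S" using \<open>open S\<close> z by (rule eventually_nhds_in_open)
    have "isCont \<tau> z" using der[OF z] DERIV_isCont by blast
    \<comment> \<open>Injectivity keeps \<tau> x away from \<tau> z, so a limit punctured at \<tau>
      z can be composed with \<tau>.\<close>
    have "filterlim \<tau> (at (\<tau> z)) (at z)"
      unfolding filterlim_at
    proof
      show "(\<tau> \<longlongrightarrow> \<tau> z) (at z)" using \<open>isCont \<tau> z\<close> by (simp add: isCont_def)
      show "\<forall>\<^sub>F x in at z. \<tau> x \<in> UNIV \<and> \<tau> x \<noteq> \<tau> z"
        unfolding eventually_at_filter using ev
        by eventually_elim (use inj z in \<open>auto dest: inj_onD\<close>)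
    qed
    from filterlim_compose[OF ordE[of "\<tau> z", folded m_def] this]
    have l1: "((\<lambda>x. E (\<tau> x) / (\<tau> x - \<tau> z) ^ m) \<longlongrightarrow> D m (\<tau> z) / fact m) (at z)" .
    have l2: "((\<lambda>x. (\<tau> x - \<tau> z) / (x - z)) \<longlongrightarrow> \<kappa> (\<tau> z)) (at z)"
      using der[OF z] by (simp add: has_field_derivative_iff)
    have "\<exists>d. (\<phi> has_real_derivative d) (at (\<tau> z))"
      using smooth_fun_deriv[OF \<phi>(1)] \<tau>[OF z] by blast
    then have "isCont \<phi> (\<tau> z)" using DERIV_isCont by blast
    then have l3: "((\<lambda>x. \<phi> (\<tau> x)) \<longlongrightarrow> \<phi> (\<tau> z)) (at z)"
      using isCont_o2[OF \<open>isCont \<tau> z\<close>] by (simp add: isCont_def)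
    \<comment> \<open>The quotient f x / (x - z)^m factors into \<phi>, the quotient of E in the
      variable t, and the m-th power of the difference quotient of \<tau>.\<close>
    have l4: "((\<lambda>x. \<phi> (\<tau> x) * (E (\<tau> x) / (\<tau> x - \<tau> z) ^ m * ((\<tau> x - \<tau> z) / (x - z)) ^ m))
      \<longlongrightarrow> \<phi> (\<tau> z) * (D m (\<tau> z) / fact m * \<kappa> (\<tau> z) ^ m)) (at z)"
      by (intro tendsto_intros l1 l2 l3)
    have "((\<lambda>x. f x / (x - z) ^ m) \<longlongrightarrow> \<phi> (\<tau> z) * (D m (\<tau> z) / fact m * \<kappa> (\<tau> z) ^ m)) (at z)"
    proof (rule Lim_transform_eventually[OF l4])
      show "\<forall>\<^sub>F x in at z. \<phi> (\<tau> x) * (E (\<tau> x) / (\<tau> x - \<tau> z) ^ m * ((\<tau> x - \<tau> z) / (x - z)) ^ m)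
          = f x / (x - z) ^ m"
        unfolding eventually_at_filter using ev
      proof eventually_elim
        case (elim x)
        then show ?case using inj z f by (auto simp: power_divide dest: inj_onD)
      qed
    qed
    moreover have "\<phi> (\<tau> z) * (D m (\<tau> z) / fact m * \<kappa> (\<tau> z) ^ m) \<noteq> 0"
      using ord \<kappa>(2) \<phi>(2) \<tau>[OF z] by (simp add: m_def)
    moreover have "\<forall>\<^sub>F h in nhds z. (F j has_real_derivative F (Suc j) h) (at h)" for j
      using ev by eventually_elim (rule F(2))
    ultimately have "has_zero_order f z m"
      using has_zero_order_limit[of F z m] F(1) by metis
    then show ?thesis unfolding zero_mult_def m_def by (intro INF_lower) simp
  qed
  have "(\<Sum>z\<in>isolated_zeros f S. zero_mult f z) \<le> (\<Sum>z\<in>isolated_zeros f S. enat ((ord \<circ> \<tau>) z))"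
    using mult sub by (intro sum_mono) auto
  also have "\<dots> = enat (sum (ord \<circ> \<tau>) (isolated_zeros f S))"
    using fin by (induction rule: finite_induct) (auto simp: zero_enat_def)
  also have "\<dots> \<le> enat (card A + card B - 2)" using le[OF fin sub] by simp
  finally show ?thesis using fin by (simp add: num_isolated_zeros_def)
qed

text \<open>Joins the two components of \<open>Sigma_h S1\<close>, each of which has its own
  substitution.\<close>

lemma num_isolated_zeros_Un:
  assumes "open S" "open T" "S \<inter> T = {}"
  shows "num_isolated_zeros f (S \<union> T) \<le> num_isolated_zeros f S + num_isolated_zeros f T"
proof -
  have *: "isolated_zeros f (S' \<union> T') \<inter> S' \<subseteq> isolated_zeros f S'" if "open S'" for S' T'
  proof
    fix z assume z: "z \<in> isolated_zeros f (S' \<union> T') \<inter> S'"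
    then obtain U where U: "open U" "U \<inter> {x \<in> S' \<union> T'. f x = 0} = {z}"
      unfolding isolated_zeros_def isolated_in_def by blast
    then have "(U \<inter> S') \<inter> {x \<in> S'. f x = 0} = {z}" using z by blast
    moreover have "z \<in> {x \<in> S'. f x = 0}" using U z by blast
    ultimately show "z \<in> isolated_zeros f S'"
      unfolding isolated_zeros_def isolated_in_def using U that by blast
  qed
  have sub: "isolated_zeros f (S \<union> T) \<subseteq> isolated_zeros f S \<union> isolated_zeros f T"
  proof
    fix z assume z: "z \<in> isolated_zeros f (S \<union> T)"
    then have "z \<in> S \<or> z \<in> T" unfolding isolated_zeros_def isolated_in_def by blast
    then show "z \<in> isolated_zeros f S \<union> isolated_zeros f T"
      using *[OF assms(1), of T] *[OF assms(2), of S] z by (auto simp: Un_commute)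
  qed
  show ?thesis
  proof (cases "finite (isolated_zeros f S) \<and> finite (isolated_zeros f T)")
    case True
    have "isolated_zeros f S \<inter> isolated_zeros f T = {}"
      using assms(3) unfolding isolated_zeros_def isolated_in_def by auto
    then have "(\<Sum>z\<in>isolated_zeros f (S \<union> T). zero_mult f z)
        \<le> (\<Sum>z\<in>isolated_zeros f S. zero_mult f z) + (\<Sum>z\<in>isolated_zeros f T. zero_mult f z)"
      using sum_mono2[OF _ sub, of "zero_mult f"] True by (simp add: sum.union_disjoint)
    moreover have "finite (isolated_zeros f (S \<union> T))" using sub True finite_subset by blast
    ultimately show ?thesis using True by (simp add: num_isolated_zeros_def)
  qed (auto simp: num_isolated_zeros_def)
qed

section \<open>Integrals over the normalized orbits\<close>

definition orbit_s :: "real \<Rightarrow> real \<Rightarrow> real" where "orbit_s t \<theta> = cosh t + sinh t * cos \<theta>"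
definition orbit_w :: "real \<Rightarrow> real \<Rightarrow> real" where "orbit_w t \<theta> = sinh t * sin \<theta>"

text \<open>The exponent \<open>j + 1\<close> absorbs ds = - w d\<theta>: index j belongs to s^q w^j
  ds. In the angle the integrand is smooth up to the end points, where w as a function of s behaves
  like a square root.\<close>

definition orbit_int :: "int \<Rightarrow> nat \<Rightarrow> real \<Rightarrow> real" where
  "orbit_int q j t = integral {0..pi} (\<lambda>\<theta>. orbit_s t \<theta> powi q * orbit_w t \<theta> ^ (j + 1))"

text \<open>The frequencies of a product of m factors cosh t or sinh t; one more factor cosh t leads
  from m to m + 1. For m < 0 the set is empty, which lets uniform statements cover degenerate
  cases.\<close>

definition parity_range :: "int \<Rightarrow> int set" where
  "parity_range m = {k. \<bar>k\<bar> \<le> m \<and> even (k - m)}"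

lemma orbit_s_pos: "orbit_s t \<theta> > 0"
proof -
  have "\<bar>sinh t * cos \<theta>\<bar> \<le> \<bar>sinh t\<bar>"
    by (simp add: abs_mult mult_left_le)
  moreover have "cosh t - sinh t > 0" "cosh t + sinh t > 0"
    by (simp_all add: cosh_minus_sinh cosh_plus_sinh)
  ultimately show ?thesis unfolding orbit_s_def by linarith
qed

lemma orbit_w_sq: "orbit_w t \<theta> ^ 2 = 2 * cosh t * orbit_s t \<theta> - orbit_s t \<theta> ^ 2 - 1"
proof -
  have "orbit_w t \<theta> ^ 2 = sinh t ^ 2 - (sinh t * cos \<theta>) ^ 2"
    by (simp add: orbit_w_def power_mult_distrib sin_squared_eq algebra_simps)
  then show ?thesis
    using cosh_square_eq[of t] by (simp add: orbit_s_def power2_eq_square algebra_simps)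
qed

lemma orbit_s_deriv: "(orbit_s t has_real_derivative - orbit_w t \<theta>) (at \<theta>)"
  unfolding orbit_s_def[abs_def] orbit_w_def by (auto intro!: derivative_eq_intros)

lemma orbit_w_deriv: "(orbit_w t has_real_derivative orbit_s t \<theta> - cosh t) (at \<theta>)"
  unfolding orbit_s_def orbit_w_def[abs_def] by (auto intro!: derivative_eq_intros)

lemma orbit_s_powi_deriv:
  "((\<lambda>\<theta>. orbit_s t \<theta> powi q) has_real_derivative - of_int q * orbit_s t \<theta> powi (q - 1) * orbit_w t \<theta>) (at \<theta>)"
  using orbit_s_pos[of t \<theta>] by (auto intro!: derivative_eq_intros orbit_s_deriv)

lemma continuous_on_orbit_s [continuous_intros]: "continuous_on S (orbit_s t)"
  and continuous_on_orbit_w [continuous_intros]: "continuous_on S (orbit_w t)"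
  unfolding orbit_s_def[abs_def] orbit_w_def[abs_def] by (intro continuous_intros)+

lemma continuous_on_orbit_s_powi [continuous_intros]: "continuous_on S (\<lambda>\<theta>. orbit_s t \<theta> powi q)"
  by (intro continuous_at_imp_continuous_on ballI DERIV_isCont[OF orbit_s_powi_deriv])

lemma orbit_int_has_integral:
  "((\<lambda>\<theta>. orbit_s t \<theta> powi q * orbit_w t \<theta> ^ (j + 1)) has_integral orbit_int q j t) {0..pi}"
  unfolding orbit_int_def by (intro integrable_integral integrable_continuous_interval continuous_intros)

lemma orbit_int_at_0: "orbit_int q j 0 = 0"
  by (simp add: orbit_int_def orbit_w_def)

lemma FTC_0_pi:
  fixes f f' :: "real \<Rightarrow> real"
  assumes "\<And>x. (f has_real_derivative f' x) (at x)"
  shows "(f' has_integral f pi - f 0) {0..pi}"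
  using assms by (intro fundamental_theorem_of_calculus)
    (auto simp: has_real_derivative_iff_has_vector_derivative[symmetric] intro: has_field_derivative_at_within)

lemma orbit_s_0 [simp]: "orbit_s t 0 = exp t" and orbit_s_pi [simp]: "orbit_s t pi = exp (- t)"
  and orbit_w_0 [simp]: "orbit_w t 0 = 0" and orbit_w_pi [simp]: "orbit_w t pi = 0"
  by (simp_all add: orbit_s_def orbit_w_def cosh_def sinh_def field_simps)

section \<open>Evaluations of and recursions for the orbit integrals\<close>

lemma orbit_int_eqI:
  assumes "\<And>\<theta>. (F has_real_derivative orbit_s t \<theta> powi q * orbit_w t \<theta> ^ (j + 1)) (at \<theta>)"
  shows "orbit_int q j t = F pi - F 0"
  using has_integral_unique[OF orbit_int_has_integral FTC_0_pi[OF assms]] .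

lemma orbit_int_0:
  assumes "q \<noteq> -1"
  shows "orbit_int q 0 t = (exp (of_int (q + 1) * t) - exp (of_int (- q - 1) * t)) / of_int (q + 1)"
proof -
  have q: "of_int (q + 1) \<noteq> (0 :: real)"
    using assms by (metis add_eq_0_iff2 minus_equation_iff of_int_eq_0_iff)
  have "((\<lambda>\<theta>. - (orbit_s t \<theta> powi (q + 1)) / of_int (q + 1)) has_real_derivative
      orbit_s t \<theta> powi q * orbit_w t \<theta> ^ (0 + 1)) (at \<theta>)" for \<theta>
    using DERIV_cdivide[OF DERIV_minus[OF orbit_s_powi_deriv[of t "q + 1"]], of "of_int (q + 1)"] q
    by (simp del: of_int_add)
  moreover have "of_int (q + 1) * - t = of_int (- q - 1) * t" by (simp add: algebra_simps)
  moreover have "- b / c - - a / c = (a - b) / c" for a b c :: real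
    by (simp add: diff_divide_distrib)
  ultimately show ?thesis using orbit_int_eqI
    by (metis (no_types, lifting) exp_power_int orbit_s_0 orbit_s_pi)
qed

text \<open>The integral of ds/s, a logarithm: the only origin of a factor t.\<close>

lemma orbit_int_minus_1_0: "orbit_int (- 1) 0 t = 2 * t"
proof -
  have "((\<lambda>\<theta>. - ln (orbit_s t \<theta>)) has_real_derivative orbit_s t \<theta> powi (- 1) * orbit_w t \<theta> ^ (0 + 1))
    (at \<theta>)" for \<theta>
    using orbit_s_pos[of t \<theta>]
    by (auto intro!: derivative_eq_intros orbit_s_deriv simp: power_int_minus divide_inverse)
  from orbit_int_eqI[OF this] show ?thesis by simp
qed

text \<open>Substituting the equation of the conic for w^2 lowers j by two, so that only j = 0 and j
  = 1 need a separate treatment.\<close>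

lemma orbit_int_Suc_Suc:
  "orbit_int q (j + 2) t = 2 * (cosh t * orbit_int (q + 1) j t) + (- 1) * orbit_int (q + 2) j t + (- 1) * orbit_int q j t"
proof -
  have "orbit_s t \<theta> powi q * orbit_w t \<theta> ^ ((j + 2) + 1)
      = 2 * (cosh t * (orbit_s t \<theta> powi (q + 1) * orbit_w t \<theta> ^ (j + 1))) + (- 1) * (orbit_s t \<theta> powi (q + 2) * orbit_w t \<theta> ^ (j + 1))
        + (- 1) * (orbit_s t \<theta> powi q * orbit_w t \<theta> ^ (j + 1))" for \<theta>
  proof -
    have "orbit_s t \<theta> powi q * orbit_w t \<theta> ^ ((j + 2) + 1) = orbit_s t \<theta> powi q * orbit_w t \<theta> ^ 2 * orbit_w t \<theta> ^ (j + 1)"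
      by (simp add: power_add power2_eq_square)
    then show ?thesis
      unfolding orbit_w_sq using orbit_s_pos[of t \<theta>]
      by (simp add: power_int_add power2_eq_square algebra_simps)
  qed
  moreover have "((\<lambda>\<theta>. 2 * (cosh t * (orbit_s t \<theta> powi (q + 1) * orbit_w t \<theta> ^ (j + 1))) + (- 1) * (orbit_s t \<theta> powi (q + 2) * orbit_w t \<theta> ^ (j + 1))
        + (- 1) * (orbit_s t \<theta> powi q * orbit_w t \<theta> ^ (j + 1))) has_integral
     2 * (cosh t * orbit_int (q + 1) j t) + (- 1) * orbit_int (q + 2) j t + (- 1) * orbit_int q j t) {0..pi}"
    by (intro has_integral_add has_integral_mult_right orbit_int_has_integral)
  ultimately have "((\<lambda>\<theta>. orbit_s t \<theta> powi q * orbit_w t \<theta> ^ ((j + 2) + 1)) has_integral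
     2 * (cosh t * orbit_int (q + 1) j t) + (- 1) * orbit_int (q + 2) j t + (- 1) * orbit_int q j t) {0..pi}"
    by simp
  then show ?thesis using orbit_int_has_integral has_integral_unique by blast
qed

text \<open>
  The three-term recursion comes from integrating the derivative of \<open>s\<^sup>q w\<^sup>3\<close>, which vanishes at both
  end points.
\<close>

lemma orbit_int_1_rec:
  "of_int (q + 3) * orbit_int (q + 1) 1 t
    = of_int (2 * q + 3) * (cosh t * orbit_int q 1 t) - of_int q * orbit_int (q - 1) 1 t"
proof -
  let ?f' = "\<lambda>\<theta>. of_int (q + 3) * (orbit_s t \<theta> powi (q + 1) * orbit_w t \<theta> ^ (1 + 1))
    - of_int (2 * q + 3) * (cosh t * (orbit_s t \<theta> powi q * orbit_w t \<theta> ^ (1 + 1)))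
    + of_int q * (orbit_s t \<theta> powi (q - 1) * orbit_w t \<theta> ^ (1 + 1))"
  have "((\<lambda>\<theta>. orbit_s t \<theta> powi q * orbit_w t \<theta> ^ 3) has_real_derivative ?f' \<theta>) (at \<theta>)" for \<theta>
  proof -
    define p where "p = orbit_s t \<theta> powi (q - 1)"
    have "orbit_s t \<theta> powi (q - 1 + 1) = p * orbit_s t \<theta>" "orbit_s t \<theta> powi (q - 1 + 2) = p * orbit_s t \<theta> ^ 2"
      by (subst power_int_add; use orbit_s_pos[of t \<theta>] in \<open>simp add: p_def\<close>)+
    moreover have "q - 1 + 1 = q" "q - 1 + 2 = q + 1" by simp_all
    ultimately have p: "orbit_s t \<theta> powi q = p * orbit_s t \<theta>" "orbit_s t \<theta> powi (q + 1) = p * orbit_s t \<theta> ^ 2"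
      by (simp_all only:)
    have "((\<lambda>\<theta>. orbit_w t \<theta> ^ 3) has_real_derivative of_nat 3 * ((orbit_s t \<theta> - cosh t) * orbit_w t \<theta> ^ (3 - Suc 0))) (at \<theta>)"
      by (intro DERIV_power orbit_w_deriv)
    from DERIV_mult[OF orbit_s_powi_deriv this]
    have "((\<lambda>\<theta>. orbit_s t \<theta> powi q * orbit_w t \<theta> ^ 3) has_real_derivative
      (- of_int q * p * orbit_w t \<theta>) * orbit_w t \<theta> ^ 3 + 3 * ((orbit_s t \<theta> - cosh t) * orbit_w t \<theta> ^ 2) * orbit_s t \<theta> powi q)
      (at \<theta>)"
      by (simp add: p_def)
    moreover have "(- of_int q * p * orbit_w t \<theta>) * orbit_w t \<theta> ^ 3
      = - of_int q * p * (2 * cosh t * orbit_s t \<theta> - orbit_s t \<theta> ^ 2 - 1) * orbit_w t \<theta> ^ 2"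
      unfolding orbit_w_sq[symmetric] by (simp add: eval_nat_numeral)
    then have "(- of_int q * p * orbit_w t \<theta>) * orbit_w t \<theta> ^ 3
        + 3 * ((orbit_s t \<theta> - cosh t) * orbit_w t \<theta> ^ 2) * orbit_s t \<theta> powi q = ?f' \<theta>"
      unfolding p p_def[symmetric] by (simp add: algebra_simps power2_eq_square)
    ultimately show ?thesis by (simp only:)
  qed
  from FTC_0_pi[OF this] have "(?f' has_integral 0) {0..pi}" by simp
  moreover have "(?f' has_integral (of_int (q + 3) * orbit_int (q + 1) 1 t
    - of_int (2 * q + 3) * (cosh t * orbit_int q 1 t)
    + of_int q * orbit_int (q - 1) 1 t)) {0..pi}"
    by (intro has_integral_add has_integral_diff has_integral_mult_right orbit_int_has_integral)
  ultimately have "0 = of_int (q + 3) * orbit_int (q + 1) 1 t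
    - of_int (2 * q + 3) * (cosh t * orbit_int q 1 t) + of_int q * orbit_int (q - 1) 1 t"
    by (rule has_integral_unique)
  then show ?thesis by linarith
qed

text \<open>The area of a half disc of radius sinh t, since w^2 = (sinh t)^2 - (s - cosh
  t)^2.\<close>

lemma orbit_int_0_1: "orbit_int 0 1 t = pi / 2 * sinh t ^ 2"
proof -
  have "((\<lambda>\<theta>. sinh t ^ 2 * (\<theta> / 2 - sin \<theta> * cos \<theta> / 2)) has_real_derivative orbit_s t \<theta> powi 0 * orbit_w t \<theta> ^ (1 + 1))
    (at \<theta>)" for \<theta>
  proof -
    have "1 - (cos \<theta> * cos \<theta> - sin \<theta> * sin \<theta>) = 2 * (sin \<theta>)\<^sup>2"
      using sin_cos_squared_add[of \<theta>] by (simp add: power2_eq_square)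
    then have "sinh t ^ 2 * ((1 - (cos \<theta> * cos \<theta> - sin \<theta> * sin \<theta>)) / 2)
        = orbit_s t \<theta> powi 0 * orbit_w t \<theta> ^ (1 + 1)"
      by (simp add: orbit_w_def power2_eq_square mult_ac)
    moreover have "((\<lambda>\<theta>. sinh t ^ 2 * (\<theta> / 2 - sin \<theta> * cos \<theta> / 2)) has_real_derivative
        sinh t ^ 2 * ((1 - (cos \<theta> * cos \<theta> - sin \<theta> * sin \<theta>)) / 2)) (at \<theta>)"
      by (auto intro!: derivative_eq_intros simp: field_simps)
    ultimately show ?thesis by simp
  qed
  from orbit_int_eqI[OF this] show ?thesis by simp
qed

text \<open>
  With \<open>\<beta> = tanh (t / 2)\<close>, the integrand is \<open>cosh t - sinh t cos \<theta> - 1 / s\<close>, and \<open>1 / s\<close> is the Poisson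
  kernel \<open>(1 - \<beta>\<^sup>2) / (1 + 2 \<beta> cos \<theta> + \<beta>\<^sup>2)\<close>.
\<close>

lemma orbit_int_minus_1_1: "orbit_int (- 1) 1 t = pi * (cosh t - 1)"
proof -
  define \<beta> where "\<beta> = tanh (t / 2)"
  have \<beta>: "\<bar>\<beta>\<bar> < 1" using tanh_real_bounds[of "t / 2"] by (auto simp: \<beta>_def)
  \<comment> \<open>The rational parametrization of cosh and sinh by tanh (t / 2), with denominators
    cleared.\<close>
  have c: "cosh t * (1 - \<beta>\<^sup>2) = 1 + \<beta>\<^sup>2" and d: "sinh t * (1 - \<beta>\<^sup>2) = 2 * \<beta>"
  proof -
    have 1: "cosh t = cosh (t/2) ^ 2 + sinh (t/2) ^ 2" "sinh t = 2 * sinh (t/2) * cosh (t/2)"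
      using cosh_double[of "t/2"] sinh_double[of "t/2"] by simp_all
    have 3: "sinh (t/2) = \<beta> * cosh (t/2)" by (simp add: \<beta>_def tanh_def)
    then have "(1 - \<beta>\<^sup>2) * cosh (t/2) ^ 2 = cosh (t/2) ^ 2 - sinh (t/2) ^ 2"
      by (simp add: power_mult_distrib algebra_simps)
    then have 2: "(1 - \<beta>\<^sup>2) * cosh (t/2) ^ 2 = 1" using cosh_square_eq[of "t/2"] by simp
    have "cosh t = (1 + \<beta>\<^sup>2) * cosh (t/2)^2" "sinh t = 2 * \<beta> * cosh (t/2)^2"
      unfolding 1 unfolding 3 by (simp_all add: power2_eq_square algebra_simps)
    then have "cosh t * (1 - \<beta>\<^sup>2) = (1 + \<beta>\<^sup>2) * ((1 - \<beta>\<^sup>2) * cosh (t/2)^2)"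
      "sinh t * (1 - \<beta>\<^sup>2) = 2 * \<beta> * ((1 - \<beta>\<^sup>2) * cosh (t/2)^2)"
      by simp_all
    then show "cosh t * (1 - \<beta>\<^sup>2) = 1 + \<beta>\<^sup>2" "sinh t * (1 - \<beta>\<^sup>2) = 2 * \<beta>"
      unfolding 2 by simp_all
  qed
  \<comment> \<open>The arctan is the argument of 1 + \<beta> exp (i \<theta>). Its doubled
    derivative is 1 minus the Poisson kernel, so the bracket is a primitive of 1/s;
    \<bar>\<beta>\<bar> < 1 keeps the denominator positive.\<close>
  let ?F = "\<lambda>\<theta>. \<theta> * cosh t - sinh t * sin \<theta> - (\<theta> - 2 * arctan (\<beta> * sin \<theta> / (1 + \<beta> * cos \<theta>)))"
  have "(?F has_real_derivative orbit_s t \<theta> powi (- 1) * orbit_w t \<theta> ^ (1 + 1)) (at \<theta>)" for \<theta>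
  proof -
    have "\<bar>\<beta> * cos \<theta>\<bar> \<le> \<bar>\<beta>\<bar>" by (simp add: abs_mult mult_left_le)
    then have p: "1 + \<beta> * cos \<theta> > 0" using \<beta> by linarith
    \<comment> \<open>The squared modulus of 1 + \<beta> exp (i \<theta>).\<close>
    define N where "N = (1 + \<beta> * cos \<theta>)\<^sup>2 + (\<beta> * sin \<theta>)\<^sup>2"
    have N0: "N > 0" using p by (simp add: N_def add_pos_nonneg)
    have "\<beta> * \<beta> * (cos \<theta> * cos \<theta> + sin \<theta> * sin \<theta>) = \<beta> * \<beta>" by simp
    then have cs: "\<beta> * (\<beta> * (cos \<theta> * cos \<theta>)) + \<beta> * (\<beta> * (sin \<theta> * sin \<theta>)) = \<beta> * \<beta>"
      by (simp only: algebra_simps)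
    have "N = 1 + 2 * \<beta> * cos \<theta> + \<beta>\<^sup>2 * ((sin \<theta>)\<^sup>2 + (cos \<theta>)\<^sup>2)"
      unfolding N_def using cs by (simp add: power2_eq_square algebra_simps)
    then have N: "N = 1 + 2 * \<beta> * cos \<theta> + \<beta>\<^sup>2" by simp
    have b: "1 - \<beta>\<^sup>2 > 0" using \<beta> by (simp add: abs_square_less_1)
    have sN: "orbit_s t \<theta> * (1 - \<beta>\<^sup>2) = N"
    proof -
      have "orbit_s t \<theta> * (1 - \<beta>\<^sup>2) = cosh t * (1 - \<beta>\<^sup>2) + cos \<theta> * (sinh t * (1 - \<beta>\<^sup>2))"
        by (simp add: orbit_s_def algebra_simps)
      then show ?thesis unfolding c d N by simp
    qed
    let ?u = "\<beta> * sin \<theta> / (1 + \<beta> * cos \<theta>)"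
    let ?u' = "(\<beta> * cos \<theta> * (1 + \<beta> * cos \<theta>) - \<beta> * sin \<theta> * (- \<beta> * sin \<theta>)) / (1 + \<beta> * cos \<theta>)^2"
    have "((\<lambda>\<theta>. \<beta> * sin \<theta> / (1 + \<beta> * cos \<theta>)) has_real_derivative ?u') (at \<theta>)"
      using p by (auto intro!: derivative_eq_intros simp: power2_eq_square)
    define A where "A = (\<lambda>\<theta>. arctan (\<beta> * sin \<theta> / (1 + \<beta> * cos \<theta>)))"
    have "(A has_real_derivative inverse (1 + ?u\<^sup>2) * ?u') (at \<theta>)"
      unfolding A_def by (rule DERIV_chain2[OF DERIV_arctan]) fact
    then have "((\<lambda>\<theta>. \<theta> * cosh t - sinh t * sin \<theta> - (\<theta> - 2 * A \<theta>)) has_real_derivative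
        cosh t - sinh t * cos \<theta> - (1 - 2 * (inverse (1 + ?u\<^sup>2) * ?u'))) (at \<theta>)"
      by (auto intro!: derivative_eq_intros)
    then have "(?F has_real_derivative cosh t - sinh t * cos \<theta> - (1 - 2 * (?u' / (1 + ?u\<^sup>2)))) (at \<theta>)"
      by (simp only: A_def divide_inverse mult.commute)
    moreover have "?u' / (1 + ?u\<^sup>2) = (\<beta> * cos \<theta> + \<beta>\<^sup>2) / N"
    proof -
      have "1 + ?u\<^sup>2 = N / (1 + \<beta> * cos \<theta>)\<^sup>2"
        using p by (simp add: N_def power_divide add_divide_distrib)
      moreover have "\<beta> * cos \<theta> * (1 + \<beta> * cos \<theta>) - \<beta> * sin \<theta> * (- \<beta> * sin \<theta>) = \<beta> * cos \<theta> + \<beta>\<^sup>2"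
      proof -
        have "\<beta> * cos \<theta> * (1 + \<beta> * cos \<theta>) - \<beta> * sin \<theta> * (- \<beta> * sin \<theta>)
          = \<beta> * cos \<theta> + \<beta>\<^sup>2 * ((sin \<theta>)\<^sup>2 + (cos \<theta>)\<^sup>2)"
          by algebra
        then show ?thesis by simp
      qed
      ultimately show ?thesis using p by simp
    qed
    moreover have "1 - 2 * ((\<beta> * cos \<theta> + \<beta>\<^sup>2) / N) = 1 / orbit_s t \<theta>"
    proof -
      have "1 - 2 * ((\<beta> * cos \<theta> + \<beta>\<^sup>2) / N) = (1 - \<beta>\<^sup>2) / N"
        using N0 by (simp add: field_simps) (simp add: N algebra_simps)
      also have "\<dots> = 1 / orbit_s t \<theta>" using b orbit_s_pos[of t \<theta>] unfolding sN[symmetric] by simp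
      finally show ?thesis .
    qed
    moreover have "cosh t - sinh t * cos \<theta> - 1 / orbit_s t \<theta> = orbit_s t \<theta> powi (- 1) * orbit_w t \<theta> ^ (1 + 1)"
    proof -
      have "cosh t - sinh t * cos \<theta> = 2 * cosh t - orbit_s t \<theta>" by (simp add: orbit_s_def)
      then show ?thesis using orbit_s_pos[of t \<theta>] orbit_w_sq[of t \<theta>]
        by (simp add: power_int_minus field_simps power2_eq_square)
    qed
    ultimately show ?thesis by (simp only:)
  qed
  from orbit_int_eqI[OF this] show ?thesis by (simp add: algebra_simps)
qed

text \<open>The recursion at q = -1 links the indices 0, -1 and -2. The agreement with index -1
  reflects the symmetry s -> 1/s, which exchanges q and - 3 - q for j = 1.\<close>

lemma orbit_int_minus_2_1: "orbit_int (- 2) 1 t = pi * (cosh t - 1)"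
proof -
  have "2 * orbit_int 0 1 t = cosh t * orbit_int (- 1) 1 t + orbit_int (- 2) 1 t"
    using orbit_int_1_rec[of "-1" t] by simp
  then show ?thesis using cosh_square_eq[of t]
    unfolding orbit_int_0_1 orbit_int_minus_1_1 by (simp add: algebra_simps power2_eq_square)
qed

lemma orbit_int_minus_3_1: "orbit_int (- 3) 1 t = pi / 2 * sinh t ^ 2"
proof -
  have "orbit_int (- 1) 1 t = - (cosh t * orbit_int (- 2) 1 t) + 2 * orbit_int (- 3) 1 t"
    using orbit_int_1_rec[of "-2" t] by simp
  then show ?thesis using cosh_square_eq[of t]
    unfolding orbit_int_minus_2_1 orbit_int_minus_1_1 by (simp add: algebra_simps power2_eq_square)
qed

section \<open>Frequencies of the orbit integrals\<close>

lemma parity_range_mono: "m \<le> n \<Longrightarrow> even (n - m) \<Longrightarrow> parity_range m \<subseteq> parity_range n"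
  unfolding parity_range_def by auto

lemma parity_range_shift: "k \<in> parity_range m \<Longrightarrow> k + 1 \<in> parity_range (m + 1) \<and> k - 1 \<in> parity_range (m + 1)"
  unfolding parity_range_def by auto

lemma exp_span_const: "0 \<in> A \<Longrightarrow> exp_span A B (\<lambda>t. c)"
  using exp_span.scale[OF exp_span.exp[of 0 A B], of c] by simp

lemma exp_span_sinh_sq: "exp_span (parity_range 2) {} (\<lambda>t. c * sinh t ^ 2)"
proof -
  have "exp_span (parity_range 2) {} (\<lambda>t. c / 4 * ((exp (of_int 2 * t) + exp (of_int (- 2) * t)) + (- 2)))"
    by (intro exp_span.scale exp_span.add exp_span.exp exp_span_const) (auto simp: parity_range_def)
  moreover have "c / 4 * ((exp (of_int 2 * t) + exp (of_int (- 2) * t)) + (- 2)) = c * sinh t ^ 2" for t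
  proof -
    have "exp (of_int 2 * t) = exp t * exp t" "exp (of_int (- 2) * t) = exp (- t) * exp (- t)"
      "exp t * exp (- t) = 1"
      by (simp_all flip: exp_add)
    then show ?thesis by (simp only: sinh_field_def power2_eq_square) (simp add: algebra_simps)
  qed
  ultimately show ?thesis by (simp only:)
qed

text \<open>Serves both branches of the recursion, \<open>p m = m\<close> and
  \<open>p m = - m - 3\<close>, which have the same start values; each step costs one multiplication
  by cosh t.\<close>

lemma exp_span_orbit_int_1_aux:
  fixes p :: "nat \<Rightarrow> int"
  assumes rec: "\<And>m. \<exists>a b. \<forall>t. orbit_int (p (Suc (Suc m))) 1 t
      = a * (cosh t * orbit_int (p (Suc m)) 1 t) + b * orbit_int (p m) 1 t"
    and "orbit_int (p 0) 1 = (\<lambda>t. pi / 2 * sinh t ^ 2)"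
    and "orbit_int (p 1) 1 = (\<lambda>t. pi / 2 * (cosh t * sinh t ^ 2))"
  shows "exp_span (parity_range (int m + 2)) {} (orbit_int (p m) 1)"
proof (induction m rule: nat_less_induct)
  case (1 m)
  consider "m = 0" | "m = 1" | m' where "m = Suc (Suc m')" by (metis One_nat_def nat.exhaust)
  then show ?case
  proof cases
    case 1
    then show ?thesis using exp_span_sinh_sq[of "pi / 2"] assms(2) by simp
  next
    case 2
    have "exp_span (parity_range 3) {} (\<lambda>t. cosh t * (pi / 2 * sinh t ^ 2))"
      by (rule exp_span_cosh[OF exp_span_sinh_sq]) (use parity_range_shift[of _ 2] in auto)
    then show ?thesis using 2 assms(3) by (simp add: algebra_simps)
  next
    case 3
    obtain a b where ab: "\<And>t. orbit_int (p m) 1 t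
      = a * (cosh t * orbit_int (p (Suc m')) 1 t) + b * orbit_int (p m') 1 t"
      using rec[of m'] 3 by blast
    have i1: "exp_span (parity_range (int m)) {} (orbit_int (p m') 1)"
      using 1[rule_format, of m'] 3 by (simp add: algebra_simps)
    have i2: "exp_span (parity_range (int m + 1)) {} (orbit_int (p (Suc m')) 1)"
      using 1[rule_format, of "Suc m'"] 3 by (simp add: algebra_simps)
    have "exp_span (parity_range (int m + 2)) {}
        (\<lambda>t. a * (cosh t * orbit_int (p (Suc m')) 1 t) + b * orbit_int (p m') 1 t)"
    proof (intro exp_span.add exp_span.scale)
      show "exp_span (parity_range (int m + 2)) {} (\<lambda>t. cosh t * orbit_int (p (Suc m')) 1 t)"
        by (rule exp_span_cosh[OF i2])
          (use parity_range_shift[of _ "int m + 1"] in \<open>auto simp: algebra_simps\<close>)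
      show "exp_span (parity_range (int m + 2)) {} (orbit_int (p m') 1)"
        by (rule exp_span_mono[OF i1 parity_range_mono]) auto
    qed
    then show ?thesis using ab by presburger
  qed
qed

lemma three_term_solve:
  "c \<noteq> 0 \<Longrightarrow> c * x = a * y - b * z \<Longrightarrow> x = a / c * y + (- b / c) * z" for x :: real
  by (simp add: field_simps)

text \<open>In the recursion the coefficient of the lower neighbour vanishes at q = 0, that of the
  upper one at q = -3, so each branch starts from (pi / 2) (sinh t)^2 alone. On the branches one of
  the two ranges is empty; in the gap q = -1, -2 the value pi (cosh t - 1) mixes both
  parities.\<close>

lemma exp_span_orbit_int_1:
  "exp_span (parity_range (- q - 1) \<union> parity_range (q + 2)) {} (orbit_int q 1)"
proof -
  consider "q \<ge> 0" | "q = - 1" | "q = - 2" | "q \<le> - 3" by linarith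
  then show ?thesis
  proof cases
    case 1
    have "exp_span (parity_range (int (nat q) + 2)) {} (orbit_int (int (nat q)) 1)"
    proof (rule exp_span_orbit_int_1_aux[of int])
      show "\<exists>a b. \<forall>t. orbit_int (int (Suc (Suc m))) 1 t
        = a * (cosh t * orbit_int (int (Suc m)) 1 t) + b * orbit_int (int m) 1 t" for m
      proof (intro exI allI)
        fix t
        show "orbit_int (int (Suc (Suc m))) 1 t
          = real (2 * m + 5) / real (m + 4) * (cosh t * orbit_int (int (Suc m)) 1 t)
            + (- real (m + 1) / real (m + 4)) * orbit_int (int m) 1 t"
          using orbit_int_1_rec[of "int (Suc m)" t]
          by (intro three_term_solve) (simp_all add: algebra_simps)
      qed
      show "orbit_int (int 0) 1 = (\<lambda>t. pi / 2 * sinh t ^ 2)"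
        unfolding of_nat_0 by (rule ext) (rule orbit_int_0_1)
      show "orbit_int (int 1) 1 = (\<lambda>t. pi / 2 * (cosh t * sinh t ^ 2))"
      proof
        fix t
        have "orbit_int 1 1 t = cosh t * orbit_int 0 1 t" using orbit_int_1_rec[of 0 t] by simp
        then show "orbit_int (int 1) 1 t = pi / 2 * (cosh t * sinh t ^ 2)"
          unfolding orbit_int_0_1 by simp
      qed
    qed
    then show ?thesis using 1 by (auto intro: exp_span_mono)
  next
    case 4
    have "exp_span (parity_range (int (nat (- q - 3)) + 2)) {} (orbit_int (- int (nat (- q - 3)) - 3) 1)"
    proof (rule exp_span_orbit_int_1_aux[of "\<lambda>m. - int m - 3"])
      show "\<exists>a b. \<forall>t. orbit_int (- int (Suc (Suc m)) - 3) 1 t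
        = a * (cosh t * orbit_int (- int (Suc m) - 3) 1 t) + b * orbit_int (- int m - 3) 1 t" for m
      proof (intro exI allI)
        fix t
        show "orbit_int (- int (Suc (Suc m)) - 3) 1 t
          = real (2 * m + 5) / real (m + 4) * (cosh t * orbit_int (- int (Suc m) - 3) 1 t)
            + (- real (m + 1) / real (m + 4)) * orbit_int (- int m - 3) 1 t"
          using orbit_int_1_rec[of "- int (Suc m) - 3" t]
          by (intro three_term_solve) (simp_all add: algebra_simps)
      qed
      show "orbit_int (- int 0 - 3) 1 = (\<lambda>t. pi / 2 * sinh t ^ 2)"
        by (rule ext) (use orbit_int_minus_3_1 in simp)
      show "orbit_int (- int 1 - 3) 1 = (\<lambda>t. pi / 2 * (cosh t * sinh t ^ 2))"
      proof
        fix t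
        have "orbit_int (- 4) 1 t = cosh t * orbit_int (- 3) 1 t"
          using orbit_int_1_rec[of "- 3" t] by simp
        then show "orbit_int (- int 1 - 3) 1 t = pi / 2 * (cosh t * sinh t ^ 2)"
          unfolding orbit_int_minus_3_1 by simp
      qed
    qed
    moreover have "int (nat (- q - 3)) + 2 = - q - 1" "- int (nat (- q - 3)) - 3 = q"
      using 4 by simp_all
    ultimately have "exp_span (parity_range (- q - 1)) {} (orbit_int q 1)" by (simp only:)
    then show ?thesis by (rule exp_span_mono) auto
  next
    case 2
    have "exp_span {-1, 0, 1} {} (\<lambda>t. pi * (cosh t * 1 + (- 1)))"
      by (intro exp_span.scale exp_span.add exp_span_cosh[of "{0}" "{}"] exp_span_const) auto
    moreover have "(\<lambda>t. pi * (cosh t * 1 + (- 1))) = orbit_int q 1"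
      using 2 by (auto simp: orbit_int_minus_1_1[unfolded One_nat_def])
    ultimately have "exp_span {-1, 0, 1} {} (orbit_int q 1)" by (simp only:)
    then show ?thesis by (rule exp_span_mono) (auto simp: 2 parity_range_def)
  next
    case 3
    have "exp_span {-1, 0, 1} {} (\<lambda>t. pi * (cosh t * 1 + (- 1)))"
      by (intro exp_span.scale exp_span.add exp_span_cosh[of "{0}" "{}"] exp_span_const) auto
    moreover have "(\<lambda>t. pi * (cosh t * 1 + (- 1))) = orbit_int q 1"
      using 3 by (auto simp: orbit_int_minus_2_1[unfolded One_nat_def])
    ultimately have "exp_span {-1, 0, 1} {} (orbit_int q 1)" by (simp only:)
    then show ?thesis by (rule exp_span_mono) (auto simp: 3 parity_range_def)
  qed
qed

text \<open>For q \<noteq> -1 one bound is negative and the intersection is empty; for q = -1 both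
  ranges are {0}, and the intersection admits the t of the logarithm.\<close>

lemma exp_span_orbit_int_0:
  "exp_span (parity_range (- q - 1) \<union> parity_range (q + 1)) (parity_range (- q - 1) \<inter> parity_range (q + 1))
    (orbit_int q 0)"
proof (cases "q = - 1")
  case True
  have "exp_span A {0} (\<lambda>t. 2 * (t * exp (of_int 0 * t)))" for A
    by (intro exp_span.scale exp_span.t_exp) auto
  then have "exp_span A {0} (orbit_int q 0)" for A
    using True by (simp add: orbit_int_minus_1_0[abs_def])
  then show ?thesis by (rule exp_span_mono) (auto simp: True parity_range_def)
next
  case False
  have "exp_span {q + 1, - q - 1} {} (\<lambda>t. (1 / of_int (q + 1)) *
      (exp (of_int (q + 1) * t) + (- 1) * exp (of_int (- q - 1) * t)))"
    by (intro exp_span.scale exp_span.add exp_span.exp) auto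
  also have "(\<lambda>t. (1 / of_int (q + 1)) * (exp (of_int (q + 1) * t) + (- 1) * exp (of_int (- q - 1) * t)))
      = orbit_int q 0"
    using orbit_int_0[OF False] by (simp add: fun_eq_iff)
  finally have "exp_span {q + 1, - q - 1} {} (orbit_int q 0)" .
  then show ?thesis by (rule exp_span_mono) (use False in \<open>auto simp: parity_range_def\<close>)
qed

text \<open>For even j the bounds have equal parity, so the ranges are nested and t occurs only with
  frequencies in the smaller one; for odd j there is no t because there is none at j = 1. The
  recursion in j respects the bounds: cosh t raises both bounds of (q + 1, j - 2) by one, while (q +
  2, j - 2) and (q, j - 2) each attain one bound and stay two below the other.\<close>

lemma exp_span_orbit_int:
  "exp_span (parity_range (- q - 1) \<union> parity_range (q + int j + 1))
     (if even j then parity_range (- q - 1) \<inter> parity_range (q + int j + 1) else {}) (orbit_int q j)"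
proof (induction j arbitrary: q rule: nat_less_induct)
  case (1 j)
  consider "j = 0" | "j = 1" | i where "j = i + 2"
    by (metis One_nat_def Suc_1 add_2_eq_Suc' nat.exhaust)
  then show ?case
  proof cases
    case 1
    then show ?thesis using exp_span_orbit_int_0[of q] by simp
  next
    case 2
    then show ?thesis using exp_span_orbit_int_1[of q] by (simp add: algebra_simps)
  next
    case 3
    let ?A = "parity_range (- q - 1) \<union> parity_range (q + int j + 1)"
    let ?B = "if even j then parity_range (- q - 1) \<inter> parity_range (q + int j + 1) else {}"
    have IH: "exp_span (parity_range (- q' - 1) \<union> parity_range (q' + int i + 1))
     (if even j then parity_range (- q' - 1) \<inter> parity_range (q' + int i + 1) else {}) (orbit_int q' i)" for q'
      using 1[rule_format, of i q'] 3 by simp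
    have m: "parity_range (- q - 3) \<subseteq> parity_range (- q - 1)"
      "parity_range (q + int i + 1) \<subseteq> parity_range (q + int j + 1)"
      using 3 by (simp_all add: parity_range_mono)
    have "k + 1 \<in> parity_range (- q - 1) \<and> k - 1 \<in> parity_range (- q - 1)"
      if "k \<in> parity_range (- (q + 1) - 1)" for k
    proof -
      have "- (q + 1) - 1 = - q - 2" "- q - 2 + 1 = - q - 1" by simp_all
      then show ?thesis using parity_range_shift[of k "- q - 2"] that by (simp only:)
    qed
    moreover have "k + 1 \<in> parity_range (q + int j + 1) \<and> k - 1 \<in> parity_range (q + int j + 1)"
      if "k \<in> parity_range (q + 1 + int i + 1)" for k
      using parity_range_shift[of k "q + int i + 2"] that 3 by (simp add: algebra_simps)
    ultimately have "exp_span ?A ?B (\<lambda>t. cosh t * orbit_int (q + 1) i t)"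
      by (intro exp_span_cosh[OF IH]) (auto split: if_splits)
    moreover have "exp_span ?A ?B (orbit_int (q + 2) i)"
      by (rule exp_span_mono[OF IH]) (use m 3 in \<open>auto simp: algebra_simps\<close>)
    moreover have "exp_span ?A ?B (orbit_int q i)"
      by (rule exp_span_mono[OF IH]) (use m 3 in auto)
    ultimately have "exp_span ?A ?B (\<lambda>t. 2 * (cosh t * orbit_int (q + 1) i t)
        + (- 1) * orbit_int (q + 2) i t + (- 1) * orbit_int q i t)"
      by (intro exp_span.add exp_span.scale)
    moreover have "(\<lambda>t. 2 * (cosh t * orbit_int (q + 1) i t)
        + (- 1) * orbit_int (q + 2) i t + (- 1) * orbit_int q i t) = orbit_int q j"
      unfolding 3 by (rule ext) (rule orbit_int_Suc_Suc[symmetric])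
    ultimately show ?thesis by (simp only:)
  qed
qed

section \<open>Line integrals in a given parametrization\<close>

text \<open>
  Every parametrization by a solution is a translate of \<open>p \<circ> T\<^sup>-\<^sup>1\<close>, where \<open>T\<close> is the time needed to
  reach the parameter \<open>\<theta>\<close>.
\<close>

lemma flow_integral_param_pos:
  fixes p :: "real \<Rightarrow> real \<times> real"
  assumes bij: "bij_betw p {0<..<pi} \<Gamma>"
    and der: "\<And>\<theta>. \<theta> \<in> {0<..<pi} \<Longrightarrow> (p has_vector_derivative r \<theta> *\<^sub>R X (p \<theta>)) (at \<theta>)"
    and r: "continuous_on {0..pi} r" "\<And>\<theta>. \<theta> \<in> {0..pi} \<Longrightarrow> r \<theta> > 0"
    and nz: "\<And>\<theta>. \<theta> \<in> {0<..<pi} \<Longrightarrow> fst (X (p \<theta>)) \<noteq> 0"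
    and G: "continuous_on {0..pi} G"
    and GX: "\<And>\<theta>. \<theta> \<in> {0<..<pi} \<Longrightarrow>
      G \<theta> = r \<theta> * (P (p \<theta>) * fst (X (p \<theta>)) + Q (p \<theta>) * snd (X (p \<theta>)))"
  shows "flow_integral X \<Gamma> P Q = integral {0..pi} G"
proof -
  let ?I = "{0<..<pi}"
  define T where "T = (\<lambda>\<theta>. integral {0..\<theta>} r)"
  have T': "(T has_real_derivative r \<theta>) (at \<theta> within {0..pi})" if "\<theta> \<in> {0..pi}" for \<theta>
    unfolding T_def has_real_derivative_iff_has_vector_derivative
    using integral_has_vector_derivative[OF r(1) that] .
  have at_I: "at \<theta> within {0..pi} = at \<theta>" if "\<theta> \<in> ?I" for \<theta>
    using that by (intro at_within_interior) (simp add: interior_atLeastAtMost_real)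
  have T_at: "(T has_real_derivative r \<theta>) (at \<theta>)" if "\<theta> \<in> ?I" for \<theta>
    using T'[of \<theta>] at_I[OF that] that by simp
  have contT: "continuous_on {0..pi} T"
    using T' DERIV_continuous_on by blast
  have T_mono: "T x < T y" if "0 \<le> x" "x < y" "y \<le> pi" for x y
  proof (rule DERIV_pos_imp_increasing_open[OF that(2)])
    show "continuous_on {x..y} T" using contT by (rule continuous_on_subset) (use that in auto)
    fix z assume "x < z" "z < y"
    then show "\<exists>d. (T has_real_derivative d) (at z) \<and> 0 < d"
      using T_at[of z] r(2)[of z] that by auto
  qed
  have T0: "T 0 = 0" by (simp add: T_def)
  define b where "b = T pi"
  have b: "b > 0" using T_mono[of 0 pi] T0 by (simp add: b_def)
  have injT: "inj_on T {0..pi}"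
    by (rule linorder_inj_onI') (use T_mono in force)
  have imT: "T ` {0..pi} = {0..b}"
  proof
    show "T ` {0..pi} \<subseteq> {0..b}"
    proof
      fix y assume "y \<in> T ` {0..pi}"
      then obtain x where x: "x \<in> {0..pi}" "y = T x" by blast
      have "x = 0 \<or> T 0 < T x" using T_mono[of 0 x] x by (cases "x = 0") auto
      moreover have "x = pi \<or> T x < T pi" using T_mono[of x pi] x by (cases "x = pi") auto
      ultimately show "y \<in> {0..b}" using T0 x b by (auto simp: b_def)
    qed
    show "{0..b} \<subseteq> T ` {0..pi}"
    proof
      fix y assume "y \<in> {0..b}"
      then obtain x where "0 \<le> x" "x \<le> pi" "T x = y"
        using IVT'[of T 0 y pi] contT T0 by (auto simp: b_def)
      then show "y \<in> T ` {0..pi}" by auto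
    qed
  qed
  define g where "g = inv_into {0..pi} T"
  have gT: "g (T \<theta>) = \<theta>" if "\<theta> \<in> {0..pi}" for \<theta>
    unfolding g_def using inv_into_f_f[OF injT that] .
  have contg: "continuous_on {0..b} g"
    using continuous_on_inv[OF contT compact_Icc, of g] gT imT by simp
  have gI: "g u \<in> ?I" "T (g u) = u" if u: "u \<in> {0<..<b}" for u
  proof -
    have "u \<in> T ` {0..pi}" using u imT by auto
    then have "g u \<in> {0..pi}" "T (g u) = u" unfolding g_def using inv_into_into f_inv_into_f by metis+
    moreover have "g u \<noteq> 0" "g u \<noteq> pi" using \<open>T (g u) = u\<close> T0 u by (auto simp: b_def)
    ultimately show "g u \<in> ?I" "T (g u) = u" by auto
  qed
  have g': "(g has_real_derivative inverse (r (g u))) (at u)" if u: "u \<in> {0<..<b}" for u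
  proof (rule DERIV_inverse_function[where f = T and a = 0 and b = b])
    show "(T has_real_derivative r (g u)) (at (g u))" using T_at gI u by blast
    show "r (g u) \<noteq> 0" using r(2)[of "g u"] gI(1)[OF u] by auto
    have "continuous_on {0<..<b} g" using contg by (rule continuous_on_subset) auto
    then show "isCont g u" using u continuous_on_eq_continuous_at open_greaterThanLessThan by blast
  qed (use u gI in auto)
  have bijg: "bij_betw g {0<..<b} ?I"
  proof (rule bij_betw_byWitness[where f' = T])
    show "T ` ?I \<subseteq> {0<..<b}"
      using T_mono[of 0] T_mono[of _ pi] T0 by (auto simp: b_def)
  qed (use gI gT in auto)
  define H where "H = (\<lambda>\<theta>. integral {0..\<theta>} G)"
  have H': "(H has_real_derivative G \<theta>) (at \<theta> within {0..pi})" if "\<theta> \<in> {0..pi}" for \<theta>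
    unfolding H_def has_real_derivative_iff_has_vector_derivative
    using integral_has_vector_derivative[OF G that] .
  have contH: "continuous_on {0..pi} H" using H' DERIV_continuous_on by blast
  let ?f = "\<lambda>\<gamma> t. P (\<gamma> t) * fst (X (\<gamma> t)) + Q (\<gamma> t) * snd (X (\<gamma> t))"
  have along: "(?f \<gamma> has_integral integral {0..pi} G) {a<..<c}" if \<gamma>: "flow_param X \<Gamma> \<gamma> a c" for \<gamma> a c
  proof -
    have ac: "a < c" and bij\<gamma>: "bij_betw \<gamma> {a<..<c} \<Gamma>"
      and \<gamma>': "\<And>t. t \<in> {a<..<c} \<Longrightarrow> (\<gamma> has_vector_derivative X (\<gamma> t)) (at t)"
      using \<gamma> by (auto simp: flow_param_def)
    \<comment> \<open>The first component of \<open>X\<close> does not vanish on the arc, so x alone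
      is a coordinate there. Inverting the real function \<xi> makes the parameter \<phi> t of the
      point \<gamma> t differentiable in t.\<close>
    define \<xi> where "\<xi> = fst \<circ> p"
    have \<xi>': "(\<xi> has_real_derivative r \<theta> * fst (X (p \<theta>))) (at \<theta>)" if "\<theta> \<in> ?I" for \<theta>
      using bounded_linear.has_vector_derivative[OF bounded_linear_fst der[OF that]]
      by (simp add: \<xi>_def has_real_derivative_iff_has_vector_derivative comp_def)
    have \<xi>'nz: "r \<theta> * fst (X (p \<theta>)) \<noteq> 0" if "\<theta> \<in> ?I" for \<theta>
      using nz[OF that] r(2)[of \<theta>] that by auto
    have inj\<xi>: "inj_on \<xi> ?I"
    proof (rule linorder_inj_onI')
      fix x y assume xy: "x \<in> ?I" "y \<in> ?I" "x < y"
      show "\<xi> x \<noteq> \<xi> y"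
      proof
        assume eq: "\<xi> x = \<xi> y"
        have "\<exists>z. x < z \<and> z < y \<and> DERIV \<xi> z :> 0"
        proof (rule Rolle[OF xy(3) eq])
          show "continuous_on {x..y} \<xi>"
          proof (intro continuous_at_imp_continuous_on ballI)
            fix z assume "z \<in> {x..y}"
            then have "z \<in> ?I" using xy by auto
            then show "isCont \<xi> z" using \<xi>' DERIV_isCont by blast
          qed
          fix z assume "x < z" "z < y"
          then have "z \<in> ?I" using xy by auto
          then show "\<xi> differentiable (at z)" using \<xi>' real_differentiable_def by blast
        qed
        then obtain z where "x < z" "z < y" "DERIV \<xi> z :> 0" by blast
        moreover have "z \<in> ?I" using \<open>x < z\<close> \<open>z < y\<close> xy by auto
        ultimately show False using \<xi>'[of z] \<xi>'nz[of z] DERIV_unique by blast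
      qed
    qed
    define \<phi> where "\<phi> = inv_into ?I \<xi> \<circ> (fst \<circ> \<gamma>)"
    have \<phi>: "\<phi> t \<in> ?I" "p (\<phi> t) = \<gamma> t" if t: "t \<in> {a<..<c}" for t
    proof -
      have "\<gamma> t \<in> \<Gamma>" using bij\<gamma> t bij_betwE by blast
      then obtain \<theta> where \<theta>: "\<theta> \<in> ?I" "p \<theta> = \<gamma> t" using bij by (metis bij_betw_imp_surj_on imageE)
      then have "\<phi> t = \<theta>" unfolding \<phi>_def using inv_into_f_f[OF inj\<xi> \<theta>(1)] by (simp add: \<xi>_def)
      then show "\<phi> t \<in> ?I" "p (\<phi> t) = \<gamma> t" using \<theta> by auto
    qed
    have \<phi>': "(\<phi> has_real_derivative inverse (r (\<phi> t))) (at t)" if t: "t \<in> {a<..<c}" for t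
    proof -
      have 1: "((fst \<circ> \<gamma>) has_real_derivative fst (X (\<gamma> t))) (at t)"
        using bounded_linear.has_vector_derivative[OF bounded_linear_fst \<gamma>'[OF t]]
        by (simp add: has_real_derivative_iff_has_vector_derivative comp_def)
      have "((inv_into ?I \<xi>) has_real_derivative inverse (r (\<phi> t) * fst (X (p (\<phi> t))))) (at (\<xi> (\<phi> t)))"
        unfolding has_field_derivative_def
      proof (rule has_derivative_inverse_strong[where f = \<xi> and S = "?I"])
        show "continuous_on ?I \<xi>"
          using \<xi>' by (intro continuous_at_imp_continuous_on) (blast intro: DERIV_isCont)
        show "\<And>z. z \<in> ?I \<Longrightarrow> inv_into ?I \<xi> (\<xi> z) = z" using inv_into_f_f[OF inj\<xi>] .
        show "(\<xi> has_derivative (*) (r (\<phi> t) * fst (X (p (\<phi> t))))) (at (\<phi> t))"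
          using \<xi>'[OF \<phi>(1)[OF t]] by (simp add: has_field_derivative_def)
        show "(*) (r (\<phi> t) * fst (X (p (\<phi> t)))) \<circ> (*) (inverse (r (\<phi> t) * fst (X (p (\<phi> t))))) = id"
          using \<xi>'nz[OF \<phi>(1)[OF t]] by (auto simp: fun_eq_iff field_simps)
      qed (use \<phi>(1)[OF t] in auto)
      moreover have "\<xi> (\<phi> t) = (fst \<circ> \<gamma>) t" using \<phi>[OF t] by (simp add: \<xi>_def)
      ultimately have "(\<phi> has_real_derivative inverse (r (\<phi> t) * fst (X (p (\<phi> t)))) * fst (X (\<gamma> t))) (at t)"
        unfolding \<phi>_def using DERIV_chain[OF _ 1] by simp
      then show ?thesis using \<phi>[OF t] nz[of "\<phi> t"] by (simp add: mult.assoc)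
    qed
    \<comment> \<open>Both terms measure time along the same solution, so they differ by a
      constant.\<close>
    have "((\<lambda>t. T (\<phi> t) - t) has_real_derivative 0) (at t)" if t: "t \<in> {a<..<c}" for t
    proof -
      have "((\<lambda>t. T (\<phi> t) - t) has_real_derivative r (\<phi> t) * inverse (r (\<phi> t)) - 1) (at t)"
        using DERIV_chain2[OF T_at \<phi>'[OF t]] \<phi>[OF t] by (intro DERIV_diff DERIV_ident) auto
      moreover have "r (\<phi> t) \<noteq> 0" using r(2)[of "\<phi> t"] \<phi>(1)[OF t] by auto
      ultimately show ?thesis by simp
    qed
    then have "\<exists>d. \<forall>t\<in>{a<..<c}. T (\<phi> t) - t = d"
      by (intro has_field_derivative_zero_constant) (auto intro: has_field_derivative_at_within)
    then obtain d where d: "\<And>t. t \<in> {a<..<c} \<Longrightarrow> T (\<phi> t) = t + d"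
      by (metis add.commute diff_add_cancel)
    have "bij_betw \<phi> {a<..<c} ?I"
    proof -
      have "inj_on \<phi> {a<..<c}"
        using bij\<gamma> \<phi>(2) by (metis bij_betw_imp_inj_on inj_on_def)
      moreover have "?I \<subseteq> \<phi> ` {a<..<c}"
      proof
        fix \<theta> assume \<theta>: "\<theta> \<in> ?I"
        then have "p \<theta> \<in> \<Gamma>" using bij bij_betwE by blast
        then obtain t where t: "t \<in> {a<..<c}" "\<gamma> t = p \<theta>" using bij\<gamma> by (metis bij_betw_imp_surj_on imageE)
        then have "\<phi> t = \<theta>" using \<phi>[OF t(1)] bij \<theta> by (metis bij_betw_imp_inj_on inj_onD)
        then show "\<theta> \<in> \<phi> ` {a<..<c}" using t(1) by blast
      qed
      ultimately show ?thesis using \<phi>(1) unfolding bij_betw_def by blast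
    qed
    then have "(\<lambda>t. T (\<phi> t)) ` {a<..<c} = {0<..<b}"
      using bij_betw_imp_surj_on[OF bijg] gI(2) by (metis (no_types, lifting) bij_betw_imp_surj_on gT gI bij_betw_def image_image image_cong image_ident)
    moreover have "(\<lambda>t. T (\<phi> t)) ` {a<..<c} = {a + d<..<c + d}"
    proof -
      have "(\<lambda>t. T (\<phi> t)) ` {a<..<c} = (\<lambda>t. t + d) ` {a<..<c}" using d by (intro image_cong) auto
      also have "\<dots> = {a + d<..<c + d}"
      proof (intro equalityI subsetI)
        fix x assume "x \<in> {a + d<..<c + d}"
        then have "x = (x - d) + d" "x - d \<in> {a<..<c}" by auto
        then show "x \<in> (\<lambda>t. t + d) ` {a<..<c}" by blast
      qed auto
      finally show ?thesis .
    qed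
    ultimately have "{0<..<b} = {a + d<..<c + d}" by simp
    then have "a + d = 0" "c + d = b" using b ac
      by (smt (verit) greaterThanLessThan_eq_iff)+
    then have \<phi>g: "\<phi> t = g (t - a)" if "t \<in> {a<..<c}" for t
    proof -
      have "T (\<phi> t) = t - a" using d[OF that] \<open>a + d = 0\<close> by linarith
      then show ?thesis using gT[of "\<phi> t"] \<phi>(1)[OF that] by simp
    qed
    have ca: "c - a = b" using \<open>a + d = 0\<close> \<open>c + d = b\<close> by simp
    \<comment> \<open>The solution \<gamma> is given on the open interval only, but the primitive
      \<open>H \<circ> g\<close> extends continuously to its end points.\<close>
    have "(?f \<gamma> has_integral (H \<circ> g \<circ> (\<lambda>t. t - a)) c - (H \<circ> g \<circ> (\<lambda>t. t - a)) a) {a..c}"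
    proof (rule fundamental_theorem_of_calculus_interior)
      show "a \<le> c" using ac by simp
      show "continuous_on {a..c} (H \<circ> g \<circ> (\<lambda>t. t - a))"
      proof (intro continuous_on_compose continuous_intros)
        have *: "(\<lambda>t. t - a) ` {a..c} = {0..b}" using ca by simp
        show "continuous_on ((\<lambda>t. t - a) ` {a..c}) g" unfolding * by (rule contg)
        have "g ` {0..b} = {0..pi}"
          unfolding g_def imT[symmetric] using inj_on_inv_into inv_into_image_cancel[OF injT, of "{0..pi}"] by simp
        then show "continuous_on (g ` (\<lambda>t. t - a) ` {a..c}) H" unfolding * using contH by simp
      qed
      fix t assume t: "t \<in> {a<..<c}"
      have u: "t - a \<in> {0<..<b}" using t ca by auto
      have "((H \<circ> g \<circ> (\<lambda>t. t - a)) has_real_derivative G (\<phi> t) * inverse (r (\<phi> t)) * 1) (at t)"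
      proof (intro DERIV_chain)
        show "((\<lambda>t. t - a) has_real_derivative 1) (at t)" by (auto intro!: derivative_eq_intros)
        show "(g has_real_derivative inverse (r (\<phi> t))) (at (t - a))"
          using g'[OF u] \<phi>g[OF t] by simp
        show "(H has_real_derivative G (\<phi> t)) (at (g (t - a)))"
          using H'[of "\<phi> t"] at_I[OF \<phi>(1)[OF t]] \<phi>(1)[OF t] \<phi>g[OF t] by simp
      qed
      moreover have "G (\<phi> t) * inverse (r (\<phi> t)) * 1 = ?f \<gamma> t"
        using GX[OF \<phi>(1)[OF t]] r(2)[of "\<phi> t"] \<phi>[OF t] by (simp add: field_simps)
      ultimately show "((H \<circ> g \<circ> (\<lambda>t. t - a)) has_vector_derivative ?f \<gamma> t) (at t)"
        by (simp add: has_real_derivative_iff_has_vector_derivative)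
    qed
    moreover have "g 0 = 0" "g b = pi" using gT[of 0] gT[of pi] T0 by (auto simp: b_def)
    ultimately show ?thesis
      using ca by (simp add: H_def has_integral_Icc_iff_Ioo)
  qed
  \<comment> \<open>The definite description also requires that some parametrization exists.\<close>
  have "flow_param X \<Gamma> (p \<circ> g) 0 b"
    unfolding flow_param_def
  proof (intro conjI ballI)
    show "bij_betw (p \<circ> g) {0<..<b} \<Gamma>" using bij_betw_trans[OF bijg bij] .
    fix u assume u: "u \<in> {0<..<b}"
    have "((p \<circ> g) has_vector_derivative inverse (r (g u)) *\<^sub>R (r (g u) *\<^sub>R X (p (g u)))) (at u)"
      using g'[OF u] der[OF gI(1)[OF u]]
      by (intro vector_diff_chain_at) (simp_all add: has_real_derivative_iff_has_vector_derivative)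
    then show "((p \<circ> g) has_vector_derivative X ((p \<circ> g) u)) (at u)"
      using r(2)[of "g u"] gI(1)[OF u] by simp
  qed (rule b)
  then show ?thesis
    unfolding flow_integral_def using along
    by (intro the_equality) (blast intro: has_integral_unique)+
qed

text \<open>Here p runs against the flow; the reflection \<theta> -> pi - \<theta> reverses
  it.\<close>

lemma flow_integral_param_neg:
  fixes p :: "real \<Rightarrow> real \<times> real"
  assumes bij: "bij_betw p {0<..<pi} \<Gamma>"
    and der: "\<And>\<theta>. \<theta> \<in> {0<..<pi} \<Longrightarrow> (p has_vector_derivative r \<theta> *\<^sub>R X (p \<theta>)) (at \<theta>)"
    and r: "continuous_on {0..pi} r" "\<And>\<theta>. \<theta> \<in> {0..pi} \<Longrightarrow> r \<theta> < 0"
    and nz: "\<And>\<theta>. \<theta> \<in> {0<..<pi} \<Longrightarrow> fst (X (p \<theta>)) \<noteq> 0"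
    and G: "continuous_on {0..pi} G"
    and GX: "\<And>\<theta>. \<theta> \<in> {0<..<pi} \<Longrightarrow>
      G \<theta> = r \<theta> * (P (p \<theta>) * fst (X (p \<theta>)) + Q (p \<theta>) * snd (X (p \<theta>)))"
  shows "flow_integral X \<Gamma> P Q = - integral {0..pi} G"
proof -
  have bij': "bij_betw (\<lambda>\<theta>. pi - \<theta>) {0<..<pi} {0<..<pi}"
    by (rule bij_betw_byWitness[where f' = "\<lambda>\<theta>. pi - \<theta>"]) auto
  have refl: "continuous_on {0..pi} (\<lambda>\<theta>. f (pi - \<theta>))" if "continuous_on {0..pi} f" for f :: "real \<Rightarrow> real"
    by (rule continuous_on_compose2[OF that]) (auto intro!: continuous_intros)
  have "flow_integral X \<Gamma> P Q = integral {0..pi} (\<lambda>\<theta>. - G (pi - \<theta>))"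
  proof (rule flow_integral_param_pos[where p = "\<lambda>\<theta>. p (pi - \<theta>)" and r = "\<lambda>\<theta>. - r (pi - \<theta>)"])
    show "bij_betw (\<lambda>\<theta>. p (pi - \<theta>)) {0<..<pi} \<Gamma>"
      using bij_betw_trans[OF bij' bij] by (simp add: comp_def)
    fix \<theta> assume \<theta>: "\<theta> \<in> {0<..<pi}"
    have "((p \<circ> (\<lambda>\<theta>. pi - \<theta>)) has_vector_derivative (- 1) *\<^sub>R (r (pi - \<theta>) *\<^sub>R X (p (pi - \<theta>)))) (at \<theta>)"
      using \<theta> by (intro vector_diff_chain_at der) (auto intro!: derivative_eq_intros)
    then show "((\<lambda>\<theta>. p (pi - \<theta>)) has_vector_derivative - r (pi - \<theta>) *\<^sub>R X (p (pi - \<theta>))) (at \<theta>)"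
      by (simp add: comp_def)
    show "fst (X (p (pi - \<theta>))) \<noteq> 0" using nz \<theta> by simp
    show "- G (pi - \<theta>) = - r (pi - \<theta>) * (P (p (pi - \<theta>)) * fst (X (p (pi - \<theta>)))
        + Q (p (pi - \<theta>)) * snd (X (p (pi - \<theta>))))"
      using GX[of "pi - \<theta>"] \<theta> by simp
  next
    show "continuous_on {0..pi} (\<lambda>\<theta>. - r (pi - \<theta>))" "continuous_on {0..pi} (\<lambda>\<theta>. - G (pi - \<theta>))"
      by (intro continuous_intros refl r G)+
    show "- r (pi - \<theta>) > 0" if "\<theta> \<in> {0..pi}" for \<theta> using r(2) that by simp
  qed
  also have "\<dots> = - integral {0..pi} G"
  proof -
    have "(G has_integral integral {0..pi} G) (cbox 0 pi)"
      using integrable_integral[OF integrable_continuous_interval[OF G]] by simp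
    from has_integral_affinity[OF this, of "- 1" pi]
    have "((\<lambda>\<theta>. G (pi - \<theta>)) has_integral integral {0..pi} G) {0..pi}"
      by (simp add: image_affinity_atLeastAtMost_diff)
    then show ?thesis by (simp add: integral_unique)
  qed
  finally show ?thesis .
qed

text \<open>
  \<open>orbit_sum\<close> collects what the monomials of \<open>g dx - f dy\<close> contribute along \<open>x = A s\<^sup>\<alpha>\<close>,
  \<open>y = B s\<^sup>\<beta> w\<close> when \<open>x\<^sup>-\<^sup>k\<^sup>-\<^sup>1\<close> is a multiple of \<open>s\<^sup>e\<close>; the \<open>dy\<close> terms have been integrated by parts.
\<close>

definition orbit_sum ::
  "int \<Rightarrow> int \<Rightarrow> int \<Rightarrow> nat \<Rightarrow> (nat \<Rightarrow> nat \<Rightarrow> real) \<Rightarrow> (nat \<Rightarrow> nat \<Rightarrow> real) \<Rightarrow> real \<Rightarrow> real \<Rightarrow> real \<Rightarrow> real"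
  where
  "orbit_sum \<alpha> \<beta> e n a b A B t = (\<Sum>(i, j)\<in>{(i, j). i + j \<le> n}.
     b i j * (- of_int \<alpha> * A ^ (i + 1) * B ^ j) * orbit_int (e + \<alpha> * int (i + 1) - 1 + \<beta> * int j) j t
     + a i j * (- (A ^ i) * of_int (e + \<alpha> * int i) / real (j + 1) * B ^ (j + 1))
       * orbit_int (e + \<alpha> * int i - 1 + \<beta> * int (j + 1)) (j + 1) t)"

section \<open>Line integrals along the normalized orbits\<close>

lemma finite_degree_le: "finite {(i :: nat, j :: nat). i + j \<le> n}"
  by (rule finite_subset[of _ "{..n} \<times> {..n}"]) auto

lemma powi_inj:
  fixes x y :: real
  assumes "x > 0" "y > 0" "m \<noteq> 0" "x powi m = y powi m"
  shows "x = y"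
proof -
  have "of_int m * ln x = of_int m * ln y"
    using assms by (metis ln_powr powr_real_of_int' less_imp_le less_irrefl)
  then show ?thesis using assms by simp
qed

text \<open>The last factor is dy/d\<theta> for y = B s^\<beta> w. It has a term without w, so at j
  = 0 the integrand falls outside the family \<open>orbit_int\<close>; moving the derivative to s^q
  supplies the missing factor w. The boundary terms vanish because y does at 0 and pi.\<close>

lemma orbit_int_by_parts:
  "((\<lambda>\<theta>. orbit_s t \<theta> powi q * (B * orbit_s t \<theta> powi \<beta> * orbit_w t \<theta>) ^ j
      * (B * (orbit_s t \<theta> powi \<beta> * (orbit_s t \<theta> - cosh t) - of_int \<beta> * orbit_s t \<theta> powi (\<beta> - 1) * orbit_w t \<theta> ^ 2)))
    has_integral of_int q / real (j + 1) * B ^ (j + 1) * orbit_int (q - 1 + \<beta> * int (j + 1)) (j + 1) t) {0..pi}"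
proof -
  define y where "y = (\<lambda>\<theta>. B * orbit_s t \<theta> powi \<beta> * orbit_w t \<theta>)"
  define y' where "y' = (\<lambda>\<theta>. B * (orbit_s t \<theta> powi \<beta> * (orbit_s t \<theta> - cosh t) - of_int \<beta> * orbit_s t \<theta> powi (\<beta> - 1) * orbit_w t \<theta> ^ 2))"
  have y': "(y has_real_derivative y' \<theta>) (at \<theta>)" for \<theta>
  proof -
    have "((\<lambda>\<theta>. B * (orbit_s t \<theta> powi \<beta> * orbit_w t \<theta>)) has_real_derivative
      B * ((- of_int \<beta> * orbit_s t \<theta> powi (\<beta> - 1) * orbit_w t \<theta>) * orbit_w t \<theta> + (orbit_s t \<theta> - cosh t) * orbit_s t \<theta> powi \<beta>)) (at \<theta>)"
      by (intro DERIV_cmult DERIV_mult orbit_s_powi_deriv orbit_w_deriv)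
    then show ?thesis by (simp add: y_def y'_def power2_eq_square algebra_simps)
  qed
  let ?f' = "\<lambda>\<theta>. orbit_s t \<theta> powi q * y \<theta> ^ j * y' \<theta>
    - of_int q / real (j + 1) * B ^ (j + 1) * (orbit_s t \<theta> powi (q - 1 + \<beta> * int (j + 1)) * orbit_w t \<theta> ^ ((j + 1) + 1))"
  have "((\<lambda>\<theta>. orbit_s t \<theta> powi q * (y \<theta> ^ Suc j / real (j + 1))) has_real_derivative ?f' \<theta>) (at \<theta>)" for \<theta>
  proof -
    have D: "((\<lambda>\<theta>. orbit_s t \<theta> powi q * (y \<theta> ^ Suc j / real (j + 1))) has_real_derivative
      (- of_int q * orbit_s t \<theta> powi (q - 1) * orbit_w t \<theta>) * (y \<theta> ^ Suc j / real (j + 1))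
      + ((1 + real j) * (y' \<theta> * y \<theta> ^ j) / real (j + 1)) * orbit_s t \<theta> powi q) (at \<theta>)"
      by (intro DERIV_cdivide DERIV_mult orbit_s_powi_deriv DERIV_power_Suc y')
    have 1: "(1 + real j) * (y' \<theta> * y \<theta> ^ j) / real (j + 1) = y' \<theta> * y \<theta> ^ j" by simp
    have 2: "y \<theta> ^ Suc j = B ^ (j + 1) * orbit_s t \<theta> powi (\<beta> * int (j + 1)) * orbit_w t \<theta> ^ (j + 1)"
      by (simp add: y_def power_mult_distrib power_int_power' del: power_Suc)
    have 3: "orbit_s t \<theta> powi (q - 1 + \<beta> * int (j + 1)) = orbit_s t \<theta> powi (q - 1) * orbit_s t \<theta> powi (\<beta> * int (j + 1))"
      using orbit_s_pos[of t \<theta>] by (intro power_int_add) auto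
    have "(- of_int q * orbit_s t \<theta> powi (q - 1) * orbit_w t \<theta>) * (y \<theta> ^ Suc j / real (j + 1))
      + ((1 + real j) * (y' \<theta> * y \<theta> ^ j) / real (j + 1)) * orbit_s t \<theta> powi q = ?f' \<theta>"
      unfolding 1 2 3 by (simp add: mult_ac)
    with D show ?thesis by (rule DERIV_cong)
  qed
  moreover have "y 0 = 0" "y pi = 0" by (simp_all add: y_def)
  ultimately have "(?f' has_integral 0) {0..pi}" using FTC_0_pi by fastforce
  from has_integral_add[OF this has_integral_mult_right[OF
      orbit_int_has_integral[of t "q - 1 + \<beta> * int (j + 1)" "j + 1"], of "of_int q / real (j + 1) * B ^ (j + 1)"]]
  have "((\<lambda>\<theta>. orbit_s t \<theta> powi q * y \<theta> ^ j * y' \<theta>) has_integral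
     of_int q / real (j + 1) * B ^ (j + 1) * orbit_int (q - 1 + \<beta> * int (j + 1)) (j + 1) t) {0..pi}"
    by (simp only: diff_add_cancel add_0)
  then show ?thesis by (simp only: y_def y'_def)
qed

text \<open>The interface to the four systems: \<open>arc\<close> is the equation of the arc in
  normalized coordinates, the sign of B selecting the upper or the lower one; \<open>X\<close> says
  that the point moves with velocity c s^m X as \<theta> grows, so that \<open>sgn c\<close>
  compares the two orientations; \<open>W\<close> rewrites the weight.\<close>

lemma flow_integral_orbit:
  fixes X :: "real \<times> real \<Rightarrow> real \<times> real" and A B C c k t :: real
  assumes t: "t > 0" and \<alpha>: "\<alpha> \<noteq> 0" and A: "A \<noteq> 0" and B: "B \<noteq> 0" and c: "c \<noteq> 0"
    and arc: "\<And>x y. (x, y) \<in> \<Gamma> \<longleftrightarrow> (\<exists>s>0. x = A * s powi \<alpha>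
      \<and> y\<^sup>2 = (B * s powi \<beta>)\<^sup>2 * (2 * cosh t * s - s\<^sup>2 - 1) \<and> B * y > 0)"
    and X: "\<And>s w. s > 0 \<Longrightarrow> w > 0 \<Longrightarrow> w\<^sup>2 = 2 * cosh t * s - s\<^sup>2 - 1 \<Longrightarrow>
      (A * (- of_int \<alpha> * s powi (\<alpha> - 1) * w),
        B * (s powi \<beta> * (s - cosh t) - of_int \<beta> * s powi (\<beta> - 1) * w\<^sup>2))
      = (c * s powi m) *\<^sub>R X (A * s powi \<alpha>, B * s powi \<beta> * w)"
    and W: "\<And>s. s > 0 \<Longrightarrow> rpow (A * s powi \<alpha>) (- k - 1) = C * s powi e"
  shows "flow_integral X \<Gamma> (\<lambda>(x, y). rpow x (- k - 1) * bipoly n b x y)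
      (\<lambda>(x, y). - (rpow x (- k - 1) * bipoly n a x y))
    = sgn c * C * orbit_sum \<alpha> \<beta> e n a b A B t"
proof -
  define s where "s = orbit_s t"
  define w where "w = orbit_w t"
  have s: "s \<theta> > 0" for \<theta> by (simp add: s_def orbit_s_pos)
  have w: "w \<theta> > 0" if "\<theta> \<in> {0<..<pi}" for \<theta>
    using that t by (simp add: w_def orbit_w_def sin_gt_zero)
  have w2: "(w \<theta>)\<^sup>2 = 2 * cosh t * s \<theta> - (s \<theta>)\<^sup>2 - 1" for \<theta>
    by (simp add: s_def w_def orbit_w_sq)
  define x where "x = (\<lambda>\<theta>. A * s \<theta> powi \<alpha>)"
  define y where "y = (\<lambda>\<theta>. B * s \<theta> powi \<beta> * w \<theta>)"
  define x' where "x' = (\<lambda>\<theta>. A * (- of_int \<alpha> * s \<theta> powi (\<alpha> - 1) * w \<theta>))"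
  define y' where "y' = (\<lambda>\<theta>. B * (s \<theta> powi \<beta> * (s \<theta> - cosh t) - of_int \<beta> * s \<theta> powi (\<beta> - 1) * (w \<theta>)\<^sup>2))"
  have x': "(x has_real_derivative x' \<theta>) (at \<theta>)" for \<theta>
    unfolding x_def x'_def s_def w_def by (intro DERIV_cmult orbit_s_powi_deriv)
  have y': "(y has_real_derivative y' \<theta>) (at \<theta>)" for \<theta>
  proof -
    have "((\<lambda>\<theta>. B * (orbit_s t \<theta> powi \<beta> * orbit_w t \<theta>)) has_real_derivative
      B * ((- of_int \<beta> * orbit_s t \<theta> powi (\<beta> - 1) * orbit_w t \<theta>) * orbit_w t \<theta> + (orbit_s t \<theta> - cosh t) * orbit_s t \<theta> powi \<beta>)) (at \<theta>)"
      by (intro DERIV_cmult DERIV_mult orbit_s_powi_deriv orbit_w_deriv)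
    then show ?thesis by (simp add: y_def y'_def s_def w_def power2_eq_square algebra_simps)
  qed
  define p where "p = (\<lambda>\<theta>. (x \<theta>, y \<theta>))"
  define r where "r = (\<lambda>\<theta>. c * s \<theta> powi m)"
  have rX: "(x' \<theta>, y' \<theta>) = r \<theta> *\<^sub>R X (p \<theta>)" if "\<theta> \<in> {0<..<pi}" for \<theta>
    using X[OF s w[OF that] w2] unfolding x'_def y'_def r_def p_def x_def y_def by simp
  have der: "(p has_vector_derivative r \<theta> *\<^sub>R X (p \<theta>)) (at \<theta>)" if "\<theta> \<in> {0<..<pi}" for \<theta>
    unfolding rX[OF that, symmetric] unfolding p_def using x' y'
    by (intro has_vector_derivative_Pair) (simp_all add: has_real_derivative_iff_has_vector_derivative)
  have r0: "r \<theta> \<noteq> 0" for \<theta> using c s[of \<theta>] by (simp add: r_def)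
  have nz: "fst (X (p \<theta>)) \<noteq> 0" if "\<theta> \<in> {0<..<pi}" for \<theta>
  proof -
    have "r \<theta> * fst (X (p \<theta>)) = x' \<theta>" using rX[OF that] by (metis fst_conv fst_scaleR real_scaleR_def)
    moreover have "x' \<theta> \<noteq> 0" using A \<alpha> s[of \<theta>] w[OF that] by (simp add: x'_def)
    ultimately show ?thesis by auto
  qed
  have bij: "bij_betw p {0<..<pi} \<Gamma>"
    unfolding bij_betw_def
  proof
    show "inj_on p {0<..<pi}"
    proof (rule inj_onI)
      fix \<theta> \<theta>' assume \<theta>: "\<theta> \<in> {0<..<pi}" "\<theta>' \<in> {0<..<pi}" and "p \<theta> = p \<theta>'"
      then have "s \<theta> powi \<alpha> = s \<theta>' powi \<alpha>" using A by (simp add: p_def x_def)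
      then have "s \<theta> = s \<theta>'" by (rule powi_inj[OF s s \<alpha>])
      then have "cos \<theta> = cos \<theta>'" using t by (simp add: s_def orbit_s_def)
      then show "\<theta> = \<theta>'" by (rule cos_inj_pi[rotated 4]) (use \<theta> in auto)
    qed
    show "p ` {0<..<pi} = \<Gamma>"
    proof (intro equalityI subsetI)
      fix z assume "z \<in> p ` {0<..<pi}"
      then obtain \<theta> where \<theta>: "\<theta> \<in> {0<..<pi}" "z = p \<theta>" by blast
      have "(x \<theta>, y \<theta>) \<in> \<Gamma>"
        unfolding arc
      proof (intro exI[of _ "s \<theta>"] conjI s)
        show "(y \<theta>)\<^sup>2 = (B * s \<theta> powi \<beta>)\<^sup>2 * (2 * cosh t * s \<theta> - (s \<theta>)\<^sup>2 - 1)"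
          unfolding w2[symmetric] y_def by (simp add: power_mult_distrib)
        have "B * y \<theta> = B\<^sup>2 * (s \<theta> powi \<beta> * w \<theta>)" by (simp add: y_def power2_eq_square)
        then show "B * y \<theta> > 0" using B s w[OF \<theta>(1)] by simp
      qed (simp add: x_def)
      then show "z \<in> \<Gamma>" using \<theta>(2) by (simp add: p_def)
    next
      fix z assume "z \<in> \<Gamma>"
      then obtain u v \<sigma> where z: "z = (u, v)" "\<sigma> > 0" "u = A * \<sigma> powi \<alpha>"
        "v\<^sup>2 = (B * \<sigma> powi \<beta>)\<^sup>2 * (2 * cosh t * \<sigma> - \<sigma>\<^sup>2 - 1)" "B * v > 0"
        using arc by (metis surj_pair)
      \<comment> \<open>The candidate for cos \<theta>; v \<noteq> 0 confines it to the open
        interval from -1 to 1.\<close>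
      define \<kappa> where "\<kappa> = (\<sigma> - cosh t) / sinh t"
      have sh: "sinh t > 0" using t by simp
      have eq: "2 * cosh t * \<sigma> - \<sigma>\<^sup>2 - 1 = (sinh t)\<^sup>2 * (1 - \<kappa>\<^sup>2)"
      proof -
        have "(sinh t)\<^sup>2 * (1 - \<kappa>\<^sup>2) = (sinh t)\<^sup>2 - (\<sigma> - cosh t)\<^sup>2"
          using sh by (simp add: \<kappa>_def power_divide right_diff_distrib)
        then show ?thesis using cosh_square_eq[of t] by (simp add: power2_eq_square algebra_simps)
      qed
      have "v\<^sup>2 > 0" using z(5) by auto
      then have "0 < (B * \<sigma> powi \<beta>)\<^sup>2 * ((sinh t)\<^sup>2 * (1 - \<kappa>\<^sup>2))"
        using z(4) unfolding eq by (simp only:)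
      then have "1 - \<kappa>\<^sup>2 > 0" by (auto simp: zero_less_mult_iff)
      then have \<kappa>: "- 1 < \<kappa>" "\<kappa> < 1" using abs_square_less_1[of \<kappa>] by auto
      define \<theta> where "\<theta> = arccos \<kappa>"
      have \<theta>: "\<theta> \<in> {0<..<pi}" using arccos_lt_bounded[OF \<kappa>] by (simp add: \<theta>_def)
      have "cos \<theta> = \<kappa>" using \<kappa> by (simp add: \<theta>_def)
      then have "s \<theta> = \<sigma>" using sh by (simp add: s_def orbit_s_def \<kappa>_def)
      have "v\<^sup>2 = (y \<theta>)\<^sup>2"
        using z(4) \<open>s \<theta> = \<sigma>\<close> w2[of \<theta>] by (simp add: y_def power_mult_distrib)
      moreover have "B * y \<theta> > 0"
      proof -
        have "B * y \<theta> = B\<^sup>2 * (s \<theta> powi \<beta> * w \<theta>)" by (simp add: y_def power2_eq_square)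
        then show ?thesis using B s w[OF \<theta>] by simp
      qed
      ultimately have "v = y \<theta>" using z(5) by (auto simp: power2_eq_iff)
      then have "z = p \<theta>" using z \<open>s \<theta> = \<sigma>\<close> by (simp add: p_def x_def)
      then show "z \<in> p ` {0<..<pi}" using \<theta> by blast
    qed
  qed
  define G where "G = (\<lambda>\<theta>. C * s \<theta> powi e * (bipoly n b (x \<theta>) (y \<theta>) * x' \<theta> - bipoly n a (x \<theta>) (y \<theta>) * y' \<theta>))"
  have cs: "continuous_on S s" "continuous_on S w" "continuous_on S (\<lambda>\<theta>. s \<theta> powi q)" for S q
    unfolding s_def w_def by (rule continuous_intros)+
  have cont: "continuous_on S x" "continuous_on S y" "continuous_on S x'" "continuous_on S y'" for S
    unfolding x_def y_def x'_def y'_def by (intro continuous_intros cs)+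
  have contG: "continuous_on {0..pi} G"
    unfolding G_def bipoly_def case_prod_beta
    by (intro continuous_on_mult continuous_on_diff continuous_on_sum continuous_on_power
        continuous_on_const cs cont)
  have contr: "continuous_on {0..pi} r" unfolding r_def by (intro continuous_on_mult continuous_on_const cs)
  have GX: "G \<theta> = r \<theta> * ((\<lambda>(x, y). rpow x (- k - 1) * bipoly n b x y) (p \<theta>) * fst (X (p \<theta>))
      + (\<lambda>(x, y). - (rpow x (- k - 1) * bipoly n a x y)) (p \<theta>) * snd (X (p \<theta>)))"
    if "\<theta> \<in> {0<..<pi}" for \<theta>
  proof -
    have "x' \<theta> = r \<theta> * fst (X (p \<theta>))" "y' \<theta> = r \<theta> * snd (X (p \<theta>))"
      using rX[OF that] by (metis fst_conv fst_scaleR real_scaleR_def, metis snd_conv snd_scaleR real_scaleR_def)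
    moreover have "rpow (x \<theta>) (- k - 1) = C * s \<theta> powi e" unfolding x_def by (rule W[OF s])
    ultimately show ?thesis by (simp add: G_def p_def algebra_simps)
  qed
  have "flow_integral X \<Gamma> (\<lambda>(x, y). rpow x (- k - 1) * bipoly n b x y)
      (\<lambda>(x, y). - (rpow x (- k - 1) * bipoly n a x y)) = sgn c * integral {0..pi} G"
  proof (cases "c > 0")
    case True
    then have "r \<theta> > 0" for \<theta> using s by (simp add: r_def)
    from flow_integral_param_pos[OF bij der contr this nz contG GX] True show ?thesis by simp
  next
    case False
    then have "r \<theta> < 0" for \<theta> using s c by (simp add: r_def mult_neg_pos)
    from flow_integral_param_neg[OF bij der contr this nz contG GX] False c show ?thesis by simp
  qed
  also have "integral {0..pi} G = C * orbit_sum \<alpha> \<beta> e n a b A B t"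
  proof -
    let ?I = "{(i, j). i + j \<le> n}"
    \<comment> \<open>In the b-terms x' already carries the factor w; the a-terms keep y' for the
      integration by parts.\<close>
    define g where "g = (\<lambda>(i, j) \<theta>. b i j * (- of_int \<alpha> * A ^ (i + 1) * B ^ j) * (s \<theta> powi (e + \<alpha> * int (i + 1) - 1 + \<beta> * int j) * w \<theta> ^ (j + 1))
        + (- a i j * A ^ i) * (s \<theta> powi (e + \<alpha> * int i) * y \<theta> ^ j * y' \<theta>))"
    have G_eq: "G \<theta> = C * (\<Sum>ij\<in>?I. g ij \<theta>)" for \<theta>
    proof -
      have "s \<theta> powi e * (b i j * x \<theta> ^ i * y \<theta> ^ j * x' \<theta> - a i j * x \<theta> ^ i * y \<theta> ^ j * y' \<theta>) = g (i, j) \<theta>" for i j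
      proof -
        have 1: "x \<theta> ^ i = A ^ i * s \<theta> powi (\<alpha> * int i)"
          by (simp add: x_def power_mult_distrib power_int_power')
        have 2: "y \<theta> ^ j = B ^ j * s \<theta> powi (\<beta> * int j) * w \<theta> ^ j"
          by (simp add: y_def power_mult_distrib power_int_power')
        have "e + \<alpha> * int (i + 1) - 1 + \<beta> * int j = e + \<alpha> * int i + (\<alpha> - 1) + \<beta> * int j"
          by (simp add: algebra_simps)
        then have 3: "s \<theta> powi (e + \<alpha> * int (i + 1) - 1 + \<beta> * int j)
          = s \<theta> powi e * s \<theta> powi (\<alpha> * int i) * s \<theta> powi (\<alpha> - 1) * s \<theta> powi (\<beta> * int j)"
          using s[of \<theta>] by (simp only:) (subst power_int_add; simp)+
        have 4: "s \<theta> powi (e + \<alpha> * int i) = s \<theta> powi e * s \<theta> powi (\<alpha> * int i)"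
          using s[of \<theta>] by (intro power_int_add) auto
        have "s \<theta> powi e * (b i j * x \<theta> ^ i * y \<theta> ^ j * x' \<theta>)
          = b i j * (- of_int \<alpha> * A ^ (i + 1) * B ^ j) * (s \<theta> powi (e + \<alpha> * int (i + 1) - 1 + \<beta> * int j) * w \<theta> ^ (j + 1))"
          unfolding 1 2 3 x'_def by (simp add: mult_ac)
        moreover have "s \<theta> powi e * (a i j * x \<theta> ^ i * y \<theta> ^ j * y' \<theta>)
          = (a i j * A ^ i) * (s \<theta> powi (e + \<alpha> * int i) * y \<theta> ^ j * y' \<theta>)"
          unfolding 1 4 by (simp add: mult_ac)
        ultimately show ?thesis unfolding g_def by (simp add: right_diff_distrib)
      qed
      then have "(\<Sum>ij\<in>?I. g ij \<theta>) = (\<Sum>(i, j)\<in>?I. s \<theta> powi e * (b i j * x \<theta> ^ i * y \<theta> ^ j * x' \<theta> - a i j * x \<theta> ^ i * y \<theta> ^ j * y' \<theta>))"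
        by (intro sum.cong) auto
      then show ?thesis
        unfolding G_def bipoly_def
        by (simp add: sum_distrib_left sum_distrib_right sum_subtractf case_prod_beta mult_ac right_diff_distrib)
    qed
    have "((\<lambda>\<theta>. C * (\<Sum>ij\<in>?I. g ij \<theta>)) has_integral C * orbit_sum \<alpha> \<beta> e n a b A B t) {0..pi}"
      unfolding orbit_sum_def
    proof (intro has_integral_mult_right has_integral_sum finite_degree_le)
      fix ij assume "ij \<in> ?I"
      obtain i j where ij: "ij = (i, j)" by fastforce
      have "(g (i, j) has_integral
        b i j * (- of_int \<alpha> * A ^ (i + 1) * B ^ j) * orbit_int (e + \<alpha> * int (i + 1) - 1 + \<beta> * int j) j t
        + (- a i j * A ^ i) * (of_int (e + \<alpha> * int i) / real (j + 1) * B ^ (j + 1)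
          * orbit_int (e + \<alpha> * int i - 1 + \<beta> * int (j + 1)) (j + 1) t)) {0..pi}"
        unfolding g_def case_prod_conv y_def y'_def s_def w_def
        by (intro has_integral_add has_integral_mult_right orbit_int_has_integral orbit_int_by_parts)
      then show "(g ij has_integral (case ij of (i, j) \<Rightarrow>
        b i j * (- of_int \<alpha> * A ^ (i + 1) * B ^ j) * orbit_int (e + \<alpha> * int (i + 1) - 1 + \<beta> * int j) j t
        + a i j * (- (A ^ i) * of_int (e + \<alpha> * int i) / real (j + 1) * B ^ (j + 1))
          * orbit_int (e + \<alpha> * int i - 1 + \<beta> * int (j + 1)) (j + 1) t)) {0..pi}"
        unfolding ij case_prod_conv by (simp add: mult_ac)
    qed
    then show ?thesis unfolding G_eq[abs_def, symmetric] by (rule integral_unique)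
  qed
  finally show ?thesis by simp
qed

section \<open>The arcs of the four systems\<close>

definition half_arc :: "case_id \<Rightarrow> real \<Rightarrow> real \<Rightarrow> (real \<times> real) set" where
  "half_arc c \<delta> h = {(x, y). x \<in> xdom c \<and> HH c x y = h \<and> \<delta> * y > 0}"

lemma upper_arc_eq: "upper_arc c h = half_arc c 1 h"
  and lower_arc_eq: "lower_arc c h = half_arc c (- 1) h"
  by (auto simp: upper_arc_def lower_arc_def half_arc_def)

lemma rpow_of_int: "rpow x (of_int m) = x powi m"
  by (simp add: rpow_def)

text \<open>Odd m keeps m / 2 out of the integers, so \<open>rpow\<close> takes its
  \<open>powr\<close> branch. With x = s^2 this clears the half-integral exponents of
  \<open>R19\<close> and \<open>R20\<close>.\<close>

lemma rpow_half: "s > 0 \<Longrightarrow> odd m \<Longrightarrow> rpow (s\<^sup>2) (of_int m / 2) = s powi m"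
proof -
  assume s: "s > 0" and m: "odd m"
  have "(of_int m / 2 :: real) \<notin> \<int>"
  proof
    assume "(of_int m / 2 :: real) \<in> \<int>"
    then obtain z where "(of_int m / 2 :: real) = of_int z" by (auto elim: Ints_cases)
    then have "(of_int m :: real) = of_int (2 * z)" by simp
    then have "m = 2 * z" using of_int_eq_iff by blast
    then show False using m by simp
  qed
  then have "rpow (s\<^sup>2) (of_int m / 2) = (s\<^sup>2) powr (of_int m / 2)" by (simp add: rpow_def)
  moreover have e: "s\<^sup>2 = s powr 2" using s by simp
  have "(s\<^sup>2) powr (of_int m / 2) = s powr of_int m" unfolding e by (simp add: powr_powr)
  moreover have "s powr of_int m = s powi m" using s by (simp add: powr_real_of_int')
  ultimately show ?thesis by simp
qed

text \<open>For x = A s the terms linear in x merge, and the level curve becomes 2 y^2 = 2 s cosh t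
  - s^2 - 1. The sign A tells the half-plane x > 0 from x < 0.\<close>

lemma flow_integral_S1:
  assumes t: "t > 0" and \<delta>: "\<delta> = 1 \<or> \<delta> = - 1" and A: "A = 1 \<or> A = - 1"
  shows "flow_integral (vfield S1) (half_arc S1 \<delta> ((A * cosh t - 1) / 2))
      (\<lambda>(x, y). rpow x (- kk S1 - 1) * bipoly n b x y) (\<lambda>(x, y). - (rpow x (- kk S1 - 1) * bipoly n a x y))
    = sgn (- \<delta>) * 1 * orbit_sum 1 0 (- 2) n a b A (\<delta> / sqrt 2) t"
proof (rule flow_integral_orbit[OF t, where m = "- 1"])
  have \<delta>2: "\<delta> * \<delta> = 1" and A2: "A * A = 1" using \<delta> A by auto
  have c1: "cosh t > 1" using t cosh_real_strict_mono[of 0 t] by simp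
  show "(x, y) \<in> half_arc S1 \<delta> ((A * cosh t - 1) / 2) \<longleftrightarrow>
    (\<exists>s>0. x = A * s powi 1 \<and> y\<^sup>2 = (\<delta> / sqrt 2 * s powi 0)\<^sup>2 * (2 * cosh t * s - s\<^sup>2 - 1) \<and> \<delta> / sqrt 2 * y > 0)"
    for x y
  proof -
    have HH: "HH S1 x y = (y\<^sup>2 / 2 + (x - 1)\<^sup>2 / 4) / x"
    proof -
      have rp: "rpow x (- kk S1) = 1 / x"
        using rpow_of_int[of x "- 1"] by (simp add: power_int_minus inverse_eq_divide)
      have Q: "1/2 * y\<^sup>2 + lam2 S1 * x\<^sup>2 + lam1 S1 * x + lam0 S1 = y\<^sup>2 / 2 + (x - 1)\<^sup>2 / 4"
        by (simp add: power2_eq_square field_simps)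
      show ?thesis unfolding HH_def rp Q by simp
    qed
    have H: "HH S1 x y = (A * cosh t - 1) / 2 \<longleftrightarrow> 2 * y\<^sup>2 + (x - 1)\<^sup>2 = 2 * (A * cosh t - 1) * x"
      if "x \<noteq> 0" unfolding HH using that by (auto simp: field_simps)
    \<comment> \<open>\<open>xdom S1\<close> admits both half-planes, so the level must decide: the
      left-hand side is positive as y \<noteq> 0, and A cosh t - 1 has the sign of A.\<close>
    have pos: "A * x > 0" if "x \<noteq> 0" "2 * y\<^sup>2 + (x - 1)\<^sup>2 = 2 * (A * cosh t - 1) * x" "\<delta> * y > 0"
    proof -
      have "y \<noteq> 0" using that by auto
      then have "2 * y\<^sup>2 + (x - 1)\<^sup>2 > 0" by (simp add: add_pos_nonneg)
      then have "2 * (A * cosh t - 1) * x > 0" using that(2) by (simp only:)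
      then show ?thesis using A c1 by (auto simp: zero_less_mult_iff)
    qed
    have eq: "2 * y\<^sup>2 + (A * s - 1)\<^sup>2 = 2 * (A * cosh t - 1) * (A * s)
        \<longleftrightarrow> y\<^sup>2 = (\<delta> / sqrt 2)\<^sup>2 * (2 * cosh t * s - s\<^sup>2 - 1)" for s
    proof -
      have "(\<delta> / sqrt 2)\<^sup>2 = 1 / 2" using \<delta>2 by (simp add: power_divide power2_eq_square)
      moreover have "(A * s - 1)\<^sup>2 = s\<^sup>2 - 2 * A * s + 1" "(A * cosh t - 1) * (A * s) = cosh t * s - A * s"
        using A by auto (auto simp: power2_eq_square algebra_simps)
      ultimately show ?thesis using A by (auto simp: field_simps)
    qed
    have \<delta>y: "\<delta> / sqrt 2 * y > 0 \<longleftrightarrow> \<delta> * y > 0" by (simp add: zero_less_mult_iff zero_less_divide_iff)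
    show ?thesis
    proof
      assume "(x, y) \<in> half_arc S1 \<delta> ((A * cosh t - 1) / 2)"
      then have *: "x \<noteq> 0" "2 * y\<^sup>2 + (x - 1)\<^sup>2 = 2 * (A * cosh t - 1) * x" "\<delta> * y > 0"
        using H by (auto simp: half_arc_def)
      have "x = A * (A * x)" using A by auto
      moreover have "y\<^sup>2 = (\<delta> / sqrt 2)\<^sup>2 * (2 * cosh t * (A * x) - (A * x)\<^sup>2 - 1)"
        using eq[of "A * x"] * A by auto
      ultimately show "\<exists>s>0. x = A * s powi 1 \<and> y\<^sup>2 = (\<delta> / sqrt 2 * s powi 0)\<^sup>2 * (2 * cosh t * s - s\<^sup>2 - 1) \<and> \<delta> / sqrt 2 * y > 0"
        using pos[OF *] *(3) \<delta>y by (intro exI[of _ "A * x"]) simp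
    next
      assume "\<exists>s>0. x = A * s powi 1 \<and> y\<^sup>2 = (\<delta> / sqrt 2 * s powi 0)\<^sup>2 * (2 * cosh t * s - s\<^sup>2 - 1) \<and> \<delta> / sqrt 2 * y > 0"
      then obtain s where s: "s > 0" "x = A * s" "y\<^sup>2 = (\<delta> / sqrt 2)\<^sup>2 * (2 * cosh t * s - s\<^sup>2 - 1)" "\<delta> * y > 0"
        using \<delta>y by auto
      then have "x \<noteq> 0" using A by auto
      then show "(x, y) \<in> half_arc S1 \<delta> ((A * cosh t - 1) / 2)"
        using H eq[of s] s by (simp add: half_arc_def)
    qed
  qed
  show "(A * (- of_int 1 * s powi (1 - 1) * w),
      \<delta> / sqrt 2 * (s powi 0 * (s - cosh t) - of_int 0 * s powi (0 - 1) * w\<^sup>2))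
    = (- \<delta> * s powi - 1) *\<^sub>R vfield S1 (A * s powi 1, \<delta> / sqrt 2 * s powi 0 * w)"
    if "s > 0" "w > 0" "w\<^sup>2 = 2 * cosh t * s - s\<^sup>2 - 1" for s w
  proof -
    have e: "2 * (\<delta> / sqrt 2 * w)\<^sup>2 = w\<^sup>2" "(A * s)\<^sup>2 = s\<^sup>2"
      using \<delta>2 A2 by (simp_all add: power_mult_distrib power_divide power2_eq_square)
    have "sqrt 2 / 4 * (1 - (A * s)\<^sup>2 + 2 * (\<delta> / sqrt 2 * w)\<^sup>2) = sqrt 2 / 4 * (2 * s * (cosh t - s))"
      unfolding e that(3) by (simp add: power2_eq_square algebra_simps)
    also have "\<dots> = 1 / sqrt 2 * (s * (cosh t - s))"
      by (simp add: field_simps)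
    finally have "sqrt 2 / 4 * (1 - (A * s)\<^sup>2 + 2 * (\<delta> / sqrt 2 * w)\<^sup>2) = 1 / sqrt 2 * (s * (cosh t - s))" .
    then have V: "vfield S1 (A * s powi 1, \<delta> / sqrt 2 * s powi 0 * w)
      = (A * s * \<delta> * w, 1 / sqrt 2 * (s * (cosh t - s)))"
      by simp
    show ?thesis unfolding V using \<delta> that(1)
      by (auto simp: power_int_minus field_simps)
  qed
  show "rpow (A * s powi 1) (- kk S1 - 1) = 1 * s powi - 2" if "s > 0" for s
    using rpow_of_int[of "A * s" "- 2"] A by (auto simp: power_int_minus)
qed (use \<delta> A in auto)

text \<open>In u = 1/x and v = y/x the level curve is the conic v^2 / 2 + (1 - u)^2 = h, whose end
  points 1 - sqrt h and 1 + sqrt h have the product 1 - h. Scaling u by cosh t = 1 / sqrt (1 - h)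
  makes them reciprocal. This is the only case in which A depends on t.\<close>

lemma flow_integral_S2:
  assumes t: "t > 0" and \<delta>: "\<delta> = 1 \<or> \<delta> = - 1"
  shows "flow_integral (vfield S2) (half_arc S2 \<delta> (1 - 1 / (cosh t)\<^sup>2))
      (\<lambda>(x, y). rpow x (- kk S2 - 1) * bipoly n b x y) (\<lambda>(x, y). - (rpow x (- kk S2 - 1) * bipoly n a x y))
    = sgn \<delta> * inverse (cosh t ^ 3) * orbit_sum (- 1) (- 1) 3 n a b (cosh t) (\<delta> * sqrt 2) t"
proof (rule flow_integral_orbit[OF t, where m = 0])
  have \<delta>2: "\<delta> * \<delta> = 1" using \<delta> by auto
  have c0: "cosh t > 0" by simp
  have \<delta>y: "\<delta> * sqrt 2 * y > 0 \<longleftrightarrow> \<delta> * y > 0" for y using \<delta> by (auto simp: zero_less_mult_iff mult_less_0_iff)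
  have B2: "(\<delta> * sqrt 2 * u)\<^sup>2 = 2 * u\<^sup>2" for u
    using \<delta> by (auto simp: power_mult_distrib)
  show "(x, y) \<in> half_arc S2 \<delta> (1 - 1 / (cosh t)\<^sup>2) \<longleftrightarrow>
    (\<exists>s>0. x = cosh t * s powi - 1 \<and> y\<^sup>2 = (\<delta> * sqrt 2 * s powi - 1)\<^sup>2 * (2 * cosh t * s - s\<^sup>2 - 1) \<and> \<delta> * sqrt 2 * y > 0)"
    for x y
  proof -
    have eq: "HH S2 x y = 1 - 1 / (cosh t)\<^sup>2
        \<longleftrightarrow> y\<^sup>2 = (\<delta> * sqrt 2 * s powi - 1)\<^sup>2 * (2 * cosh t * s - s\<^sup>2 - 1)"
      if s: "s > 0" "x = cosh t / s" for s
    proof -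
      have "HH S2 x y = (y\<^sup>2 / 2 + (x - 1)\<^sup>2) / x\<^sup>2"
    proof -
      have rp: "rpow x (- kk S2) = 1 / x\<^sup>2"
        using rpow_of_int[of x "- 2"] by (simp add: power_int_minus inverse_eq_divide)
      have Q: "1/2 * y\<^sup>2 + lam2 S2 * x\<^sup>2 + lam1 S2 * x + lam0 S2 = y\<^sup>2 / 2 + (x - 1)\<^sup>2"
        by (simp add: power2_eq_square field_simps)
      show ?thesis unfolding HH_def rp Q by simp
    qed
      also have "\<dots> = (s\<^sup>2 * y\<^sup>2 / 2 + (cosh t - s)\<^sup>2) / (cosh t)\<^sup>2"
      proof -
        have "cosh t / s - 1 = (cosh t - s) / s" using s(1) by (simp add: field_simps)
        then show ?thesis using s(1) c0 unfolding s(2) by (simp add: power_divide field_simps)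
      qed
      finally have HH: "HH S2 x y = (s\<^sup>2 * y\<^sup>2 / 2 + (cosh t - s)\<^sup>2) / (cosh t)\<^sup>2" .
      have "HH S2 x y = 1 - 1 / (cosh t)\<^sup>2 \<longleftrightarrow> s\<^sup>2 * y\<^sup>2 / 2 + (cosh t - s)\<^sup>2 = (cosh t)\<^sup>2 - 1"
      proof -
        have "N / D = 1 - 1 / D \<longleftrightarrow> N = D - 1" if "D > 0" for N D :: real
          using that by (simp add: field_simps)
        then show ?thesis unfolding HH using c0 by simp
      qed
      also have "\<dots> \<longleftrightarrow> s\<^sup>2 * y\<^sup>2 = 2 * (2 * cosh t * s - s\<^sup>2 - 1)"
        by (auto simp: power2_eq_square algebra_simps)
      also have "\<dots> \<longleftrightarrow> y\<^sup>2 = 2 * (2 * cosh t * s - s\<^sup>2 - 1) / s\<^sup>2"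
        using s by (auto simp: field_simps)
      also have "2 * (2 * cosh t * s - s\<^sup>2 - 1) / s\<^sup>2 = (\<delta> * sqrt 2 * s powi - 1)\<^sup>2 * (2 * cosh t * s - s\<^sup>2 - 1)"
        unfolding B2 by (simp add: power_int_minus divide_inverse power_inverse)
      finally show ?thesis .
    qed
    show ?thesis
    proof
      assume *: "(x, y) \<in> half_arc S2 \<delta> (1 - 1 / (cosh t)\<^sup>2)"
      then have "x > 0" by (simp add: half_arc_def)
      then have "cosh t / x > 0" "x = cosh t / (cosh t / x)" using c0 by (simp_all add: field_simps)
      then show "\<exists>s>0. x = cosh t * s powi - 1 \<and> y\<^sup>2 = (\<delta> * sqrt 2 * s powi - 1)\<^sup>2 * (2 * cosh t * s - s\<^sup>2 - 1) \<and> \<delta> * sqrt 2 * y > 0"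
        using eq[of "cosh t / x"] \<delta>y *
        by (intro exI[of _ "cosh t / x"]) (auto simp: half_arc_def power_int_minus)
    next
      assume "\<exists>s>0. x = cosh t * s powi - 1 \<and> y\<^sup>2 = (\<delta> * sqrt 2 * s powi - 1)\<^sup>2 * (2 * cosh t * s - s\<^sup>2 - 1) \<and> \<delta> * sqrt 2 * y > 0"
      then obtain s where s: "s > 0" "x = cosh t / s"
        "y\<^sup>2 = (\<delta> * sqrt 2 * s powi - 1)\<^sup>2 * (2 * cosh t * s - s\<^sup>2 - 1)" "\<delta> * y > 0"
        unfolding \<delta>y by (auto simp: power_int_minus divide_inverse)
      then show "(x, y) \<in> half_arc S2 \<delta> (1 - 1 / (cosh t)\<^sup>2)"
        using eq[OF s(1,2)] c0 by (simp add: half_arc_def)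
    qed
  qed
  show "(cosh t * (- of_int (- 1) * s powi (- 1 - 1) * w),
      \<delta> * sqrt 2 * (s powi - 1 * (s - cosh t) - of_int (- 1) * s powi (- 1 - 1) * w\<^sup>2))
    = (\<delta> * s powi 0) *\<^sub>R vfield S2 (cosh t * s powi - 1, \<delta> * sqrt 2 * s powi - 1 * w)"
    if "s > 0" "w > 0" "w\<^sup>2 = 2 * cosh t * s - s\<^sup>2 - 1" for s w
  proof -
    have m2: "s powi - 2 = 1 / s\<^sup>2" "s powi - 1 = 1 / s" using that by (simp_all add: power_int_minus divide_inverse)
    have "(\<delta> * sqrt 2 * (1 / s) * w)\<^sup>2 = 2 * w\<^sup>2 / s\<^sup>2"
      using B2[of "w / s"] by (simp add: power_divide)
    then have "vfield S2 (cosh t * (1 / s), \<delta> * sqrt 2 * (1 / s) * w)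
      = (\<delta> * cosh t * w / s\<^sup>2, sqrt 2 * (1 - cosh t / s + w\<^sup>2 / s\<^sup>2))"
      by (simp add: power2_eq_square field_simps)
    then show ?thesis using \<delta>2 that(1)
      by (simp add: m2 power2_eq_square field_simps)
  qed
  show "rpow (cosh t * s powi - 1) (- kk S2 - 1) = inverse (cosh t ^ 3) * s powi 3" if "s > 0" for s
    using rpow_of_int[of "cosh t * s powi - 1" "- 3"]
    by (simp add: power_int_minus power_mult_distrib power_inverse)
qed (use \<delta> in auto)

text \<open>With x = s^2 and y = \<delta> s w / 8 the first integral becomes (w^2 + s^2 + 1) / (128
  s), which is cosh t / 64 on the normalized conic.\<close>

lemma flow_integral_R19:
  assumes t: "t > 0" and \<delta>: "\<delta> = 1 \<or> \<delta> = - 1"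
  shows "flow_integral (vfield R19) (half_arc R19 \<delta> (cosh t / 64))
      (\<lambda>(x, y). rpow x (- kk R19 - 1) * bipoly n b x y) (\<lambda>(x, y). - (rpow x (- kk R19 - 1) * bipoly n a x y))
    = sgn (16 * \<delta>) * 1 * orbit_sum 2 1 (- 5) n a b 1 (\<delta> / 8) t"
proof (rule flow_integral_orbit[OF t, where m = "- 2"])
  have \<delta>2: "\<delta> * \<delta> = 1" using \<delta> by auto
  have \<delta>y: "\<delta> / 8 * y > 0 \<longleftrightarrow> \<delta> * y > 0" for y by (simp add: zero_less_mult_iff)
  have B2: "(\<delta> / 8 * u)\<^sup>2 = u\<^sup>2 / 64" for u
    using \<delta>2 by (simp add: power_mult_distrib power2_eq_square)
  show "(x, y) \<in> half_arc R19 \<delta> (cosh t / 64) \<longleftrightarrow>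
    (\<exists>s>0. x = 1 * s powi 2 \<and> y\<^sup>2 = (\<delta> / 8 * s powi 1)\<^sup>2 * (2 * cosh t * s - s\<^sup>2 - 1) \<and> \<delta> / 8 * y > 0)"
    for x y
  proof -
    have eq: "HH R19 x y = cosh t / 64
        \<longleftrightarrow> y\<^sup>2 = (\<delta> / 8 * s)\<^sup>2 * (2 * cosh t * s - s\<^sup>2 - 1)"
      if s: "s > 0" "x = s\<^sup>2" for s
    proof -
      have HH: "HH R19 x y = (y\<^sup>2 / 2 + (s\<^sup>2)\<^sup>2 / 128 + s\<^sup>2 / 128) / s ^ 3"
    proof -
      have rp: "rpow x (- kk R19) = 1 / s ^ 3"
        using rpow_half[OF s(1), of "- 3"] s(2) by (simp add: power_int_minus inverse_eq_divide)
      have Q: "1/2 * y\<^sup>2 + lam2 R19 * x\<^sup>2 + lam1 R19 * x + lam0 R19 = y\<^sup>2 / 2 + (s\<^sup>2)\<^sup>2 / 128 + s\<^sup>2 / 128"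
        by (simp add: s(2) power2_eq_square field_simps)
      show ?thesis unfolding HH_def rp Q by simp
    qed
      have "HH R19 x y = cosh t / 64 \<longleftrightarrow> y\<^sup>2 / 2 + (s\<^sup>2)\<^sup>2 / 128 + s\<^sup>2 / 128 = cosh t / 64 * s ^ 3"
        unfolding HH using s(1) by (simp add: field_simps)
      also have "\<dots> \<longleftrightarrow> y\<^sup>2 = s\<^sup>2 / 64 * (2 * cosh t * s - s\<^sup>2 - 1)"
        by (auto simp: power2_eq_square power3_eq_cube field_simps)
      finally show ?thesis unfolding B2 .
    qed
    show ?thesis
    proof
      assume *: "(x, y) \<in> half_arc R19 \<delta> (cosh t / 64)"
      then have "x > 0" by (simp add: half_arc_def)
      then show "\<exists>s>0. x = 1 * s powi 2 \<and> y\<^sup>2 = (\<delta> / 8 * s powi 1)\<^sup>2 * (2 * cosh t * s - s\<^sup>2 - 1) \<and> \<delta> / 8 * y > 0"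
        using eq[of "sqrt x"] \<delta>y * by (intro exI[of _ "sqrt x"]) (simp add: half_arc_def)
    next
      assume "\<exists>s>0. x = 1 * s powi 2 \<and> y\<^sup>2 = (\<delta> / 8 * s powi 1)\<^sup>2 * (2 * cosh t * s - s\<^sup>2 - 1) \<and> \<delta> / 8 * y > 0"
      then obtain s where s: "s > 0" "x = s\<^sup>2"
        "y\<^sup>2 = (\<delta> / 8 * s)\<^sup>2 * (2 * cosh t * s - s\<^sup>2 - 1)" "\<delta> * y > 0"
        unfolding \<delta>y by auto
      then show "(x, y) \<in> half_arc R19 \<delta> (cosh t / 64)"
        using eq[OF s(1,2)] by (simp add: half_arc_def)
    qed
  qed
  show "(1 * (- of_int 2 * s powi (2 - 1) * w),
      \<delta> / 8 * (s powi 1 * (s - cosh t) - of_int 1 * s powi (1 - 1) * w\<^sup>2))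
    = (16 * \<delta> * s powi - 2) *\<^sub>R vfield R19 (1 * s powi 2, \<delta> / 8 * s powi 1 * w)"
    if "s > 0" "w > 0" "w\<^sup>2 = 2 * cosh t * s - s\<^sup>2 - 1" for s w
  proof -
    have m2: "s powi - 2 = 1 / s\<^sup>2" using that by (simp add: power_int_minus divide_inverse)
    have "(\<delta> / 8 * s * w)\<^sup>2 = s\<^sup>2 * w\<^sup>2 / 64"
      using \<delta> by (auto simp: power_mult_distrib power_divide)
    then have V0: "vfield R19 (s\<^sup>2, \<delta> / 8 * s * w)
      = (- \<delta> / 8 * s ^ 3 * w, s\<^sup>2 / 256 * (s\<^sup>2 - 1 - 3 * w\<^sup>2))"
      by (simp add: power2_eq_square power3_eq_cube algebra_simps)
    have E: "s\<^sup>2 - 1 - 3 * w\<^sup>2 = 2 * (s * (s - cosh t) - w\<^sup>2)"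
      using that(3) by (simp add: power2_eq_square algebra_simps)
    have V: "vfield R19 (1 * s powi 2, \<delta> / 8 * s powi 1 * w)
      = (- \<delta> / 8 * s ^ 3 * w, s\<^sup>2 / 256 * (2 * (s * (s - cosh t) - w\<^sup>2)))"
      using V0 unfolding E by (simp del: vfield.simps)
    show ?thesis unfolding V using \<delta> that(1)
      by (auto simp: m2 power3_eq_cube power2_eq_square field_simps)
  qed
  show "rpow (1 * s powi 2) (- kk R19 - 1) = 1 * s powi - 5" if "s > 0" for s
    using rpow_half[OF that, of "- 5"] by simp
qed (use \<delta> in auto)

text \<open>The same expression (w^2 + s^2 + 1) / (128 s) for \<open>HH\<close> arises from x = s^2
  and y = \<delta> w / 8.\<close>

lemma flow_integral_R20:
  assumes t: "t > 0" and \<delta>: "\<delta> = 1 \<or> \<delta> = - 1"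
  shows "flow_integral (vfield R20) (half_arc R20 \<delta> (cosh t / 64))
      (\<lambda>(x, y). rpow x (- kk R20 - 1) * bipoly n b x y) (\<lambda>(x, y). - (rpow x (- kk R20 - 1) * bipoly n a x y))
    = sgn (16 * \<delta>) * 1 * orbit_sum 2 0 (- 3) n a b 1 (\<delta> / 8) t"
proof (rule flow_integral_orbit[OF t, where m = "- 1"])
  have \<delta>2: "\<delta> * \<delta> = 1" using \<delta> by auto
  have \<delta>y: "\<delta> / 8 * y > 0 \<longleftrightarrow> \<delta> * y > 0" for y by (simp add: zero_less_mult_iff)
  have B2: "(\<delta> / 8 * u)\<^sup>2 = u\<^sup>2 / 64" for u
    using \<delta>2 by (simp add: power_mult_distrib power2_eq_square)
  show "(x, y) \<in> half_arc R20 \<delta> (cosh t / 64) \<longleftrightarrow>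
    (\<exists>s>0. x = 1 * s powi 2 \<and> y\<^sup>2 = (\<delta> / 8 * s powi 0)\<^sup>2 * (2 * cosh t * s - s\<^sup>2 - 1) \<and> \<delta> / 8 * y > 0)"
    for x y
  proof -
    have eq: "HH R20 x y = cosh t / 64
        \<longleftrightarrow> y\<^sup>2 = (\<delta> / 8 * 1)\<^sup>2 * (2 * cosh t * s - s\<^sup>2 - 1)"
      if s: "s > 0" "x = s\<^sup>2" for s
    proof -
      have HH: "HH R20 x y = (y\<^sup>2 / 2 + s\<^sup>2 / 128 + 1 / 128) / s"
    proof -
      have rp: "rpow x (- kk R20) = 1 / s"
        using rpow_half[OF s(1), of "- 1"] s(2) by (simp add: power_int_minus inverse_eq_divide)
      have Q: "1/2 * y\<^sup>2 + lam2 R20 * x\<^sup>2 + lam1 R20 * x + lam0 R20 = y\<^sup>2 / 2 + s\<^sup>2 / 128 + 1 / 128"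
        by (simp add: s(2) power2_eq_square field_simps)
      show ?thesis unfolding HH_def rp Q by simp
    qed
      have "HH R20 x y = cosh t / 64 \<longleftrightarrow> y\<^sup>2 / 2 + s\<^sup>2 / 128 + 1 / 128 = cosh t / 64 * s"
        unfolding HH using s(1) by (simp add: field_simps)
      also have "\<dots> \<longleftrightarrow> y\<^sup>2 = 1\<^sup>2 / 64 * (2 * cosh t * s - s\<^sup>2 - 1)"
        by (auto simp: field_simps)
      finally show ?thesis unfolding B2 .
    qed
    show ?thesis
    proof
      assume *: "(x, y) \<in> half_arc R20 \<delta> (cosh t / 64)"
      then have "x > 0" by (simp add: half_arc_def)
      then show "\<exists>s>0. x = 1 * s powi 2 \<and> y\<^sup>2 = (\<delta> / 8 * s powi 0)\<^sup>2 * (2 * cosh t * s - s\<^sup>2 - 1) \<and> \<delta> / 8 * y > 0"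
        using eq[of "sqrt x"] \<delta>y * by (intro exI[of _ "sqrt x"]) (simp add: half_arc_def)
    next
      assume "\<exists>s>0. x = 1 * s powi 2 \<and> y\<^sup>2 = (\<delta> / 8 * s powi 0)\<^sup>2 * (2 * cosh t * s - s\<^sup>2 - 1) \<and> \<delta> / 8 * y > 0"
      then obtain s where s: "s > 0" "x = s\<^sup>2"
        "y\<^sup>2 = (\<delta> / 8 * 1)\<^sup>2 * (2 * cosh t * s - s\<^sup>2 - 1)" "\<delta> * y > 0"
        unfolding \<delta>y by auto
      then show "(x, y) \<in> half_arc R20 \<delta> (cosh t / 64)"
        using eq[OF s(1,2)] by (simp add: half_arc_def)
    qed
  qed
  show "(1 * (- of_int 2 * s powi (2 - 1) * w),
      \<delta> / 8 * (s powi 0 * (s - cosh t) - of_int 0 * s powi (0 - 1) * w\<^sup>2))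
    = (16 * \<delta> * s powi - 1) *\<^sub>R vfield R20 (1 * s powi 2, \<delta> / 8 * s powi 0 * w)"
    if "s > 0" "w > 0" "w\<^sup>2 = 2 * cosh t * s - s\<^sup>2 - 1" for s w
  proof -
    have m1: "s powi - 1 = 1 / s" using that by (simp add: power_int_minus divide_inverse)
    have "(\<delta> / 8 * w)\<^sup>2 = w\<^sup>2 / 64" using B2[of w] .
    then have "vfield R20 (s\<^sup>2, \<delta> / 8 * w) = (- \<delta> / 8 * s\<^sup>2 * w, (s\<^sup>2 - 1 - w\<^sup>2) / 256)"
      by (simp add: power2_eq_square algebra_simps)
    moreover have "s\<^sup>2 - 1 - w\<^sup>2 = 2 * s * (s - cosh t)"
      using that(3) by (simp add: power2_eq_square algebra_simps)
    ultimately show ?thesis using \<delta> that(1)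
      by (auto simp: m1 power2_eq_square field_simps)
  qed
  show "rpow (1 * s powi 2) (- kk R20 - 1) = 1 * s powi - 3" if "s > 0" for s
    using rpow_half[OF that, of "- 3"] by simp
qed (use \<delta> in auto)

section \<open>Counting frequencies\<close>

text \<open>A term of g with indices (i, j) counts as (i + 1, j), and after the integration by parts
  a term of f counts as (i, j + 1), both in the same formula. Hence the pairs to be considered have
  sum at most n + 1, and (0, 0) does not occur.\<close>

lemma exp_span_orbit_sum:
  assumes "\<And>i j. 0 < i + j \<Longrightarrow> i + j \<le> n + 1 \<Longrightarrow>
    exp_span P Q (\<lambda>t. A t ^ i * orbit_int (e + \<alpha> * int i - 1 + \<beta> * int j) j t)"
  shows "exp_span P Q (\<lambda>t. orbit_sum \<alpha> \<beta> e n a b (A t) B t)"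
proof -
  have "exp_span P Q (\<lambda>t. \<Sum>ij\<in>{(i, j). i + j \<le> n}.
      (b (fst ij) (snd ij) * (- of_int \<alpha> * B ^ snd ij))
        * (A t ^ (fst ij + 1) * orbit_int (e + \<alpha> * int (fst ij + 1) - 1 + \<beta> * int (snd ij)) (snd ij) t)
      + (a (fst ij) (snd ij) * (- of_int (e + \<alpha> * int (fst ij)) / real (snd ij + 1) * B ^ (snd ij + 1)))
        * (A t ^ fst ij * orbit_int (e + \<alpha> * int (fst ij) - 1 + \<beta> * int (snd ij + 1)) (snd ij + 1) t))" (is "exp_span P Q ?f")
    by (intro exp_span_sum exp_span.add exp_span.scale assms finite_degree_le) auto
  also have "?f = (\<lambda>t. orbit_sum \<alpha> \<beta> e n a b (A t) B t)"
    unfolding orbit_sum_def by (intro ext sum.cong refl) (auto simp: algebra_simps)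
  finally show ?thesis .
qed

lemma orbit_sum_at_0: "orbit_sum \<alpha> \<beta> e n a b A B 0 = 0"
  by (simp add: orbit_sum_def orbit_int_at_0)

lemma num_isolated_zeros_orbit_sum:
  fixes \<tau> M :: "real \<Rightarrow> real"
  assumes "open S" "inj_on \<tau> S" "\<And>h. h \<in> S \<Longrightarrow> \<tau> h > 0"
    and "\<And>h. h \<in> S \<Longrightarrow> (\<tau> has_real_derivative \<kappa> (\<tau> h)) (at h)"
    and "smooth_fun \<kappa>" "\<And>t. t > 0 \<Longrightarrow> \<kappa> t \<noteq> 0"
    and "smooth_fun \<phi>" "\<And>t. t > 0 \<Longrightarrow> \<phi> t \<noteq> 0"
    and M: "\<And>h. h \<in> S \<Longrightarrow> M h = \<phi> (\<tau> h) *
      (c * orbit_sum \<alpha> \<beta> e n a b (A (\<tau> h)) B (\<tau> h) + c' * orbit_sum \<alpha> \<beta> e n a' b' (A (\<tau> h)) B' (\<tau> h))"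
    and "\<And>i j. 0 < i + j \<Longrightarrow> i + j \<le> n + 1 \<Longrightarrow>
      exp_span P Q (\<lambda>t. A t ^ i * orbit_int (e + \<alpha> * int i - 1 + \<beta> * int j) j t)"
    and "finite P" "Q \<subseteq> P"
  shows "num_isolated_zeros M S \<le> enat (card P + card Q - 2)"
proof (rule num_isolated_zeros_le[OF assms(1-8) M])
  show "exp_span P Q (\<lambda>t. c * orbit_sum \<alpha> \<beta> e n a b (A t) B t + c' * orbit_sum \<alpha> \<beta> e n a' b' (A t) B' t)"
    by (intro exp_span.add exp_span.scale exp_span_orbit_sum assms)
qed (use assms in \<open>auto simp: orbit_sum_at_0\<close>)

lemma arcosh_deriv:
  fixes \<eta> :: "real \<Rightarrow> real"
  assumes "(\<eta> has_real_derivative d) (at h)" "\<eta> h > 1"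
  shows "((\<lambda>h. arcosh (\<eta> h)) has_real_derivative d * inverse (sinh (arcosh (\<eta> h)))) (at h)"
proof -
  have "sinh (arcosh (\<eta> h)) = sqrt (\<eta> h ^ 2 - 1)"
    using assms(2) by (simp add: sinh_arcosh_real)
  then show ?thesis
    using DERIV_chain2[OF arcosh_real_has_field_derivative[OF assms(2)] assms(1)]
    by (simp add: divide_inverse mult.commute)
qed

lemma arcosh_pos: "x > 1 \<Longrightarrow> arcosh x > 0" for x :: real
  by simp

lemma finite_parity_range: "finite (parity_range m)"
  unfolding parity_range_def by (rule finite_subset[of _ "{- m..m}"]) auto

lemma card_parity_range: "card (parity_range m) = nat (m + 1)"
proof (cases "m \<ge> 0")
  case True
  have "parity_range m = (\<lambda>i. m - 2 * int i) ` {..nat m}"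
  proof (intro equalityI subsetI)
    fix k assume k: "k \<in> parity_range m"
    then have "even (k - m)" unfolding parity_range_def by blast
    then obtain l where l: "k - m = 2 * l" by (rule evenE)
    then have "k = m - 2 * int (nat (- l))" "nat (- l) \<le> nat m" using k by (auto simp: parity_range_def)
    then show "k \<in> (\<lambda>i. m - 2 * int i) ` {..nat m}" by blast
  qed (use True in \<open>auto simp: parity_range_def\<close>)
  moreover have "inj_on (\<lambda>i. m - 2 * int i) {..nat m}" by (auto simp: inj_on_def)
  ultimately show ?thesis using True by (simp add: card_image nat_add_distrib)
next
  case False
  then have "parity_range m = {}" unfolding parity_range_def by auto
  then show ?thesis using False by simp
qed

lemma card_parity_range_Un_le:
  "card (parity_range l \<union> parity_range m) \<le> nat (l + 1) + nat (m + 1)"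
  using card_Un_le[of "parity_range l" "parity_range m"] by (simp add: card_parity_range)

section \<open>Frequency counts and zero bounds for the four systems\<close>

lemma num_isolated_zeros_S1_half:
  assumes A: "A = 1 \<or> A = - 1" and S: "S = {h. A * (1 + 2 * h) > 1}"
  shows "num_isolated_zeros (MM S1 n ap am bp bm) S \<le> enat (2 * n + 15)"
proof -
  define \<tau> where "\<tau> = (\<lambda>h. arcosh (A * (1 + 2 * h)))"
  have cosh\<tau>: "cosh (\<tau> h) = A * (1 + 2 * h)" if "h \<in> S" for h
    using that unfolding S \<tau>_def by simp
  have \<tau>: "\<tau> h > 0" if "h \<in> S" for h using that unfolding S \<tau>_def by (intro arcosh_pos) simp
  have h: "h = (A * cosh (\<tau> h) - 1) / 2" if "h \<in> S" for h
    using A unfolding cosh\<tau>[OF that] by auto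
  \<comment> \<open>Here q = i - 3, with bounds 2 - i and i + j - 2, so t occurs with frequencies up
    to 2 at most. Full intervals, without regard to parity, suffice: they give 2 n + 8.\<close>
  define m where "m = int n + 2"
  have "num_isolated_zeros (MM S1 n ap am bp bm) S \<le> enat (card {- m..m} + card {- 2..2 :: int} - 2)"
  proof (rule num_isolated_zeros_orbit_sum[where \<tau> = \<tau> and \<kappa> = "\<lambda>t. 2 * A * inverse (sinh t)"
        and \<phi> = "\<lambda>t. 1" and A = "\<lambda>t. A" and c = "- 1" and c' = 1 and \<alpha> = 1 and \<beta> = 0 and e = "- 2"
        and n = n and a = ap and b = bp and a' = am and b' = bm and B = "1 / sqrt 2" and B' = "- 1 / sqrt 2"])
    show "open S" unfolding S by (intro open_Collect_less continuous_intros)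
    show "inj_on \<tau> S" by (rule inj_onI) (metis h)
    show "(\<tau> has_real_derivative 2 * A * inverse (sinh (\<tau> h))) (at h)" if "h \<in> S" for h
      unfolding \<tau>_def using that S by (intro arcosh_deriv) (auto intro!: derivative_eq_intros)
    show "smooth_fun (\<lambda>t. 2 * A * inverse (sinh t))"
      by (intro smooth_fun.mult smooth_fun_const smooth_fun.inv_sinh)
    show "MM S1 n ap am bp bm h = 1 * (- 1 * orbit_sum 1 0 (- 2) n ap bp A (1 / sqrt 2) (\<tau> h)
      + 1 * orbit_sum 1 0 (- 2) n am bm A (- 1 / sqrt 2) (\<tau> h))" if "h \<in> S" for h
      using flow_integral_S1[OF \<tau>[OF that] _ A, of 1 n bp ap] flow_integral_S1[OF \<tau>[OF that] _ A, of "- 1" n bm am]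
      by (simp add: MM_def upper_arc_eq lower_arc_eq h[OF that, symmetric])
    show "exp_span {- m..m} {- 2..2} (\<lambda>t. A ^ i * orbit_int (- 2 + 1 * int i - 1 + 0 * int j) j t)"
      if "0 < i + j" "i + j \<le> n + 1" for i j
      by (rule exp_span.scale, rule exp_span_mono[OF exp_span_orbit_int])
        (use that in \<open>auto simp: parity_range_def m_def\<close>)
  qed (use A \<tau> smooth_fun_const in \<open>auto simp: m_def\<close>)
  also have "card {- m..m} + card {- 2..2 :: int} - 2 \<le> 2 * n + 15"
    by (simp add: m_def)
  finally show ?thesis by simp
qed

lemma num_isolated_zeros_S1:
  "num_isolated_zeros (MM S1 n ap am bp bm) (Sigma_h S1) \<le> enat (4 * n + 30)"
proof -
  have "{..<-1} = {h :: real. - 1 * (1 + 2 * h) > 1}" "{0<..} = {h :: real. 1 * (1 + 2 * h) > 1}" by auto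
  then have "num_isolated_zeros (MM S1 n ap am bp bm) {..<-1} \<le> enat (2 * n + 15)"
    "num_isolated_zeros (MM S1 n ap am bp bm) {0<..} \<le> enat (2 * n + 15)"
    by (intro num_isolated_zeros_S1_half[where A = "- 1"] num_isolated_zeros_S1_half[where A = 1]; simp)+
  then have "num_isolated_zeros (MM S1 n ap am bp bm) ({..<-1} \<union> {0<..}) \<le> enat (2 * n + 15) + enat (2 * n + 15)"
    by (intro order.trans[OF num_isolated_zeros_Un] add_mono) auto
  then show ?thesis by simp
qed

lemma exp_span_cosh_power:
  assumes "exp_span (parity_range l \<union> parity_range m) (if c then parity_range l \<inter> parity_range m else {}) f"
  shows "exp_span (parity_range (l + int i) \<union> parity_range (m + int i))
    (if c then parity_range (l + int i) \<inter> parity_range (m + int i) else {}) (\<lambda>t. cosh t ^ i * f t)"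
proof (induction i)
  case 0
  then show ?case using assms by (simp only: of_nat_0 add_0_right power_0 mult_1)
next
  case (Suc i)
  have e: "l + int (Suc i) = l + int i + 1" "m + int (Suc i) = m + int i + 1" by simp_all
  have "exp_span (parity_range (l + int (Suc i)) \<union> parity_range (m + int (Suc i)))
    (if c then parity_range (l + int (Suc i)) \<inter> parity_range (m + int (Suc i)) else {})
    (\<lambda>t. cosh t * (cosh t ^ i * f t))"
    unfolding e by (rule exp_span_cosh[OF Suc.IH]) (use parity_range_shift in \<open>auto split: if_splits\<close>)
  then show ?case by (simp only: power_Suc mult.assoc)
qed

lemma num_isolated_zeros_S2:
  "num_isolated_zeros (MM S2 n ap am bp bm) (Sigma_h S2) \<le> enat (if n \<ge> 1 then 10 * n - 4 else 2)"
proof -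
  define \<tau> where "\<tau> = (\<lambda>h. arcosh (1 / sqrt (1 - h)))"
  have gt1: "1 / sqrt (1 - h) > 1" if "h \<in> {0<..<1}" for h :: real
    using that by (simp add: real_less_lsqrt)
  have cosh\<tau>: "cosh (\<tau> h) = 1 / sqrt (1 - h)" if "h \<in> {0<..<1}" for h
    using gt1[OF that] by (simp add: \<tau>_def)
  have \<tau>: "\<tau> h > 0" if "h \<in> {0<..<1}" for h unfolding \<tau>_def by (rule arcosh_pos[OF gt1[OF that]])
  have h: "h = 1 - 1 / (cosh (\<tau> h))\<^sup>2" if "h \<in> {0<..<1}" for h
    using that unfolding cosh\<tau>[OF that] by (simp add: power_divide)
  \<comment> \<open>Including the factor (cosh t)^i the bounds are 3 and 2 i + j - 3. The latter
    reaches 2 n - 1 at (n + 1, 0), and 2 n - 2 in the other parity at (n, 1).\<close>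
  define P where "P = parity_range (if n \<ge> 2 then 2 * int n - 1 else 3) \<union> parity_range (2 * int n - 2)"
  define Q where "Q = (if n \<ge> 2 then parity_range 3 else {})"
  have "num_isolated_zeros (MM S2 n ap am bp bm) {0<..<1} \<le> enat (card P + card Q - 2)"
  proof (rule num_isolated_zeros_orbit_sum[where \<tau> = \<tau>
        and \<kappa> = "\<lambda>t. 1 / 2 * (cosh t ^ 3 * inverse (sinh t))" and \<phi> = "\<lambda>t. inverse (cosh t) ^ 3"
        and A = cosh and c = 1 and c' = "- 1" and \<alpha> = "- 1" and \<beta> = "- 1" and e = 3
        and n = n and a = ap and b = bp and a' = am and b' = bm and B = "sqrt 2" and B' = "- sqrt 2"])
    show "inj_on \<tau> {0<..<1}" by (rule inj_onI) (metis h)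
    show "(\<tau> has_real_derivative 1 / 2 * (cosh (\<tau> h) ^ 3 * inverse (sinh (\<tau> h)))) (at h)"
      if "h \<in> {0<..<1}" for h
    proof -
      have "((\<lambda>h. 1 / sqrt (1 - h)) has_real_derivative 1 / 2 * (1 / sqrt (1 - h)) ^ 3) (at h)"
        using that by (auto intro!: derivative_eq_intros simp: power3_eq_cube power2_eq_square field_simps)
      from arcosh_deriv[OF this gt1[OF that]] show ?thesis
        unfolding cosh\<tau>[OF that] unfolding \<tau>_def by (simp only: mult.assoc)
    qed
    show "smooth_fun (\<lambda>t. 1 / 2 * (cosh t ^ 3 * inverse (sinh t)))"
      by (intro smooth_fun.mult smooth_fun_const smooth_fun.inv_sinh smooth_fun_power smooth_fun_cosh)
    show "smooth_fun (\<lambda>t. inverse (cosh t) ^ 3)"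
      by (intro smooth_fun_power smooth_fun.inv_cosh)
    show "MM S2 n ap am bp bm h = inverse (cosh (\<tau> h)) ^ 3 *
        (1 * orbit_sum (- 1) (- 1) 3 n ap bp (cosh (\<tau> h)) (sqrt 2) (\<tau> h)
        + - 1 * orbit_sum (- 1) (- 1) 3 n am bm (cosh (\<tau> h)) (- sqrt 2) (\<tau> h))" if "h \<in> {0<..<1}" for h
      using flow_integral_S2[OF \<tau>[OF that], of 1 n bp ap] flow_integral_S2[OF \<tau>[OF that], of "- 1" n bm am]
      by (simp add: MM_def upper_arc_eq lower_arc_eq h[OF that, symmetric] power_inverse algebra_simps)
    show "exp_span P Q (\<lambda>t. cosh t ^ i * orbit_int (3 + - 1 * int i - 1 + - 1 * int j) j t)"
      if "0 < i + j" "i + j \<le> n + 1" for i j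
    proof -
      have e: "- (3 + - 1 * int i - 1 + - 1 * int j) - 1 = int i + int j - 3"
        "3 + - 1 * int i - 1 + - 1 * int j + int j + 1 = 3 - int i" by simp_all
      \<comment> \<open>For n \<le> 1 the bound i + j - 3 is negative and no t occurs. This must be
        recorded before multiplying by (cosh t)^i, which raises the bound to 2 i + j - 3.\<close>
      let ?c = "even j \<and> n \<ge> 2"
      have "exp_span (parity_range (int i + int j - 3) \<union> parity_range (3 - int i))
        (if ?c then parity_range (int i + int j - 3) \<inter> parity_range (3 - int i) else {})
        (orbit_int (3 + - 1 * int i - 1 + - 1 * int j) j)"
        by (rule exp_span_mono[OF exp_span_orbit_int]; unfold e)
          (use that in \<open>auto simp: parity_range_def\<close>)
      from exp_span_cosh_power[OF this, of i] show ?thesis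
      proof (rule exp_span_mono)
        have e': "int i + int j - 3 + int i = 2 * int i + int j - 3" "3 - int i + int i = 3" by simp_all
        show "parity_range (int i + int j - 3 + int i) \<union> parity_range (3 - int i + int i) \<subseteq> P"
          unfolding e' P_def parity_range_def using that by auto presburger+
        show "(if ?c then parity_range (int i + int j - 3 + int i) \<inter> parity_range (3 - int i + int i)
          else {}) \<subseteq> Q"
          unfolding e' Q_def by auto
      qed
    qed
    show "Q \<subseteq> P" unfolding P_def Q_def parity_range_def by auto
  qed (use \<tau> in \<open>auto simp: P_def finite_parity_range\<close>)
  \<comment> \<open>The count is at most 4 n + 1 for n \<ge> 2, 3 for n = 1, and exactly the claimed
    2 for n = 0.\<close>
  also have "card P + card Q - 2 \<le> (if n \<ge> 1 then 10 * n - 4 else 2)"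
    using card_parity_range_Un_le[of "if n \<ge> 2 then 2 * int n - 1 else 3" "2 * int n - 2"]
    unfolding P_def Q_def by (auto simp: card_parity_range)
  finally show ?thesis by simp
qed

lemma R19_R20_substitution:
  fixes h :: real
  assumes "h \<in> {1 / 2 ^ 6<..}"
  shows "arcosh (64 * h) > 0" "cosh (arcosh (64 * h)) / 64 = h"
    "((\<lambda>h. arcosh (64 * h)) has_real_derivative 64 * inverse (sinh (arcosh (64 * h)))) (at h)"
proof -
  have "64 * h > 1" using assms by simp
  then show "arcosh (64 * h) > 0" "cosh (arcosh (64 * h)) / 64 = h" using arcosh_pos by simp_all
  show "((\<lambda>h. arcosh (64 * h)) has_real_derivative 64 * inverse (sinh (arcosh (64 * h)))) (at h)"
    using \<open>64 * h > 1\<close> by (intro arcosh_deriv) (auto intro!: derivative_eq_intros)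
qed

lemma num_isolated_zeros_R19:
  "num_isolated_zeros (MM R19 n ap am bp bm) (Sigma_h R19) \<le> enat (if n \<ge> 4 then 4 * n - 3 else 11)"
proof -
  \<comment> \<open>The bounds are 2 i + 2 j - 5 \<le> 2 n - 3, always odd, and 5 - 2 i - j, at most
    4 because (0, 0) is excluded. For even j both are nonnegative only at (1, 2) and (0, 4), where
    the smaller one is 1; hence t occurs with frequencies 1 and -1 only.\<close>
  define P where "P = parity_range (if n \<ge> 3 then 2 * int n - 3 else 3) \<union> parity_range 4"
  have "num_isolated_zeros (MM R19 n ap am bp bm) {1 / 2 ^ 6<..} \<le> enat (card P + card (parity_range 1) - 2)"
  proof (rule num_isolated_zeros_orbit_sum[where \<tau> = "\<lambda>h. arcosh (64 * h)"
        and \<kappa> = "\<lambda>t. 64 * inverse (sinh t)" and \<phi> = "\<lambda>t. 1"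
        and A = "\<lambda>t. 1" and c = 1 and c' = "- 1" and \<alpha> = 2 and \<beta> = 1 and e = "- 5"
        and n = n and a = ap and b = bp and a' = am and b' = bm and B = "1 / 8" and B' = "- 1 / 8"])
    show "inj_on (\<lambda>h :: real. arcosh (64 * h)) {1 / 2 ^ 6<..}" 
      by (rule inj_on_inverseI[where g = "\<lambda>t. cosh t / 64"]) (rule R19_R20_substitution(2))
    show "smooth_fun (\<lambda>t. 64 * inverse (sinh t))"
      by (intro smooth_fun.mult smooth_fun_const smooth_fun.inv_sinh)
    show "MM R19 n ap am bp bm h = 1 * (1 * orbit_sum 2 1 (- 5) n ap bp 1 (1 / 8) (arcosh (64 * h))
        + - 1 * orbit_sum 2 1 (- 5) n am bm 1 (- 1 / 8) (arcosh (64 * h)))" if "h \<in> {1 / 2 ^ 6<..}" for h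
      using flow_integral_R19[OF R19_R20_substitution(1)[OF that], of 1 n bp ap]
        flow_integral_R19[OF R19_R20_substitution(1)[OF that], of "- 1" n bm am]
      unfolding R19_R20_substitution(2)[OF that]
      by (simp add: MM_def upper_arc_eq lower_arc_eq)
    show "exp_span P (parity_range 1) (\<lambda>t. 1 ^ i * orbit_int (- 5 + 2 * int i - 1 + 1 * int j) j t)"
      if "0 < i + j" "i + j \<le> n + 1" for i j
    proof (rule exp_span.scale, rule exp_span_mono[OF exp_span_orbit_int])
      have e: "- (- 5 + 2 * int i - 1 + 1 * int j) - 1 = 5 - 2 * int i - int j"
        "- 5 + 2 * int i - 1 + 1 * int j + int j + 1 = 2 * int i + 2 * int j - 5" by simp_all
      show "parity_range (- (- 5 + 2 * int i - 1 + 1 * int j) - 1)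
        \<union> parity_range (- 5 + 2 * int i - 1 + 1 * int j + int j + 1) \<subseteq> P"
        unfolding e P_def parity_range_def using that by auto
      show "(if even j then parity_range (- (- 5 + 2 * int i - 1 + 1 * int j) - 1)
        \<inter> parity_range (- 5 + 2 * int i - 1 + 1 * int j + int j + 1) else {}) \<subseteq> parity_range 1"
        unfolding e parity_range_def using that by auto
    qed
    show "parity_range 1 \<subseteq> P" unfolding P_def parity_range_def by auto
    show "arcosh (64 * h) > 0"
      "((\<lambda>h. arcosh (64 * h)) has_real_derivative 64 * inverse (sinh (arcosh (64 * h)))) (at h)"
      if "h \<in> {1 / 2 ^ 6<..}" for h
      using that by (rule R19_R20_substitution)+
  qed (simp_all add: P_def finite_parity_range smooth_fun_const)
  also have "card P + card (parity_range 1) - 2 \<le> (if n \<ge> 4 then 4 * n - 3 else 11)"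
    using card_parity_range_Un_le[of "if n \<ge> 3 then 2 * int n - 3 else 3" 4]
    unfolding P_def by (auto simp: card_parity_range)
  finally show ?thesis by simp
qed

lemma num_isolated_zeros_R20:
  "num_isolated_zeros (MM R20 n ap am bp bm) (Sigma_h R20) \<le> enat (if n \<ge> 3 then 4 * n + 3 else 8)"
proof -
  \<comment> \<open>The bounds are 3 - 2 i and 2 i + j - 3. For n \<le> 2 terms with t arise at (1,
    2) alone, with bound 1. Frequency 3 with a factor t requires i = 0 and j \<ge> 6; admitting it
    from n = 3 on still gives only 4 n + 1.\<close>
  define P where "P = parity_range (if n \<ge> 2 then 2 * int n - 1 else 3) \<union> parity_range (2 * int n - 2)"
  define Q where "Q = parity_range (if n \<ge> 3 then 3 else 1)"
  have "num_isolated_zeros (MM R20 n ap am bp bm) {1 / 2 ^ 6<..} \<le> enat (card P + card Q - 2)"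
  proof (rule num_isolated_zeros_orbit_sum[where \<tau> = "\<lambda>h. arcosh (64 * h)"
        and \<kappa> = "\<lambda>t. 64 * inverse (sinh t)" and \<phi> = "\<lambda>t. 1"
        and A = "\<lambda>t. 1" and c = 1 and c' = "- 1" and \<alpha> = 2 and \<beta> = 0 and e = "- 3"
        and n = n and a = ap and b = bp and a' = am and b' = bm and B = "1 / 8" and B' = "- 1 / 8"])
    show "inj_on (\<lambda>h :: real. arcosh (64 * h)) {1 / 2 ^ 6<..}" 
      by (rule inj_on_inverseI[where g = "\<lambda>t. cosh t / 64"]) (rule R19_R20_substitution(2))
    show "smooth_fun (\<lambda>t. 64 * inverse (sinh t))"
      by (intro smooth_fun.mult smooth_fun_const smooth_fun.inv_sinh)
    show "MM R20 n ap am bp bm h = 1 * (1 * orbit_sum 2 0 (- 3) n ap bp 1 (1 / 8) (arcosh (64 * h))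
        + - 1 * orbit_sum 2 0 (- 3) n am bm 1 (- 1 / 8) (arcosh (64 * h)))" if "h \<in> {1 / 2 ^ 6<..}" for h
      using flow_integral_R20[OF R19_R20_substitution(1)[OF that], of 1 n bp ap]
        flow_integral_R20[OF R19_R20_substitution(1)[OF that], of "- 1" n bm am]
      unfolding R19_R20_substitution(2)[OF that]
      by (simp add: MM_def upper_arc_eq lower_arc_eq)
    show "exp_span P Q (\<lambda>t. 1 ^ i * orbit_int (- 3 + 2 * int i - 1 + 0 * int j) j t)"
      if "0 < i + j" "i + j \<le> n + 1" for i j
    proof (rule exp_span.scale, rule exp_span_mono[OF exp_span_orbit_int])
      have e: "- (- 3 + 2 * int i - 1 + 0 * int j) - 1 = 3 - 2 * int i"
        "- 3 + 2 * int i - 1 + 0 * int j + int j + 1 = 2 * int i + int j - 3" by simp_all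
      show "parity_range (- (- 3 + 2 * int i - 1 + 0 * int j) - 1)
        \<union> parity_range (- 3 + 2 * int i - 1 + 0 * int j + int j + 1) \<subseteq> P"
        unfolding e P_def parity_range_def using that by auto presburger+
      show "(if even j then parity_range (- (- 3 + 2 * int i - 1 + 0 * int j) - 1)
        \<inter> parity_range (- 3 + 2 * int i - 1 + 0 * int j + int j + 1) else {}) \<subseteq> Q"
        unfolding e Q_def parity_range_def using that by auto
    qed
    show "Q \<subseteq> P" unfolding P_def Q_def parity_range_def by auto
    show "arcosh (64 * h) > 0"
      "((\<lambda>h. arcosh (64 * h)) has_real_derivative 64 * inverse (sinh (arcosh (64 * h)))) (at h)"
      if "h \<in> {1 / 2 ^ 6<..}" for h
      using that by (rule R19_R20_substitution)+
  qed (simp_all add: P_def finite_parity_range smooth_fun_const)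
  also have "card P + card Q - 2 \<le> (if n \<ge> 3 then 4 * n + 3 else 8)"
    using card_parity_range_Un_le[of "if n \<ge> 2 then 2 * int n - 1 else 3" "2 * int n - 2"]
    unfolding P_def Q_def by (auto simp: card_parity_range)
  finally show ?thesis by simp
qed

theorem theorem1p1:
  fixes n :: nat
    and ap am bp bm :: "nat \<Rightarrow> nat \<Rightarrow> real"
  shows
    "num_isolated_zeros (MM S1 n ap am bp bm) (Sigma_h S1) \<le> enat (4 * n + 30) \<and>
     num_isolated_zeros (MM S2 n ap am bp bm) (Sigma_h S2)
       \<le> enat (if n \<ge> 1 then 10 * n - 4 else 2) \<and>
     num_isolated_zeros (MM R19 n ap am bp bm) (Sigma_h R19)
       \<le> enat (if n \<ge> 4 then 4 * n - 3 else 11) \<and>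
     num_isolated_zeros (MM R20 n ap am bp bm) (Sigma_h R20)
       \<le> enat (if n \<ge> 3 then 4 * n + 3 else 8)"
  using num_isolated_zeros_S1 num_isolated_zeros_S2 num_isolated_zeros_R19 num_isolated_zeros_R20
  by blast

end
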